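(* Let $d\ge 2$ and let $D\subset\mathbb{C}^d$ be a bounded strongly $\mathbb{C}$-convex domain. Let $f:bD\to(0,\infty)$ be a bounded probability density function with respect to $\sigma$ that is bounded away from $0$. Let $\delta_n=\left(\frac{\log n}{n}\right)^{1/d}$, and for a continuous function $g:bD\to(0,\infty)$ put $\boldsymbol\delta_n(w)=g(w)\delta_n$. Let $\eta_n$ be the Poisson process on $bD$ with intensity measure $nf\sigma$, and let $\beta_n$ be the binomial process on $bD$ with $n$ points and density $f$. Then the following hold. (a) There exists $c_D>0$ such that for every continuous $g:bD\to(0,\infty)$ with $\min_{z\in bD}g(z)<c_D$, $$\mathbb{P}(P(\eta_n;\boldsymbol\delta_n)\subset D)\to 0\quad\text{as }n\to\infty .$$ (b) For any $\alpha>0$ there exists $C_D>0$ such that for every continuous $g:bD\to(0,\infty)$ with $\min_{z\in bD}g(z)>C_D$, $$\mathbb{P}(P(\eta_n;\boldsymbol\delta_n)\subset D)=1-\mathcal{O}(n^{-\alpha})\quad\text{as }n\to\infty .$$ (c) Both (a) and (b) also hold when $\eta_n$ is replaced by $\beta_n$.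
   Context: Notation: $\langle z,w\rangle=z_1w_1+\cdots+z_dw_d$ for $z,w\in\mathbb{C}^d$ (bilinear); $\|\cdot\|$ is the Euclidean norm; $bD$ is the boundary of $D$; $\sigma$ is Euclidean surface area measure on $bD$; $\partial\rho=(\partial\rho/\partial z_1,\dots,\partial\rho/\partial z_d)$ with $\partial/\partial z_j=\frac12(\partial/\partial x_j-i\,\partial/\partial y_j)$. Strongly $\mathbb{C}$-convex domain ($d\ge2$): a domain $D=\{z\in\mathbb{C}^d:\rho(z)<0\}$, where $\rho:\mathbb{C}^d\to\mathbb{R}$ is a $\mathcal{C}^2$ function whose gradient is nonvanishing on $bD$ (a defining function), such that for each $w\in bD$ and each nonzero $v$ in the complex tangent space $\mathcal{H}_wbD=\{v\in\mathbb{C}^d:\langle\partial\rho(w),v\rangle=0\}$, $$\sum_{j,k=1}^d\frac{\partial^2\rho}{\partial z_j\partial\bar z_k}(w)v_j\bar v_k+\operatorname{Re}\sum_{j,k=1}^d\frac{\partial^2\rho}{\partial z_j\partial z_k}(w)v_jv_k>0 .$$ Induced polyhedron: for a finite set $\varphi\subset bD$ and a function $\boldsymbol\delta:bD\to(0,\infty)$, $P(\varphi;\boldsymbol\delta)$ is the union of those connected components of $$\bigcap_{w\in\varphi}\left\{z\in\mathbb{C}^d:\frac{|\langle\partial\rho(w),w-z\rangle|}{\|\partial\rho(w)\|}>\boldsymbol\delta(w)\right\}$$ that intersect $D$ (an empty intersection is $\mathbb{C}^d$). This does not depend on the choice of $\rho$. Point processes: let $W^1,W^2,\dots$ be i.i.d.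 points on $bD$ with distribution $f\sigma$. Then $\beta_n=\{W^1,\dots,W^n\}$ and $\eta_n=\{W^1,\dots,W^{N_n}\}$, where $N_n$ is a Poisson random variable with mean $n$ independent of the $W^i$. *)

theory Defs
  imports "HOL-Probability.Probability" "HOL-Library.Landau_Symbols"
begin

section \<open>Differential calculus on complex Euclidean space\<close>

text \<open>The pairing is bilinear; no conjugation is involved.\<close>

definition cpair :: "complex ^ 'd \<Rightarrow> complex ^ 'd \<Rightarrow> complex" where
  "cpair z w = (\<Sum>j\<in>UNIV. z $ j * w $ j)"

text \<open>All derivatives are real derivatives: \<^typ>\<open>complex ^ 'd\<close> is a real Euclidean space of
  dimension \<open>2 * CARD('d)\<close>, with \<open>x\<close>-directions \<open>axis j 1\<close> and \<open>y\<close>-directions \<open>axis j \<i>\<close>.\<close>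

definition C1_function :: "('a::real_normed_vector \<Rightarrow> 'b::real_normed_vector) \<Rightarrow> bool" where
  "C1_function F \<longleftrightarrow> (\<forall>x. F differentiable (at x)) \<and>
     (\<forall>v. continuous_on UNIV (\<lambda>x. frechet_derivative F (at x) v))"

definition C2_function :: "('a::real_normed_vector \<Rightarrow> 'b::real_normed_vector) \<Rightarrow> bool" where
  "C2_function F \<longleftrightarrow> C1_function F \<and> (\<forall>v. C1_function (\<lambda>x. frechet_derivative F (at x) v))"

definition dz :: "'d \<Rightarrow> (complex ^ 'd \<Rightarrow> complex) \<Rightarrow> complex ^ 'd \<Rightarrow> complex" where
  "dz j F w = (frechet_derivative F (at w) (axis j 1)
                 - \<i> * frechet_derivative F (at w) (axis j \<i>)) / 2"

definition dzbar :: "'d \<Rightarrow> (complex ^ 'd \<Rightarrow> complex) \<Rightarrow> complex ^ 'd \<Rightarrow> complex" where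
  "dzbar j F w = (frechet_derivative F (at w) (axis j 1)
                    + \<i> * frechet_derivative F (at w) (axis j \<i>)) / 2"

definition del :: "(complex ^ 'd \<Rightarrow> real) \<Rightarrow> complex ^ 'd \<Rightarrow> complex ^ 'd" where
  "del \<rho> w = (\<chi> j. dz j (\<lambda>x. complex_of_real (\<rho> x)) w)"

definition complex_tangent_space :: "(complex ^ 'd \<Rightarrow> real) \<Rightarrow> complex ^ 'd \<Rightarrow> (complex ^ 'd) set" where
  "complex_tangent_space \<rho> w = {v. cpair (del \<rho> w) v = 0}"


section \<open>Strongly C-convex domains and induced polyhedra\<close>

definition strongly_C_convex_domain :: "(complex ^ 'd) set \<Rightarrow> (complex ^ 'd \<Rightarrow> real) \<Rightarrow> bool" where
  "strongly_C_convex_domain D \<rho> \<longleftrightarrow>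
     open D \<and> connected D \<and> D \<noteq> {} \<and> D = {z. \<rho> z < 0} \<and> C2_function \<rho> \<and>
     (\<forall>w\<in>frontier D. frechet_derivative \<rho> (at w) \<noteq> (\<lambda>v. 0)) \<and>
     (\<forall>w\<in>frontier D. \<forall>v\<in>complex_tangent_space \<rho> w. v \<noteq> 0 \<longrightarrow>
        Re (\<Sum>j\<in>UNIV. \<Sum>k\<in>UNIV. dz j (dzbar k (\<lambda>x. complex_of_real (\<rho> x))) w * v $ j * cnj (v $ k))
        + Re (\<Sum>j\<in>UNIV. \<Sum>k\<in>UNIV. dz j (dz k (\<lambda>x. complex_of_real (\<rho> x))) w * v $ j * v $ k) > 0)"

text \<open>The first of the two sums above is a Hermitian form and hence real; \<^const>\<open>Re\<close> only changes its type.\<close>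

definition induced_polyhedron ::
  "(complex ^ 'd) set \<Rightarrow> (complex ^ 'd \<Rightarrow> real) \<Rightarrow> (complex ^ 'd) set \<Rightarrow> (complex ^ 'd \<Rightarrow> real)
     \<Rightarrow> (complex ^ 'd) set" where
  "induced_polyhedron D \<rho> \<phi> \<delta> =
     \<Union> {C \<in> components (\<Inter>w\<in>\<phi>. {z. cmod (cpair (del \<rho> w) (w - z)) / norm (del \<rho> w) > \<delta> w}).
           C \<inter> D \<noteq> {}}"


section \<open>Euclidean surface area\<close>

text \<open>Surface area on a hypersurface is Hausdorff measure of codimension one. The normalisation is
  the one for which \<open>k\<close>-dimensional Hausdorff measure agrees with \<open>k\<close>-dimensional Lebesgue measure
  on \<open>k\<close>-dimensional subspaces. The empty set has gauge 0 also when \<open>k = 0\<close>.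
  Covering sets are required to be bounded because
  \<^const>\<open>diameter\<close> is meaningless for unbounded sets.\<close>

definition hausdorff_gauge :: "nat \<Rightarrow> 'a::metric_space set \<Rightarrow> ennreal" where
  "hausdorff_gauge k U =
     (if U = {} then 0 else ennreal (unit_ball_vol (real k) * (diameter U / 2) ^ k))"

definition hausdorff_content :: "nat \<Rightarrow> real \<Rightarrow> 'a::metric_space set \<Rightarrow> ennreal" where
  "hausdorff_content k r A =
     (INF U \<in> {U :: nat \<Rightarrow> 'a set. A \<subseteq> (\<Union>i. U i) \<and> (\<forall>i. bounded (U i) \<and> diameter (U i) \<le> r)}.
        \<Sum>i. hausdorff_gauge k (U i))"

definition hausdorff_outer :: "nat \<Rightarrow> 'a::metric_space set \<Rightarrow> ennreal" where
  "hausdorff_outer k A = (SUP r\<in>{0<..}. hausdorff_content k r A)"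

text \<open>By Caratheodory's criterion for metric outer measures, \<^const>\<open>hausdorff_outer\<close> is countably
  additive on Borel sets, so \<^const>\<open>measure_of\<close> below really has it as its values.\<close>

definition hausdorff_measure :: "nat \<Rightarrow> 'a::metric_space measure" where
  "hausdorff_measure k = measure_of UNIV (sets borel) (hausdorff_outer k)"

definition surface_measure :: "'a::euclidean_space set \<Rightarrow> 'a measure" where
  "surface_measure S = restrict_space (hausdorff_measure (DIM('a) - 1)) S"


section \<open>Point processes\<close>

text \<open>The sequence is indexed from 0. Since \<open>S\<close> is a measure whose space is the hypersurface,
  \<^const>\<open>distributed\<close> makes all points lie on it.\<close>

definition iid_points :: "'s measure \<Rightarrow> 'a measure \<Rightarrow> ('a \<Rightarrow> real) \<Rightarrow> (nat \<Rightarrow> 's \<Rightarrow> 'a) \<Rightarrow> bool" where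
  "iid_points M S f W \<longleftrightarrow>
     prob_space.indep_vars M (\<lambda>_. S) W UNIV \<and>
     (\<forall>i. distributed M S (W i) (\<lambda>z. ennreal (f z)))"

text \<open>The count and the sequence of points take values in different types, so their independence is
  expressed by the generated sigma-algebras (\<open>indep_var\<close> needs a common type).\<close>

definition poisson_count_indep ::
  "'s measure \<Rightarrow> 'a measure \<Rightarrow> (nat \<Rightarrow> 's \<Rightarrow> 'a) \<Rightarrow> real \<Rightarrow> ('s \<Rightarrow> nat) \<Rightarrow> bool" where
  "poisson_count_indep M S W rate N \<longleftrightarrow>
     N \<in> measurable M (count_space UNIV) \<and>
     distr M (count_space UNIV) N = measure_pmf (poisson_pmf rate) \<and>
     prob_space.indep_set M
       (sets (vimage_algebra (space M) N (count_space UNIV)))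
       (sets (vimage_algebra (space M) (\<lambda>\<omega> i. W i \<omega>) (PiM UNIV (\<lambda>_. S))))"

definition binomial_process :: "(nat \<Rightarrow> 's \<Rightarrow> 'a) \<Rightarrow> nat \<Rightarrow> 's \<Rightarrow> 'a set" where
  "binomial_process W n \<omega> = (\<lambda>i. W i \<omega>) ` {..<n}"

definition poisson_process :: "(nat \<Rightarrow> 's \<Rightarrow> 'a) \<Rightarrow> (nat \<Rightarrow> 's \<Rightarrow> nat) \<Rightarrow> nat \<Rightarrow> 's \<Rightarrow> 'a set" where
  "poisson_process W N n \<omega> = (\<lambda>i. W i \<omega>) ` {..<N n \<omega>}"

definition delta_seq :: "nat \<Rightarrow> nat \<Rightarrow> real" where
  "delta_seq d n = (ln (real n) / real n) powr (1 / real d)"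

text \<open>Probability that the polyhedron induced by a random set \<open>\<Phi>\<close> of points, with
  \<open>\<delta>(w) = g(w) * \<delta>\<^sub>n\<close>, is contained in the domain.\<close>

definition prob_inside ::
  "'s measure \<Rightarrow> (complex ^ 'd) set \<Rightarrow> (complex ^ 'd \<Rightarrow> real) \<Rightarrow> (complex ^ 'd \<Rightarrow> real)
     \<Rightarrow> nat \<Rightarrow> ('s \<Rightarrow> (complex ^ 'd) set) \<Rightarrow> real" where
  "prob_inside M D \<rho> g n \<Phi> =
     measure M {\<omega> \<in> space M. induced_polyhedron D \<rho> (\<Phi> \<omega>) (\<lambda>w. g w * delta_seq CARD('d) n) \<subseteq> D}"

definition positive_continuous_on :: "'a::topological_space set \<Rightarrow> ('a \<Rightarrow> real) \<Rightarrow> bool" where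
  "positive_continuous_on S g \<longleftrightarrow> continuous_on S g \<and> (\<forall>z\<in>S. g z > 0)"

end

theory Submission imports Defs
begin

text \<open>For a boundary point \<open>w\<close> let \<open>ell w\<close> be the linear form \<open>\<langle>\<partial>\<rho>(w), \<cdot>\<rangle> / \<parallel>\<partial>\<rho>(w)\<parallel>\<close>, so that
  \<open>\<bar>ell w (w - z)\<bar>\<close> is the distance from \<open>z\<close> to the complex tangent hyperplane at \<open>w\<close>. The polyhedron
  lies in \<open>D\<close> as soon as every boundary point \<open>z\<close> is blocked by some random point \<open>w\<close>, meaning
  \<open>\<bar>ell w (w - z)\<bar> \<le> \<delta>(w)\<close>, because a component that leaves \<open>D\<close> has to cross the boundary. Conversely
  one unblocked boundary point lets a component escape. So the question is whether random caps
  \<open>{w. \<bar>ell w (w - z)\<bar> \<le> \<delta>}\<close> are all hit, for centres \<open>z\<close> all over the boundary.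

  The key estimate is that such a cap has surface area comparable to \<open>\<delta> ^ d\<close>
  (\<open>cap_hausdorff_lower_bound\<close>, \<open>cap_hausdorff_upper_bound\<close>): it extends by about \<open>\<delta>\<close> in one real
  tangent direction and by about \<open>sqrt \<delta>\<close> in the \<open>2 * d - 2\<close> complex tangent directions. For
  \<open>\<delta> = C * (ln n / n) powr (1 / d)\<close> a given cap is therefore missed with a probability between two powers
  of \<open>1 / n\<close> whose exponents are multiples of \<open>C ^ d\<close>. If \<open>C\<close> is large, a union bound over a net of
  \<open>O(n\<^sup>2)\<close> centres is enough. If \<open>C\<close> is small, then among a positive power of \<open>n\<close> disjoint caps near the
  point where \<open>g\<close> is small the expected number of missed caps tends to infinity, and the second moment
  method shows that one of them is missed with probability tending to one.

  The upper bound for the area, and the localisation that makes only the value of \<open>g\<close> near one point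
  matter, need the global inequality \<open>\<bar>ell w (w - z)\<bar> \<ge> \<kappa> * (norm (w - z))\<^sup>2\<close> for all boundary points
  \<open>w\<close> and \<open>z\<close>. Near the diagonal it is Taylor's formula together with strong C-convexity. Away from the
  diagonal it says that a complex tangent hyperplane touches the closed domain only once, which is a
  passage from local to global convexity: all slices of \<open>D\<close> by complex lines are connected, because
  being joined inside the slice is an open and closed condition on pairs of points of \<open>D\<close>
  (\<open>line_slices_connected\<close>, \<open>complex_tangent_avoids_closure\<close>).

  The event in question has to be measurable, since its complement is what is estimated. A component
  that leaves \<open>D\<close> contains a compact connected set from a countable family that does so as well, and for
  each such set the random points that would block it form a compact set
  (\<open>measurable_polyhedron_inside\<close>).\<close>

section \<open>Second-order calculus\<close>

definition hess :: "('a::real_normed_vector \<Rightarrow> real) \<Rightarrow> 'a \<Rightarrow> 'a \<Rightarrow> 'a \<Rightarrow> real" where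
  "hess \<rho> x u v = frechet_derivative (\<lambda>y. frechet_derivative \<rho> (at y) u) (at x) v"

lemma C2_has_derivative:
  assumes "C2_function \<rho>"
  shows "(\<rho> has_derivative frechet_derivative \<rho> (at x)) (at x)"
    and "((\<lambda>y. frechet_derivative \<rho> (at y) u) has_derivative hess \<rho> x u) (at x)"
    and "continuous_on UNIV (\<lambda>x. frechet_derivative \<rho> (at x) u)"
    and "continuous_on UNIV (\<lambda>x. hess \<rho> x u v)"
  using assms unfolding C2_function_def C1_function_def hess_def[abs_def]
  by (auto simp: frechet_derivative_works[symmetric])

lemma C2_deriv_linear:
  assumes "C2_function \<rho>" shows "linear (frechet_derivative \<rho> (at x))" "linear (hess \<rho> x u)"
  using C2_has_derivative(1,2)[OF assms] has_derivative_linear by blast+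

lemma C2_continuous: fixes \<rho> :: "'a::real_normed_vector \<Rightarrow> real" assumes "C2_function \<rho>" shows "continuous_on X \<rho>"
  using C2_has_derivative(1)[OF assms]
  by (meson has_derivative_continuous continuous_at_imp_continuous_on)

lemma hess_linear_left:
  assumes "C2_function \<rho>" shows "linear (\<lambda>u. hess \<rho> x u v)"
proof (rule linearI)
  fix u u' :: 'a and r :: real
  have *: "frechet_derivative \<rho> (at y) (u + u') = frechet_derivative \<rho> (at y) u + frechet_derivative \<rho> (at y) u'"
     "frechet_derivative \<rho> (at y) (r *\<^sub>R u) = r * frechet_derivative \<rho> (at y) u" for y
    using C2_deriv_linear(1)[OF assms, of y] by (simp_all add: linear_add linear_scale)
  have "((\<lambda>y. frechet_derivative \<rho> (at y) u + frechet_derivative \<rho> (at y) u') has_derivative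
      (\<lambda>v. hess \<rho> x u v + hess \<rho> x u' v)) (at x)"
    by (intro has_derivative_add C2_has_derivative assms)
  from frechet_derivative_at[OF this]
  show "hess \<rho> x (u + u') v = hess \<rho> x u v + hess \<rho> x u' v"
    unfolding * hess_def[of _ _ "u+u'"] by metis
  have "((\<lambda>y. r * frechet_derivative \<rho> (at y) u) has_derivative
      (\<lambda>v. r * hess \<rho> x u v)) (at x)"
    by (intro has_derivative_mult_right C2_has_derivative assms)
  from frechet_derivative_at[OF this]
  show "hess \<rho> x (r *\<^sub>R u) v = r *\<^sub>R hess \<rho> x u v"
    unfolding * hess_def[of _ _ "r *\<^sub>R u"] real_scaleR_def by metis
qed

lemma hess_basis:
  fixes \<rho> :: "'a::euclidean_space \<Rightarrow> real"
  assumes "C2_function \<rho>"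
  shows "hess \<rho> x u v = (\<Sum>b\<in>Basis. \<Sum>c\<in>Basis. (u \<bullet> b) * (v \<bullet> c) * hess \<rho> x b c)"
proof -
  have "hess \<rho> x u v = (\<Sum>b\<in>Basis. (u \<bullet> b) * hess \<rho> x b v)"
    by (subst euclidean_representation[of u, symmetric])
       (simp add: linear_sum[OF hess_linear_left[OF assms]] linear_scale[OF hess_linear_left[OF assms]])
  also have "\<dots> = (\<Sum>b\<in>Basis. (u \<bullet> b) * (\<Sum>c\<in>Basis. (v \<bullet> c) * hess \<rho> x b c))"
    by (subst euclidean_representation[of v, symmetric])
       (simp add: linear_sum[OF C2_deriv_linear(2)[OF assms]] linear_scale[OF C2_deriv_linear(2)[OF assms]])
  finally show ?thesis by (simp add: sum_distrib_left mult.assoc)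
qed

lemma bilinear_form_bound:
  fixes u v :: "'a::euclidean_space"
  shows "\<bar>\<Sum>b\<in>Basis. \<Sum>c\<in>Basis. (u \<bullet> b) * (v \<bullet> c) * A b c\<bar>
    \<le> (\<Sum>b\<in>Basis. \<Sum>c\<in>Basis. \<bar>A b c\<bar>) * (norm u * norm v)"
proof -
  have "\<bar>\<Sum>b\<in>Basis. \<Sum>c\<in>Basis. (u \<bullet> b) * (v \<bullet> c) * A b c\<bar>
      \<le> (\<Sum>b\<in>Basis. \<Sum>c\<in>Basis. \<bar>(u \<bullet> b) * (v \<bullet> c) * A b c\<bar>)"
    by (rule order_trans[OF sum_abs]) (intro sum_mono sum_abs)
  also have "\<dots> \<le> (\<Sum>b\<in>Basis. \<Sum>c\<in>Basis. \<bar>A b c\<bar> * (norm u * norm v))"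
    by (intro sum_mono) (auto simp: abs_mult mult.commute[of "_ * _" "\<bar>A _ _\<bar>"]
        intro!: mult_left_mono mult_mono Basis_le_norm)
  finally show ?thesis by (simp add: sum_distrib_right)
qed

lemma hess_diff_bound:
  fixes \<rho> :: "'a::euclidean_space \<Rightarrow> real"
  assumes "C2_function \<rho>"
  shows "\<bar>hess \<rho> x u v - hess \<rho> y u v\<bar> \<le> (\<Sum>b\<in>Basis. \<Sum>c\<in>Basis. \<bar>hess \<rho> x b c - hess \<rho> y b c\<bar>) * (norm u * norm v)"
  using bilinear_form_bound[of u v "\<lambda>b c. hess \<rho> x b c - hess \<rho> y b c"]
  unfolding hess_basis[OF assms, of x u v] hess_basis[OF assms, of y u v]
  by (simp add: sum_subtractf right_diff_distrib)

lemma hess_bound: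
  fixes \<rho> :: "'a::euclidean_space \<Rightarrow> real"
  assumes "C2_function \<rho>"
  shows "\<bar>hess \<rho> x u v\<bar> \<le> (\<Sum>b\<in>Basis. \<Sum>c\<in>Basis. \<bar>hess \<rho> x b c\<bar>) * (norm u * norm v)"
  unfolding hess_basis[OF assms, of x u v] by (rule bilinear_form_bound)

lemma hess_bounded_on_compact:
  fixes \<rho> :: "'a::euclidean_space \<Rightarrow> real"
  assumes "C2_function \<rho>" "compact X"
  obtains B where "B > 0" "\<And>x u v. x \<in> X \<Longrightarrow> \<bar>hess \<rho> x u v\<bar> \<le> B * (norm u * norm v)"
proof -
  have "continuous_on X (\<lambda>x. \<Sum>b\<in>Basis. \<Sum>c\<in>Basis. \<bar>hess \<rho> x b c\<bar>)"
    by (intro continuous_intros continuous_on_subset[OF C2_has_derivative(4)[OF assms(1)]]) auto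
  then have "bounded ((\<lambda>x. \<Sum>b\<in>Basis. \<Sum>c\<in>Basis. \<bar>hess \<rho> x b c\<bar>) ` X)"
    by (intro compact_imp_bounded compact_continuous_image assms)
  then obtain B where B: "B > 0" "\<And>x. x \<in> X \<Longrightarrow> \<bar>\<Sum>b\<in>Basis. \<Sum>c\<in>Basis. \<bar>hess \<rho> x b c\<bar>\<bar> \<le> B"
    unfolding bounded_pos by auto
  show ?thesis
  proof (rule that[OF B(1)])
    fix x u v :: 'a assume "x \<in> X"
    then have "(\<Sum>b\<in>Basis. \<Sum>c\<in>Basis. \<bar>hess \<rho> x b c\<bar>) \<le> B" using B(2) by fastforce
    then show "\<bar>hess \<rho> x u v\<bar> \<le> B * (norm u * norm v)"
      by (intro order_trans[OF hess_bound[OF assms(1)]] mult_right_mono) auto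
  qed
qed

lemma C2_line_derivatives:
  assumes "C2_function \<rho>"
  shows "((\<lambda>s. \<rho> (w + s *\<^sub>R v)) has_real_derivative frechet_derivative \<rho> (at (w + s *\<^sub>R v)) v) (at s)"
    and "((\<lambda>s. frechet_derivative \<rho> (at (w + s *\<^sub>R v)) v) has_real_derivative hess \<rho> (w + s *\<^sub>R v) v v) (at s)"
proof -
  have line: "((\<lambda>s. w + s *\<^sub>R v) has_derivative (\<lambda>h. h *\<^sub>R v)) (at s)"
    by (auto intro!: derivative_eq_intros)
  show "((\<lambda>s. \<rho> (w + s *\<^sub>R v)) has_real_derivative frechet_derivative \<rho> (at (w + s *\<^sub>R v)) v) (at s)"
    using has_derivative_compose[OF line C2_has_derivative(1)[OF assms]]
    by (simp add: has_field_derivative_def linear_scale[OF C2_deriv_linear(1)[OF assms]] mult_commute_abs)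
  show "((\<lambda>s. frechet_derivative \<rho> (at (w + s *\<^sub>R v)) v) has_real_derivative hess \<rho> (w + s *\<^sub>R v) v v) (at s)"
    using has_derivative_compose[OF line C2_has_derivative(2)[OF assms]]
    by (simp add: has_field_derivative_def linear_scale[OF C2_deriv_linear(2)[OF assms]] mult_commute_abs)
qed

lemma Taylor_C2:
  assumes "C2_function \<rho>"
  obtains t where "0 < t" "t < 1"
    "\<rho> (w + v) = \<rho> w + frechet_derivative \<rho> (at w) v + hess \<rho> (w + t *\<^sub>R v) v v / 2"
proof -
  define diff where "diff m s = (if m = 0 then \<rho> (w + s *\<^sub>R v)
     else if m = 1 then frechet_derivative \<rho> (at (w + s *\<^sub>R v)) v else hess \<rho> (w + s *\<^sub>R v) v v)" for m :: nat and s
  note d = C2_line_derivatives[OF assms, of w v]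
  have "\<exists>t>0. t < 1 \<and> \<rho> (w + 1 *\<^sub>R v) = (\<Sum>m<2. diff m 0 / fact m * 1 ^ m) + diff 2 t / fact 2 * 1 ^ 2"
  proof (rule Maclaurin)
    show "\<forall>m t. m < 2 \<and> 0 \<le> t \<and> t \<le> 1 \<longrightarrow> DERIV (diff m) t :> diff (Suc m) t"
    proof safe
      fix m :: nat and t :: real assume "m < 2"
      then consider "m = 0" | "m = 1" by linarith
      then show "DERIV (diff m) t :> diff (Suc m) t"
        by cases (simp_all add: diff_def[abs_def] d)
    qed
  qed (auto simp: diff_def)
  then show ?thesis using that by (auto simp: diff_def numeral_2_eq_2)
qed

section \<open>The complex derivative and Wirtinger second derivatives\<close>

lemma cpair_add: "cpair d (u + v) = cpair d u + cpair d v"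
  and cpair_diff: "cpair d (u - v) = cpair d u - cpair d v"
  and cpair_scaleR: "cpair d (r *\<^sub>R v) = of_real r * cpair d v"
  and cpair_scale: "cpair d (c *s v) = c * cpair d v"
  and cpair_diff_left: "cpair (d - e) v = cpair d v - cpair e v"
  unfolding cpair_def
  by (simp_all add: algebra_simps sum.distrib sum_subtractf sum_distrib_left scaleR_conv_of_real[where 'a=complex])

lemma norm_cpair_le: "cmod (cpair d v) \<le> norm d * norm v"
proof -
  have "cmod (cpair d v) \<le> (\<Sum>j\<in>UNIV. \<bar>norm (d $ j)\<bar> * \<bar>norm (v $ j)\<bar>)"
    unfolding cpair_def by (rule order_trans[OF norm_sum]) (simp add: norm_mult)
  also have "\<dots> \<le> norm d * norm v"
    unfolding norm_vec_def by (rule L2_set_mult_ineq)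
  finally show ?thesis .
qed

lemma norm_vector_scale: "norm (c *s (v :: complex ^ 'd)) = cmod c * norm v"
  unfolding norm_vec_def by (simp add: norm_mult L2_set_right_distrib)

lemma complex_vec_decomp:
  "v = (\<Sum>j\<in>UNIV. Re (v $ j) *\<^sub>R axis j 1 + Im (v $ j) *\<^sub>R axis j \<i>)"
proof (rule vec_eq_iff[THEN iffD2], rule allI)
  fix i
  have "(\<Sum>j\<in>UNIV. Re (v $ j) *\<^sub>R axis j 1 + Im (v $ j) *\<^sub>R axis j \<i>) $ i
    = (\<Sum>j\<in>UNIV. if j = i then v $ i else 0)"
    unfolding sum_component by (rule sum.cong) (auto simp: axis_def complex_eq_iff)
  then show "v $ i = (\<Sum>j\<in>UNIV. Re (v $ j) *\<^sub>R axis j 1 + Im (v $ j) *\<^sub>R axis j \<i>) $ i" by simp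
qed

lemma frechet_derivative_of_real:
  assumes "(h has_derivative h') (at w)"
  shows "frechet_derivative (\<lambda>x. complex_of_real (h x)) (at w) = (\<lambda>v. of_real (h' v))"
  using frechet_derivative_at[OF has_derivative_of_real[OF assms]] by metis

lemma del_component:
  fixes \<rho> :: "complex ^ 'd \<Rightarrow> real"
  assumes "C2_function \<rho>"
  shows "del \<rho> w $ j = (of_real (frechet_derivative \<rho> (at w) (axis j 1))
            - \<i> * of_real (frechet_derivative \<rho> (at w) (axis j \<i>))) / 2"
  unfolding del_def dz_def frechet_derivative_of_real[OF C2_has_derivative(1)[OF assms]] by simp

lemma frechet_derivative_eq_del:
  fixes \<rho> :: "complex ^ 'd \<Rightarrow> real"
  assumes "C2_function \<rho>"
  shows "frechet_derivative \<rho> (at w) v = 2 * Re (cpair (del \<rho> w) v)"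
proof -
  let ?D = "frechet_derivative \<rho> (at w)"
  have l: "linear ?D" by (rule C2_deriv_linear[OF assms])
  have "?D v = (\<Sum>j\<in>UNIV. Re (v $ j) * ?D (axis j 1) + Im (v $ j) * ?D (axis j \<i>))"
    by (subst complex_vec_decomp[of v]) (simp add: linear_sum[OF l] linear_add[OF l] linear_scale[OF l])
  also have "\<dots> = 2 * Re (cpair (del \<rho> w) v)"
    unfolding cpair_def del_component[OF assms] Re_sum sum_distrib_left
    by (rule sum.cong) (auto simp: algebra_simps)
  finally show ?thesis .
qed

text \<open>Expand \<open>v $ j = a j + \<i> * b j\<close> and the Wirtinger operators. In the real part of the sum of the two
  forms the contributions of \<open>cnj (v $ k)\<close> and \<open>v $ k\<close> to each real second derivative either agree or
  cancel, and what remains is half of the Hessian applied twice to \<open>v\<close>, which is exactly the second-order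
  term of Taylor's formula.\<close>

lemma wirtinger_hessian:
  fixes \<rho> :: "complex ^ 'd \<Rightarrow> real"
  assumes C2: "C2_function \<rho>"
  shows "Re (\<Sum>j\<in>UNIV. \<Sum>k\<in>UNIV. dz j (dzbar k (\<lambda>x. complex_of_real (\<rho> x))) w * v $ j * cnj (v $ k))
        + Re (\<Sum>j\<in>UNIV. \<Sum>k\<in>UNIV. dz j (dz k (\<lambda>x. complex_of_real (\<rho> x))) w * v $ j * v $ k)
     = hess \<rho> w v v / 2"
proof -
  let ?e = "\<lambda>j. axis j 1 :: complex ^ 'd" and ?f = "\<lambda>j. axis j \<i> :: complex ^ 'd"
  let ?H = "hess \<rho> w"
  have D: "frechet_derivative (\<lambda>x. complex_of_real (\<rho> x)) (at x) u = of_real (frechet_derivative \<rho> (at x) u)" for x u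
    by (simp add: frechet_derivative_of_real[OF C2_has_derivative(1)[OF C2]])
  have bar: "((\<lambda>x. dzbar k (\<lambda>x. complex_of_real (\<rho> x)) x) has_derivative
     (\<lambda>h. (of_real (?H (?e k) h) + \<i> * of_real (?H (?f k) h)) / 2)) (at w)" for k
    unfolding dzbar_def D
    by (intro bounded_linear.has_derivative[OF bounded_linear_divide] has_derivative_add has_derivative_diff
        has_derivative_mult_right has_derivative_of_real C2_has_derivative(2)[OF C2])
  have hol: "((\<lambda>x. dz k (\<lambda>x. complex_of_real (\<rho> x)) x) has_derivative
     (\<lambda>h. (of_real (?H (?e k) h) - \<i> * of_real (?H (?f k) h)) / 2)) (at w)" for k
    unfolding dz_def D
    by (intro bounded_linear.has_derivative[OF bounded_linear_divide] has_derivative_add has_derivative_diff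
        has_derivative_mult_right has_derivative_of_real C2_has_derivative(2)[OF C2])
  have A: "dz j (dzbar k (\<lambda>x. complex_of_real (\<rho> x))) w
     = (of_real (?H (?e k) (?e j)) + \<i> * of_real (?H (?f k) (?e j))
        - \<i> * (of_real (?H (?e k) (?f j)) + \<i> * of_real (?H (?f k) (?f j)))) / 4" for j k
    unfolding dz_def[of j] frechet_derivative_at[OF bar[of k], symmetric] by (simp add: field_simps)
  have B: "dz j (dz k (\<lambda>x. complex_of_real (\<rho> x))) w
     = (of_real (?H (?e k) (?e j)) - \<i> * of_real (?H (?f k) (?e j))
        - \<i> * (of_real (?H (?e k) (?f j)) - \<i> * of_real (?H (?f k) (?f j)))) / 4" for j k
    unfolding dz_def[of j] frechet_derivative_at[OF hol[of k], symmetric] by (simp add: field_simps)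
  note ll = hess_linear_left[OF C2] and lr = C2_deriv_linear(2)[OF C2]
  have vv: "?H u v = (\<Sum>j\<in>UNIV. Re (v $ j) * ?H u (?e j) + Im (v $ j) * ?H u (?f j))" for u
    by (subst complex_vec_decomp[of v]) (simp add: linear_sum[OF lr] linear_add[OF lr] linear_scale[OF lr])
  have "?H v v = (\<Sum>k\<in>UNIV. Re (v $ k) * ?H (?e k) v + Im (v $ k) * ?H (?f k) v)"
    by (subst (1) complex_vec_decomp[of v]) (simp add: linear_sum[OF ll] linear_add[OF ll] linear_scale[OF ll])
  also have "\<dots> = (\<Sum>k\<in>UNIV. \<Sum>j\<in>UNIV. Re (v $ k) * (Re (v $ j) * ?H (?e k) (?e j) + Im (v $ j) * ?H (?e k) (?f j))
     + Im (v $ k) * (Re (v $ j) * ?H (?f k) (?e j) + Im (v $ j) * ?H (?f k) (?f j)))"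
    by (simp only: vv sum_distrib_left sum.distrib distrib_left)
  also have "\<dots> = (\<Sum>j\<in>UNIV. \<Sum>k\<in>UNIV. Re (v $ k) * (Re (v $ j) * ?H (?e k) (?e j) + Im (v $ j) * ?H (?e k) (?f j))
     + Im (v $ k) * (Re (v $ j) * ?H (?f k) (?e j) + Im (v $ j) * ?H (?f k) (?f j)))"
    by (rule sum.swap)
  finally have H: "?H v v / 2 = (\<Sum>j\<in>UNIV. \<Sum>k\<in>UNIV. (Re (v $ k) * (Re (v $ j) * ?H (?e k) (?e j) + Im (v $ j) * ?H (?e k) (?f j))
     + Im (v $ k) * (Re (v $ j) * ?H (?f k) (?e j) + Im (v $ j) * ?H (?f k) (?f j))) / 2)"
    by (simp add: sum_divide_distrib)
  show ?thesis
    unfolding H A B Re_sum sum.distrib[symmetric]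
    by (intro sum.cong refl) (simp add: field_simps)
qed


text \<open>Normalised such that \<open>cmod (nform \<rho> w (w - z))\<close> is the distance from \<open>z\<close> to the complex tangent hyperplane
  at \<open>w\<close>, the quantity in the definition of the induced polyhedron.\<close>

definition nform :: "(complex ^ 'd \<Rightarrow> real) \<Rightarrow> complex ^ 'd \<Rightarrow> complex ^ 'd \<Rightarrow> complex" where
  "nform \<rho> w v = cpair (del \<rho> w) v / of_real (norm (del \<rho> w))"

text \<open>The outer unit normal of \<open>{z. \<rho> z < 0}\<close> at a boundary point \<open>w\<close>: the real gradient is twice the conjugate of \<open>del \<rho> w\<close>.\<close>

definition nvec :: "(complex ^ 'd \<Rightarrow> real) \<Rightarrow> complex ^ 'd \<Rightarrow> complex ^ 'd" where
  "nvec \<rho> w = (\<chi> j. cnj (del \<rho> w $ j) / of_real (norm (del \<rho> w)))"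

lemma norm_nform: "cmod (nform \<rho> w v) = cmod (cpair (del \<rho> w) v) / norm (del \<rho> w)"
  by (simp add: nform_def norm_divide)

lemma nform_add: "nform \<rho> w (u + v) = nform \<rho> w u + nform \<rho> w v"
  and nform_diff: "nform \<rho> w (u - v) = nform \<rho> w u - nform \<rho> w v"
  and nform_scaleR: "nform \<rho> w (r *\<^sub>R v) = of_real r * nform \<rho> w v"
  and nform_scale: "nform \<rho> w (c *s v) = c * nform \<rho> w v"
  by (simp_all add: nform_def cpair_add cpair_diff cpair_scaleR cpair_scale
      add_divide_distrib diff_divide_distrib)

lemma norm_nform_le: "cmod (nform \<rho> w v) \<le> norm v"
proof (cases "del \<rho> w = 0")
  case False
  then show ?thesis
    unfolding norm_nform using norm_cpair_le[of "del \<rho> w" v] by (simp add: field_simps)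
qed (simp add: nform_def)

lemma cpair_cnj: "cpair d (\<chi> j. cnj (d $ j)) = of_real ((norm d)\<^sup>2)"
proof -
  have "(norm d)\<^sup>2 = (\<Sum>j\<in>UNIV. (cmod (d $ j))\<^sup>2)"
    by (simp add: norm_vec_def L2_set_def sum_nonneg)
  then have "complex_of_real ((norm d)\<^sup>2) = (\<Sum>j\<in>UNIV. complex_of_real ((cmod (d $ j))\<^sup>2))"
    by (simp only: of_real_sum)
  then show ?thesis
    unfolding cpair_def by (simp only: complex_norm_square vec_lambda_beta)
qed

lemma norm_vec_cnj: "norm ((\<chi> j. cnj (d $ j)) :: complex ^ 'd) = norm d"
  by (simp add: norm_vec_def)

lemma nvec_alt: "nvec \<rho> w = (1 / norm (del \<rho> w)) *\<^sub>R (\<chi> j. cnj (del \<rho> w $ j))"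
  by (simp add: nvec_def vec_eq_iff scaleR_conv_of_real[where 'a=complex])

lemma norm_nvec: "del \<rho> w \<noteq> 0 \<Longrightarrow> norm (nvec \<rho> w) = 1"
  by (simp add: nvec_alt norm_vec_cnj)

lemma nform_nvec: "del \<rho> w \<noteq> 0 \<Longrightarrow> nform \<rho> w (nvec \<rho> w) = 1"
  unfolding nvec_alt nform_scaleR by (simp add: nform_def cpair_cnj power2_eq_square)

lemma continuous_on_del:
  fixes \<rho> :: "complex ^ 'd \<Rightarrow> real"
  assumes "C2_function \<rho>"
  shows "continuous_on X (del \<rho>)"
proof -
  have "del \<rho> = (\<lambda>w. \<chi> j. (of_real (frechet_derivative \<rho> (at w) (axis j 1))
            - \<i> * of_real (frechet_derivative \<rho> (at w) (axis j \<i>))) / 2)"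
    by (simp add: fun_eq_iff vec_eq_iff del_component[OF assms])
  moreover have "continuous_on X \<dots>"
    by (intro continuous_intros continuous_on_subset[OF C2_has_derivative(3)[OF assms]]) auto
  ultimately show ?thesis by simp
qed

lemma continuous_on_cpair [continuous_intros]:
  "continuous_on X F \<Longrightarrow> continuous_on X G \<Longrightarrow> continuous_on X (\<lambda>x. cpair (F x) (G x))"
  unfolding cpair_def by (intro continuous_intros)

text \<open>The real part of \<open>cpair (del \<rho> w) v\<close> is half of the real derivative in direction \<open>v\<close>, and the imaginary
  part is minus the real part for the direction \<open>\<i> *s v\<close>. So the mean value theorem for real
  directional derivatives covers both.\<close>

lemma cpair_del_lipschitz:
  fixes \<rho> :: "complex ^ 'd \<Rightarrow> real"
  assumes C2: "C2_function \<rho>" and B: "\<And>x u v. x \<in> X \<Longrightarrow> \<bar>hess \<rho> x u v\<bar> \<le> B * (norm u * norm v)"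
    and X: "convex X" "w \<in> X" "z \<in> X"
  shows "cmod (cpair (del \<rho> w) v - cpair (del \<rho> z) v) \<le> B * norm (w - z) * norm v"
proof -
  have 1: "\<bar>frechet_derivative \<rho> (at w) u - frechet_derivative \<rho> (at z) u\<bar> \<le> B * norm (w - z) * norm u" for u
  proof -
    have "norm (frechet_derivative \<rho> (at w) u - frechet_derivative \<rho> (at z) u) \<le> (B * norm u) * norm (w - z)"
    proof (rule differentiable_bound[OF X(1) _ _ X(2,3)])
      fix x assume "x \<in> X"
      show "((\<lambda>y. frechet_derivative \<rho> (at y) u) has_derivative hess \<rho> x u) (at x within X)"
        using C2_has_derivative(2)[OF C2] has_derivative_at_withinI by blast
      show "onorm (hess \<rho> x u) \<le> B * norm u"
        by (rule onorm_le) (use B[OF \<open>x \<in> X\<close>, of u] in \<open>simp add: mult.assoc\<close>)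
    qed
    then show ?thesis by (simp add: mult_ac)
  qed
  let ?d = "cpair (del \<rho> w) v - cpair (del \<rho> z) v"
  have "\<bar>Re ?d\<bar> \<le> B * norm (w - z) * norm v / 2"
    using 1[of v] unfolding frechet_derivative_eq_del[OF C2] by (simp add: abs_if split: if_splits)
  moreover have "\<bar>Im ?d\<bar> \<le> B * norm (w - z) * norm v / 2"
    using 1[of "\<i> *s v"] unfolding frechet_derivative_eq_del[OF C2] cpair_scale norm_vector_scale
    by (simp add: abs_if split: if_splits)
  ultimately show ?thesis using cmod_le[of ?d] by linarith
qed

lemma norm_del_lipschitz:
  fixes \<rho> :: "complex ^ 'd \<Rightarrow> real"
  assumes C2: "C2_function \<rho>" and B: "\<And>x u v. x \<in> X \<Longrightarrow> \<bar>hess \<rho> x u v\<bar> \<le> B * (norm u * norm v)"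
    and X: "convex X" "w \<in> X" "z \<in> X" and Bp: "B \<ge> 0"
  shows "norm (del \<rho> w - del \<rho> z) \<le> B * norm (w - z)"
proof -
  let ?d = "del \<rho> w - del \<rho> z"
  \<comment> \<open>Pairing the difference with its own conjugate turns the bound on the form into one on its norm.\<close>
  have "(norm ?d)\<^sup>2 = cmod (cpair ?d (\<chi> j. cnj (?d $ j)))"
    by (simp add: cpair_cnj del: of_real_power vector_minus_component)
  also have "\<dots> \<le> B * norm (w - z) * norm ((\<chi> j. cnj (?d $ j)) :: complex ^ 'd)"
    unfolding cpair_diff_left by (rule cpair_del_lipschitz[OF C2 B X])
  also have "\<dots> = B * norm (w - z) * norm ?d"
    by (simp only: norm_vec_cnj)
  finally show ?thesis
    using Bp by (cases "norm ?d = 0") (auto simp: power2_eq_square)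
qed

lemma nform_lipschitz:
  fixes \<rho> :: "complex ^ 'd \<Rightarrow> real"
  assumes C2: "C2_function \<rho>" and B: "\<And>x u v. x \<in> X \<Longrightarrow> \<bar>hess \<rho> x u v\<bar> \<le> B * (norm u * norm v)"
    and X: "convex X" "w \<in> X" "z \<in> X" and Bp: "B \<ge> 0"
    and m: "m > 0" "m \<le> norm (del \<rho> w)" "m \<le> norm (del \<rho> z)"
  shows "cmod (nform \<rho> w v - nform \<rho> z v) \<le> (2 * B / m) * norm (w - z) * norm v"
proof -
  let ?a = "norm (del \<rho> w)" and ?b = "norm (del \<rho> z)"
  have pos: "?a > 0" "?b > 0" using m by linarith+
  have eq: "nform \<rho> w v - nform \<rho> z v = (cpair (del \<rho> w) v - cpair (del \<rho> z) v) / of_real ?a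
     + nform \<rho> z v * of_real ((?b - ?a) / ?a)"
    using pos by (simp add: nform_def field_simps)
  have nd: "norm (del \<rho> w - del \<rho> z) \<le> B * norm (w - z)"
    by (rule norm_del_lipschitz[OF C2 B X Bp])
  have cd: "cmod (cpair (del \<rho> w) v - cpair (del \<rho> z) v) \<le> B * norm (w - z) * norm v"
    by (rule cpair_del_lipschitz[OF C2 B X])
  have e1: "norm (del \<rho> z) - norm (del \<rho> w) \<le> B * norm (w - z)" "norm (del \<rho> w) - norm (del \<rho> z) \<le> B * norm (w - z)"
    using nd norm_triangle_ineq2[of "del \<rho> w" "del \<rho> z"]
      norm_triangle_ineq2[of "del \<rho> z" "del \<rho> w"] norm_minus_commute[of "del \<rho> w" "del \<rho> z"] by linarith+
  have "cmod ((cpair (del \<rho> w) v - cpair (del \<rho> z) v) / of_real ?a) \<le> B * norm (w - z) * norm v / m"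
    unfolding norm_divide using pos m Bp
    by (simp add: frac_le cd)
  moreover have "cmod (nform \<rho> z v * of_real ((?b - ?a) / ?a)) \<le> norm v * (B * norm (w - z) / m)"
    unfolding norm_mult norm_of_real
  proof (intro mult_mono norm_nform_le)
    show "\<bar>(?b - ?a) / ?a\<bar> \<le> B * norm (w - z) / m"
      unfolding abs_divide using pos m e1 Bp by (intro frac_le) auto
  qed auto
  moreover have "(2 * B / m) * norm (w - z) * norm v = B * norm (w - z) * norm v / m + norm v * (B * norm (w - z) / m)"
    using m by (simp add: field_simps)
  ultimately show ?thesis
    unfolding eq
    using norm_triangle_ineq[of "(cpair (del \<rho> w) v - cpair (del \<rho> z) v) / of_real ?a" "nform \<rho> z v * of_real ((?b - ?a) / ?a)"]
    by linarith
qed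

lemma hess_uniformly_continuous:
  fixes \<rho> :: "'a::euclidean_space \<Rightarrow> real"
  assumes C2: "C2_function \<rho>" and X: "compact X" and e: "e > 0"
  obtains r where "r > 0" "\<And>x y u v. x \<in> X \<Longrightarrow> y \<in> X \<Longrightarrow> dist x y < r \<Longrightarrow>
     \<bar>hess \<rho> x u v - hess \<rho> y u v\<bar> \<le> e * (norm u * norm v)"
proof -
  \<comment> \<open>This function vanishes on the diagonal, so its uniform continuity compares nearby Hessians.\<close>
  define F where "F p = (\<Sum>b\<in>Basis. \<Sum>c\<in>Basis. \<bar>hess \<rho> (fst p) b c - hess \<rho> (snd p) b c\<bar>)" for p :: "'a \<times> 'a"
  have c: "continuous_on UNIV (\<lambda>p :: 'a \<times> 'a. hess \<rho> (fst p) b c)" "continuous_on UNIV (\<lambda>p :: 'a \<times> 'a. hess \<rho> (snd p) b c)" for b c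
    by (auto intro!: continuous_on_compose2[OF C2_has_derivative(4)[OF C2]] continuous_intros)
  have "continuous_on (X \<times> X) F"
    unfolding F_def by (intro continuous_intros continuous_on_subset[OF c(1)] continuous_on_subset[OF c(2)]) auto
  then have "uniformly_continuous_on (X \<times> X) F"
    by (intro compact_uniformly_continuous compact_Times X)
  then obtain r where r: "r > 0" "\<And>p q. p \<in> X \<times> X \<Longrightarrow> q \<in> X \<times> X \<Longrightarrow> dist p q < r \<Longrightarrow> dist (F p) (F q) < e"
    using e unfolding uniformly_continuous_on_def by (metis dist_commute)
  show ?thesis
  proof (rule that[OF r(1)])
    fix x y u v :: 'a assume "x \<in> X" "y \<in> X" "dist x y < r"
    then have "dist (F (x, y)) (F (y, y)) < e"
      by (intro r(2)) (auto simp: dist_Pair_Pair)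
    moreover have "F (y, y) = 0" by (simp add: F_def)
    ultimately have "F (x, y) \<le> e" by simp
    then show "\<bar>hess \<rho> x u v - hess \<rho> y u v\<bar> \<le> e * (norm u * norm v)"
      by (intro order_trans[OF hess_diff_bound[OF C2]] mult_right_mono) (auto simp: F_def)
  qed
qed

section \<open>Local separation from the complex tangent hyperplane\<close>

lemma frontier_sublevel:
  fixes \<rho> :: "'a::real_normed_vector \<Rightarrow> real"
  assumes "continuous_on UNIV \<rho>" "D = {z. \<rho> z < 0}"
  shows "closure D \<subseteq> {z. \<rho> z \<le> 0}" "frontier D \<subseteq> {z. \<rho> z = 0}"
proof -
  show *: "closure D \<subseteq> {z. \<rho> z \<le> 0}"
    using assms by (intro closure_minimal closed_Collect_le) auto
  have "open D" unfolding assms(2) using assms(1) by (intro open_Collect_less) auto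
  then show "frontier D \<subseteq> {z. \<rho> z = 0}"
    using * unfolding frontier_def interior_open[OF \<open>open D\<close>] by (force simp: assms(2))
qed

lemma bounded_domain_frontier:
  fixes D :: "'a::euclidean_space set"
  assumes "bounded D" shows "compact (frontier D)" "D \<noteq> {} \<Longrightarrow> frontier D \<noteq> {}"
  using assms by (auto simp: compact_frontier_bounded frontier_eq_empty)

locale bounded_C_convex_domain =
  fixes D :: "(complex ^ 'd) set" and \<rho> :: "complex ^ 'd \<Rightarrow> real"
  assumes C_convex: "strongly_C_convex_domain D \<rho>" and bounded_D: "bounded D"
begin

lemma C2: "C2_function \<rho>" and D_eq: "D = {z. \<rho> z < 0}" and open_D: "open D" and D_ne: "D \<noteq> {}"
  and connected_D: "connected D"
  using C_convex unfolding strongly_C_convex_domain_def by auto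

lemmas rho_signs = frontier_sublevel[OF C2_continuous[OF C2] D_eq]
lemmas frontier_compact_ne = bounded_domain_frontier[OF bounded_D]

lemma hess_pos_on_complex_tangent:
  assumes "w \<in> frontier D" "cpair (del \<rho> w) v = 0" "v \<noteq> 0"
  shows "hess \<rho> w v v > 0"
  using assms C_convex wirtinger_hessian[of \<rho> w v]
  unfolding strongly_C_convex_domain_def complex_tangent_space_def by fastforce

lemma del_nonzero_on_frontier:
  assumes "w \<in> frontier D"
  shows "del \<rho> w \<noteq> 0"
proof
  assume "del \<rho> w = 0"
  then have "frechet_derivative \<rho> (at w) = (\<lambda>v. 0)"
    using frechet_derivative_eq_del[OF C2, of w] by (auto simp: fun_eq_iff cpair_def)
  then show False using assms C_convex unfolding strongly_C_convex_domain_def by blast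
qed

text \<open>On the compact set of pairs of a boundary point \<open>w\<close> and a unit vector \<open>v\<close>, the larger of
  \<open>cmod (cpair (del \<rho> w) v)\<close> and \<open>hess \<rho> w v v\<close> is positive, hence at least some \<open>\<mu> > 0\<close>. Write \<open>z = w + v\<close>. If
  the first alternative holds for the direction of \<open>v\<close>, then the pairing is even linear in \<open>norm v\<close>.
  Otherwise the second-order term of \<open>\<rho>\<close> at \<open>w\<close> is positive of size \<open>(norm v)\<^sup>2\<close>, and as \<open>\<rho> z \<le> 0 = \<rho> w\<close>
  the first-order term has to compensate for it.\<close>

lemma local_separation:
  obtains r c where "r > 0" "c > 0"
    "\<And>w z. w \<in> frontier D \<Longrightarrow> \<rho> z \<le> 0 \<Longrightarrow> norm (w - z) \<le> r \<Longrightarrow> c * (norm (w - z))\<^sup>2 \<le> cmod (cpair (del \<rho> w) (w - z))"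
proof -
  have fz: "\<rho> w = 0" if "w \<in> frontier D" for w using rho_signs(2) that by auto
  define S where "S = frontier D \<times> sphere (0 :: complex ^ 'd) 1"
  define F where "F p = max (cmod (cpair (del \<rho> (fst p)) (snd p))) (hess \<rho> (fst p) (snd p) (snd p))" for p
  have h: "continuous_on S (\<lambda>p. hess \<rho> (fst p) b c)" for b c
    by (rule continuous_on_compose2[OF C2_has_derivative(4)[OF C2]]) (auto intro!: continuous_intros)
  have "continuous_on S (\<lambda>p. del \<rho> (fst p))"
    by (rule continuous_on_compose2[OF continuous_on_del[OF C2, of UNIV]]) (auto intro!: continuous_intros)
  then have "continuous_on S F"
    unfolding F_def by (subst hess_basis[OF C2]) (intro continuous_intros h)
  moreover have "compact S" unfolding S_def by (intro compact_Times frontier_compact_ne(1)) auto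
  moreover have "S \<noteq> {}"
  proof -
    have "axis undefined 1 \<in> sphere (0 :: complex ^ 'd) 1" by simp
    with frontier_compact_ne(2)[OF D_ne] show ?thesis unfolding S_def by blast
  qed
  ultimately have "\<exists>p\<in>S. \<forall>q\<in>S. F p \<le> F q"
    by (intro continuous_attains_inf)
  then obtain p where p: "p \<in> S" "\<And>q. q \<in> S \<Longrightarrow> F p \<le> F q"
    by blast
  define \<mu> where "\<mu> = F p"
  have mu: "\<mu> > 0"
  proof (rule ccontr)
    assume "\<not> \<mu> > 0"
    then have "cmod (cpair (del \<rho> (fst p)) (snd p)) \<le> 0" "hess \<rho> (fst p) (snd p) (snd p) \<le> 0"
      unfolding \<mu>_def F_def by linarith+
    moreover have "fst p \<in> frontier D" "snd p \<noteq> 0" using p(1) unfolding S_def by (cases p, auto)+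
    ultimately show False using hess_pos_on_complex_tangent[of "fst p" "snd p"] by auto
  qed
  have dich: "\<mu> * norm v \<le> cmod (cpair (del \<rho> w) v) \<or> \<mu> * (norm v)\<^sup>2 \<le> hess \<rho> w v v" if "w \<in> frontier D" for w v
  proof (cases "v = 0")
    case False
    let ?u = "(1 / norm v) *\<^sub>R v"
    have "(w, ?u) \<in> S" using that False unfolding S_def by simp
    from p(2)[OF this] have "\<mu> \<le> cmod (cpair (del \<rho> w) ?u) \<or> \<mu> \<le> hess \<rho> w ?u ?u"
      unfolding \<mu>_def F_def by auto
    moreover have "hess \<rho> w ?u ?u = hess \<rho> w v v / (norm v)\<^sup>2"
      unfolding linear_scale[OF C2_deriv_linear(2)[OF C2]] linear_scale[OF hess_linear_left[OF C2]]
      by (simp add: power2_eq_square)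
    moreover have "cmod (cpair (del \<rho> w) ?u) = cmod (cpair (del \<rho> w) v) / norm v"
      unfolding cpair_scaleR norm_mult using False by (simp add: norm_divide)
    ultimately show ?thesis using False by (simp add: pos_le_divide_eq)
  qed auto
  have "bounded (frontier D)" using frontier_compact_ne(1) compact_imp_bounded by blast
  then obtain R where R: "\<And>w. w \<in> frontier D \<Longrightarrow> norm w \<le> R"
    unfolding bounded_iff by auto
  obtain r0 where r0: "r0 > 0" "\<And>x y u v. x \<in> cball 0 (R+1) \<Longrightarrow> y \<in> cball (0 :: complex ^ 'd) (R+1) \<Longrightarrow> dist x y < r0 \<Longrightarrow>
     \<bar>hess \<rho> x u v - hess \<rho> y u v\<bar> \<le> (\<mu>/2) * (norm u * norm v)"
    using hess_uniformly_continuous[OF C2 compact_cball, of "\<mu>/2"] mu by (metis half_gt_zero)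
  define r where "r = min 1 (r0/2)"
  show ?thesis
  proof (rule that[of r "\<mu> / 8"])
    fix w z assume w: "w \<in> frontier D" and z: "\<rho> z \<le> 0" and wz: "norm (w - z) \<le> r"
    define v where "v = z - w"
    have nv: "norm v \<le> r" "norm (w - z) = norm v" unfolding v_def using wz by (simp_all add: norm_minus_commute)
    have sw: "cmod (cpair (del \<rho> w) (w - z)) = cmod (cpair (del \<rho> w) v)"
      unfolding v_def cpair_diff by (rule norm_minus_commute)
    have "\<mu> / 8 * (norm v)\<^sup>2 \<le> cmod (cpair (del \<rho> w) v)"
    proof (cases "\<mu> * norm v \<le> cmod (cpair (del \<rho> w) v)")
      case True
      have "norm v \<le> 1" using nv unfolding r_def by auto
      then have "norm v * norm v \<le> norm v" by (simp add: mult_left_le)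
      then have "\<mu> * (norm v * norm v) \<le> \<mu> * norm v" using mu by (intro mult_left_mono) auto
      moreover have "\<mu> * (norm v * norm v) \<ge> 0" using mu by auto
      ultimately have "\<mu> / 8 * (norm v * norm v) \<le> \<mu> * norm v" by linarith
      then show ?thesis using True by (simp add: power2_eq_square)
    next
      case False
      then have h: "\<mu> * (norm v)\<^sup>2 \<le> hess \<rho> w v v" using dich[OF w] by blast
      obtain t where t: "0 < t" "t < 1"
        "\<rho> (w + v) = \<rho> w + frechet_derivative \<rho> (at w) v + hess \<rho> (w + t *\<^sub>R v) v v / 2"
        using Taylor_C2[OF C2] by blast
      have tv: "norm (t *\<^sub>R v) \<le> norm v" using t by (simp add: mult_left_le_one_le)
      have "\<bar>hess \<rho> (w + t *\<^sub>R v) v v - hess \<rho> w v v\<bar> \<le> (\<mu>/2) * (norm v * norm v)"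
      proof (rule r0(2))
        have "norm (w + t *\<^sub>R v) \<le> norm w + norm (t *\<^sub>R v)" by (rule norm_triangle_ineq)
        then show "w + t *\<^sub>R v \<in> cball 0 (R+1)"
          using R[OF w] tv nv unfolding r_def by auto
        show "w \<in> cball 0 (R+1)" using R[OF w] by auto
        show "dist (w + t *\<^sub>R v) w < r0" using tv nv(1) r0(1) unfolding r_def dist_norm by auto
      qed
      then have h2: "hess \<rho> (w + t *\<^sub>R v) v v \<ge> \<mu>/2 * (norm v)\<^sup>2"
        using h unfolding power2_eq_square by argo
      have "\<rho> (w + v) \<le> 0" using z by (simp add: v_def)
      then have "frechet_derivative \<rho> (at w) v + hess \<rho> (w + t *\<^sub>R v) v v / 2 \<le> 0"
        using t(3) fz[OF w] by linarith
      then have "\<mu>/4 * (norm v)\<^sup>2 \<le> - 2 * Re (cpair (del \<rho> w) v)"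
        using h2 unfolding frechet_derivative_eq_del[OF C2] by linarith
      also have "\<dots> \<le> 2 * cmod (cpair (del \<rho> w) v)"
        using abs_Re_le_cmod[of "cpair (del \<rho> w) v"] by linarith
      finally show ?thesis by linarith
    qed
    then show "\<mu> / 8 * (norm (w - z))\<^sup>2 \<le> cmod (cpair (del \<rho> w) (w - z))"
      using sw nv by simp
  qed (use mu r0 r_def in auto)
qed

lemma tangent_point_isolated:
  assumes w: "w \<in> frontier D"
  obtains r where "r > 0" "\<And>z. z \<in> closure D \<Longrightarrow> norm (w - z) \<le> r \<Longrightarrow> cpair (del \<rho> w) (w - z) = 0 \<Longrightarrow> w = z"
proof -
  obtain r c where rc: "r > 0" "c > 0"
    "\<And>w z. w \<in> frontier D \<Longrightarrow> \<rho> z \<le> 0 \<Longrightarrow> norm (w - z) \<le> r \<Longrightarrow> c * (norm (w - z))\<^sup>2 \<le> cmod (cpair (del \<rho> w) (w - z))"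
    using local_separation by blast
  show ?thesis
  proof (rule that[OF rc(1)])
    fix z assume "z \<in> closure D" "norm (w - z) \<le> r" "cpair (del \<rho> w) (w - z) = 0"
    then have "c * (norm (w - z))\<^sup>2 \<le> 0" using rc(3)[OF w, of z] rho_signs(1) by auto
    then show "w = z" using rc(2) by (simp add: mult_le_0_iff)
  qed
qed

end


section \<open>Slices by complex lines and global separation\<close>

definition line_pt :: "complex ^ 'd \<Rightarrow> complex ^ 'd \<Rightarrow> complex \<Rightarrow> complex ^ 'd" where
  "line_pt a b l = a + l *s (b - a)"

text \<open>\<open>{l. line_pt a b l \<in> D}\<close> is the slice of \<open>D\<close> by the complex line through \<open>a\<close> and \<open>b\<close>, in a parameter for
  which these points sit at 0 and 1. For \<open>a = b\<close> in \<open>D\<close> the slice degenerates to the whole plane, which puts the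
  diagonal into the relation and makes it behave continuously there.\<close>

definition joined_in :: "(complex ^ 'd) set \<Rightarrow> complex ^ 'd \<Rightarrow> complex ^ 'd \<Rightarrow> bool" where
  "joined_in D a b \<longleftrightarrow> connected_component {l. line_pt a b l \<in> D} 0 1"

lemma continuous_on_line_pt [continuous_intros]:
  assumes "continuous_on X F" "continuous_on X G" "continuous_on X H"
  shows "continuous_on X (\<lambda>x. line_pt (F x) (G x) (H x))"
  unfolding line_pt_def vector_scalar_mult_def using assms by (intro continuous_intros)

lemma line_pt_0 [simp]: "line_pt a b 0 = a" and line_pt_1 [simp]: "line_pt a b 1 = b"
  by (simp_all add: line_pt_def)

lemma norm_line_pt_diff: "norm (line_pt a b l - line_pt a b l') = cmod (l - l') * norm (b - a)"
proof -
  have "line_pt a b l - line_pt a b l' = (l - l') *s (b - a)"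
    by (simp add: line_pt_def vec_eq_iff algebra_simps)
  then show ?thesis by (simp only: norm_vector_scale)
qed

text \<open>The tube lemma: the exceptional pairs are the projection of a closed set along the compact set \<open>K\<close>.\<close>

lemma open_forall_compact_line:
  assumes "compact K" "open D"
  shows "open {p. \<forall>l\<in>K. line_pt (fst p) (snd p) l \<in> D}"
proof -
  have "closed {y. \<exists>x. x \<in> K \<and> (x, y) \<in> {q. line_pt (fst (snd q)) (snd (snd q)) (fst q) \<in> - D}}"
    by (intro closed_compact_projection assms(1) closed_vimage[unfolded vimage_def] continuous_intros)
       (use assms(2) in auto)
  then have "open (- {y. \<exists>x. x \<in> K \<and> (x, y) \<in> {q. line_pt (fst (snd q)) (snd (snd q)) (fst q) \<in> - D}})"
    by (rule open_Compl)
  moreover have "- {y. \<exists>x. x \<in> K \<and> (x, y) \<in> {q. line_pt (fst (snd q)) (snd (snd q)) (fst q) \<in> - D}}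
     = {p. \<forall>l\<in>K. line_pt (fst p) (snd p) l \<in> D}" by auto
  ultimately show ?thesis by simp
qed

lemma open_line_slice: "open D \<Longrightarrow> open {l. line_pt a b l \<in> D}"
  by (intro open_vimage[unfolded vimage_def] continuous_intros)

lemma closed_line_slice: "closed D \<Longrightarrow> closed {l. line_pt a b l \<in> D}"
  by (intro closed_vimage[unfolded vimage_def] continuous_intros)

lemma open_joined_in:
  fixes D :: "(complex ^ 'd) set"
  assumes D: "open D" shows "open {p. joined_in D (fst p) (snd p)}"
proof (subst open_subopen, safe)
  fix a b :: "complex ^ 'd" assume "joined_in D (fst (a, b)) (snd (a, b))"
  then have "path_component {l. line_pt a b l \<in> D} 0 1"
    using open_path_connected_component[OF open_line_slice[OF D]] by (simp add: joined_in_def)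
  then obtain g where g: "path g" "path_image g \<subseteq> {l. line_pt a b l \<in> D}" "pathstart g = 0" "pathfinish g = 1"
    unfolding path_component_def by blast
  let ?T = "{p. \<forall>l\<in>path_image g. line_pt (fst p) (snd p) l \<in> D}"
  have "open ?T" by (intro open_forall_compact_line compact_path_image g D)
  moreover have "(a, b) \<in> ?T" using g by auto
  moreover have "?T \<subseteq> {p. joined_in D (fst p) (snd p)}"
  proof safe
    fix a b assume "\<forall>l\<in>path_image g. line_pt (fst (a, b)) (snd (a, b)) l \<in> D"
    then have "path_image g \<subseteq> {l. line_pt a b l \<in> D}" by auto
    moreover have "connected (path_image g)" "0 \<in> path_image g" "1 \<in> path_image g"
      using g connected_path_image pathstart_in_path_image pathfinish_in_path_image by metis+
    ultimately show "joined_in D (fst (a, b)) (snd (a, b))"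
      unfolding joined_in_def connected_component_def by auto
  qed
  ultimately show "\<exists>T. open T \<and> (a, b) \<in> T \<and> T \<subseteq> {p. joined_in D (fst p) (snd p)}" by blast
qed

lemma C2_decrease_along:
  fixes \<rho> :: "'a::real_normed_vector \<Rightarrow> real"
  assumes C2: "C2_function \<rho>" and neg: "\<And>y. y \<in> B \<Longrightarrow> frechet_derivative \<rho> (at y) v < 0"
    and seg: "\<And>s. 0 \<le> s \<Longrightarrow> s \<le> t \<Longrightarrow> x + s *\<^sub>R v \<in> B" and t: "t > 0"
  shows "\<rho> (x + t *\<^sub>R v) < \<rho> x"
proof -
  note d0 = C2_line_derivatives(1)[OF C2, of x v]
  have "\<rho> (x + t *\<^sub>R v) < \<rho> (x + 0 *\<^sub>R v)"
    by (rule DERIV_neg_imp_decreasing[OF t]) (use d0 neg seg in blast)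
  then show ?thesis by simp
qed

lemma connected_componentI_connected:
  "connected T \<Longrightarrow> T \<subseteq> S \<Longrightarrow> x \<in> T \<Longrightarrow> y \<in> T \<Longrightarrow> connected_component S x y"
  unfolding connected_component_def by blast

context bounded_C_convex_domain begin

text \<open>The closure of a component of the slice is relatively open in the slice of the closed domain. At a
  boundary point where the line is complex tangent, the closed slice has an isolated point. At a
  transversal boundary point, \<open>\<rho>\<close> strictly decreases along some direction \<open>v\<close> of the line, so that moving
  in that direction carries the whole closed slice near \<open>q\<close> into a single small disc of the slice, which
  therefore belongs to one component.\<close>

lemma line_component_closure_open:
  assumes ab: "a \<noteq> b"
    and q: "q \<in> closure (connected_component_set {l. line_pt a b l \<in> D} x0)"
  shows "\<exists>e>0. ball q e \<inter> {l. line_pt a b l \<in> closure D} \<subseteq> closure (connected_component_set {l. line_pt a b l \<in> D} x0)"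
proof -
  define S where "S = {l. line_pt a b l \<in> D}"
  define C where "C = connected_component_set S x0"
  have opS: "open S" unfolding S_def by (rule open_line_slice[OF open_D])
  have qC: "q \<in> closure C" using q unfolding C_def S_def .
  have CS: "C \<subseteq> S" unfolding C_def by (rule connected_component_subset)
  define w where "w = line_pt a b q"
  have lp: "line_pt a b (l + of_real t * zeta) = line_pt a b l + t *\<^sub>R (zeta *s (b - a))" for l t zeta
    by (simp add: line_pt_def vec_eq_iff algebra_simps scaleR_conv_of_real[where 'a=complex])
  have "\<exists>e>0. ball q e \<inter> {l. line_pt a b l \<in> closure D} \<subseteq> closure C"
  proof (cases "w \<in> D")
    case True
    then have "q \<in> S" by (simp add: S_def w_def)
    then obtain e where e: "e > 0" "ball q e \<subseteq> S" using opS openE by blast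
    obtain y where y: "y \<in> C" "y \<in> ball q e" using qC e(1)
      by (metis closure_approachable dist_commute mem_ball)
    have "ball q e \<subseteq> C"
    proof
      fix x assume "x \<in> ball q e"
      then have "connected_component S y x"
        using e(2) y(2) by (intro connected_componentI_connected[of "ball q e"]) auto
      then show "x \<in> C" using y(1) connected_component_trans unfolding C_def by auto
    qed
    then show ?thesis using e(1) closure_subset by blast
  next
    case False
    have "S \<subseteq> {l. line_pt a b l \<in> closure D}" unfolding S_def using closure_subset by blast
    then have "closure C \<subseteq> {l. line_pt a b l \<in> closure D}"
      using CS closed_line_slice[OF closed_closure] by (intro closure_minimal) blast+
    then have "w \<in> closure D" using qC unfolding w_def by auto
    then have wF: "w \<in> frontier D" using False open_D by (simp add: frontier_def interior_open)
    then have w0: "\<rho> w = 0" using rho_signs by auto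
    show ?thesis
    proof (cases "cpair (del \<rho> w) (b - a) = 0")
      case True
      obtain r where r: "r > 0"
        "\<And>z. z \<in> closure D \<Longrightarrow> norm (w - z) \<le> r \<Longrightarrow> cpair (del \<rho> w) (w - z) = 0 \<Longrightarrow> w = z"
        using tangent_point_isolated[OF wF] by blast
      have "ball q (r / norm (b - a)) \<inter> {l. line_pt a b l \<in> closure D} \<subseteq> {q}"
      proof safe
        fix l assume l: "l \<in> ball q (r / norm (b - a))" "line_pt a b l \<in> closure D"
        have wl: "w - line_pt a b l = (q - l) *s (b - a)"
          by (simp add: w_def line_pt_def vec_eq_iff algebra_simps)
        have "cmod (q - l) * norm (b - a) < r" using l(1) ab by (simp add: dist_norm pos_less_divide_eq)
        then have "norm (w - line_pt a b l) \<le> r" unfolding wl norm_vector_scale by simp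
        moreover have "cpair (del \<rho> w) (w - line_pt a b l) = 0" unfolding wl cpair_scale True by simp
        ultimately have "w = line_pt a b l" by (rule r(2)[OF l(2)])
        then have "norm ((q - l) *s (b - a)) = 0" using wl by simp
        then show "l = q" using ab unfolding norm_vector_scale by simp
      qed
      then show ?thesis using qC r(1) ab by (intro exI[of _ "r / norm (b - a)"]) auto
    next
      case False
      \<comment> \<open>The parameter direction of steepest descent of the first-order term within the line.\<close>
      define zeta where "zeta = - cnj (cpair (del \<rho> w) (b - a))"
      define v where "v = zeta *s (b - a)"
      have z0: "zeta \<noteq> 0" using False by (simp add: zeta_def)
      have "cpair (del \<rho> w) v = - of_real ((cmod (cpair (del \<rho> w) (b - a)))\<^sup>2)"
        unfolding v_def cpair_scale zeta_def by (simp only: complex_norm_square) simp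
      then have "frechet_derivative \<rho> (at w) v < 0"
        unfolding frechet_derivative_eq_del[OF C2] using False by simp
      moreover have "open {y. frechet_derivative \<rho> (at y) v < 0}"
        by (intro open_Collect_less C2_has_derivative(3)[OF C2] continuous_intros)
      ultimately obtain s0 where s0: "s0 > 0" "\<And>y. y \<in> ball w s0 \<Longrightarrow> frechet_derivative \<rho> (at y) v < 0"
        by (metis (mono_tags, lifting) openE mem_Collect_eq subset_iff)
      define L where "L = norm (b - a)"
      have L: "L > 0" using ab by (simp add: L_def)
      define t0 where "t0 = s0 / (2 * norm v)"
      have nv: "norm v > 0" using z0 ab unfolding v_def norm_vector_scale by simp
      have t0: "t0 > 0" using s0 nv by (simp add: t0_def)
      have dec: "\<rho> (line_pt a b (l + of_real t * zeta)) < \<rho> (line_pt a b l)"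
        if l: "l \<in> ball q (s0 / (2 * L))" and t: "0 < t" "t \<le> t0" for l t
      proof -
        have "\<rho> (line_pt a b l + t *\<^sub>R v) < \<rho> (line_pt a b l)"
        proof (rule C2_decrease_along[OF C2 s0(2) _ t(1)])
          fix s :: real assume s: "0 \<le> s" "s \<le> t"
          have "norm (w - line_pt a b l) < s0 / 2"
            using l L unfolding w_def norm_line_pt_diff L_def[symmetric] by (simp add: dist_norm field_simps)
          moreover have "norm (s *\<^sub>R v) \<le> s0 / 2"
          proof -
            have "s * norm v \<le> t0 * norm v" using s t by (intro mult_right_mono) auto
            then show ?thesis using s nv by (simp add: t0_def)
          qed
          ultimately show "line_pt a b l + s *\<^sub>R v \<in> ball w s0"
            using norm_triangle_ineq4[of "w - line_pt a b l" "s *\<^sub>R v"] by (simp add: dist_norm algebra_simps)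
        qed
        then show ?thesis unfolding lp v_def .
      qed
      have "\<rho> (line_pt a b (q + of_real t0 * zeta)) < \<rho> w"
        unfolding w_def using s0 L t0 by (intro dec) auto
      then have "q + of_real t0 * zeta \<in> S" by (simp add: S_def D_eq w0)
      then obtain e' where e': "e' > 0" "ball (q + of_real t0 * zeta) e' \<subseteq> S" using opS openE by blast
      define e where "e = min e' (s0 / (2 * L))"
      have e: "e > 0" using e' s0 L by (simp add: e_def)
      obtain y where y: "y \<in> C" "y \<in> ball q e" using qC e
        by (metis closure_approachable dist_commute mem_ball)
      have move: "connected_component S (l + of_real t * zeta) (l + of_real t0 * zeta)"
        if l: "l \<in> ball q e" "line_pt a b l \<in> closure D" and t: "0 < t \<or> t = 0 \<and> l \<in> S" "t \<le> t0" for l t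
      proof (rule connected_componentI_connected)
        show "connected ((\<lambda>s. l + of_real s * zeta) ` {t..t0})"
          by (intro connected_continuous_image continuous_intros) auto
        show "(\<lambda>s. l + of_real s * zeta) ` {t..t0} \<subseteq> S"
        proof safe
          fix s assume s: "s \<in> {t..t0}"
          show "l + of_real s * zeta \<in> S"
          proof (cases "s = 0")
            case True then show ?thesis using t s by auto
          next
            case False
            then have "\<rho> (line_pt a b (l + of_real s * zeta)) < \<rho> (line_pt a b l)"
              using s t l by (intro dec) (auto simp: e_def)
            also have "\<dots> \<le> 0" using rho_signs l by auto
            finally show ?thesis by (simp add: S_def D_eq)
          qed
        qed
      qed (use t in auto)
      have "ball q e \<inter> {l. line_pt a b l \<in> closure D} \<subseteq> closure C"
      proof safe
        fix l assume l: "l \<in> ball q e" "line_pt a b l \<in> closure D"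
        have yS: "y \<in> S" using y CS by auto
        then have yD: "line_pt a b y \<in> closure D" unfolding S_def using closure_subset by auto
        have 1: "connected_component S x0 y" using y by (simp add: C_def)
        have 2: "connected_component S y (y + of_real t0 * zeta)"
          using move[OF y(2) yD, of 0] yS t0 by simp
        have 3: "connected_component S (y + of_real t0 * zeta) (l + of_real t0 * zeta)"
          by (rule connected_componentI_connected[OF connected_ball e'(2)])
             (use y(2) l(1) in \<open>auto simp: e_def dist_norm\<close>)
        have 4: "connected_component S (l + of_real t0 * zeta) (l + of_real t * zeta)" if "0 < t" "t \<le> t0" for t
          using move[OF l, of t] that connected_component_sym by blast
        have 5: "l + of_real t * zeta \<in> C" if "0 < t" "t \<le> t0" for t
          using 1 2 3 4[OF that] unfolding C_def by (blast intro: connected_component_trans)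
        show "l \<in> closure C"
        proof (subst closure_approachable, safe)
          fix d :: real assume d: "d > 0"
          define t where "t = min t0 (d / (2 * cmod zeta))"
          have t: "0 < t" "t \<le> t0" using t0 d z0 by (auto simp: t_def)
          have "t * cmod zeta \<le> d / (2 * cmod zeta) * cmod zeta"
            by (intro mult_right_mono) (auto simp: t_def)
          also have "\<dots> < d" using d z0 by simp
          finally have "dist (l + of_real t * zeta) l < d" using t by (simp add: dist_norm norm_mult)
          then show "\<exists>y\<in>C. dist y l < d" using 5[OF t] by blast
        qed
      qed
      then show ?thesis using e by blast
    qed
  qed
  then show ?thesis unfolding C_def S_def .
qed

lemma joined_in_refl: "a \<in> D \<Longrightarrow> joined_in D a a"
proof -
  assume "a \<in> D"
  then have "{l. line_pt a a l \<in> D} = UNIV"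
    by (auto simp: line_pt_def vector_scalar_mult_def zero_vec_def[symmetric])
  then show ?thesis unfolding joined_in_def using connected_UNIV by (auto simp: connected_component_def)
qed

text \<open>If \<open>a\<close> and \<open>b\<close> lie in different components of the slice, \<open>line_component_closure_open\<close> splits the closed slice into
  two disjoint closed pieces, one around each point. By compactness the slices through nearby pairs
  remain in disjoint neighbourhoods \<open>U\<close> and \<open>V\<close> of the two pieces, so those pairs are not joined either.\<close>

lemma open_not_joined_in:
  assumes a: "a \<in> D" and b: "b \<in> D"
    and nj: "\<not> joined_in D a b"
  shows "\<exists>T. open T \<and> (a, b) \<in> T \<and> (\<forall>p\<in>T. fst p \<in> D \<longrightarrow> snd p \<in> D \<longrightarrow> \<not> joined_in D (fst p) (snd p))"
proof -
  have ab: "a \<noteq> b"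
  proof
    assume "a = b"
    then show False using nj joined_in_refl[OF a] by simp
  qed
  define S where "S = {l. line_pt a b l \<in> D}"
  define T where "T = {l. line_pt a b l \<in> closure D}"
  define A where "A = closure (connected_component_set S 0)"
  define B where "B = T - A"
  have clT: "closed T" unfolding T_def by (intro closed_line_slice) auto
  have ST: "S \<subseteq> T" unfolding S_def T_def using closure_subset by blast
  have AT: "A \<subseteq> T" unfolding A_def using ST clT connected_component_subset[of S 0] by (intro closure_minimal) auto
  have clB: "closed B"
  proof -
    have "openin (top_of_set T) A"
      unfolding openin_contains_ball using AT line_component_closure_open[OF ab, of _ 0]
      unfolding A_def S_def T_def by simp
    then have "closedin (top_of_set T) (T - A)" by (simp add: closedin_diff)
    then show ?thesis using clT closedin_closed_trans unfolding B_def by blast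
  qed
  have 0: "0 \<in> A" unfolding A_def using a closure_subset[of "connected_component_set S 0"]
    by (auto simp: S_def)
  have 1: "1 \<in> B"
  proof -
    have "1 \<in> S" using b by (simp add: S_def)
    moreover have "1 \<notin> A"
    proof
      assume "1 \<in> A"
      have "open S" unfolding S_def by (rule open_line_slice[OF open_D])
      then obtain e where e: "e > 0" "ball 1 e \<subseteq> S" using \<open>1 \<in> S\<close> openE by blast
      then obtain y where y: "y \<in> connected_component_set S 0" "y \<in> ball 1 e"
        using \<open>1 \<in> A\<close> unfolding A_def by (metis closure_approachable dist_commute mem_ball)
      have "connected_component S y 1"
        using e y(2) by (intro connected_componentI_connected[of "ball 1 e"]) auto
      then have "connected_component S 0 1" using y(1) connected_component_trans by auto
      then show False using nj by (simp add: joined_in_def S_def)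
    qed
    ultimately show ?thesis using ST by (auto simp: B_def)
  qed
  obtain U V where UV: "open U" "open V" "A \<subseteq> U" "B \<subseteq> V" "U \<inter> V = {}"
    using separation_normal[OF _ clB, of A] unfolding A_def B_def by auto
  obtain R where R: "\<And>z. z \<in> closure D \<Longrightarrow> norm z \<le> R" "R > 0"
    using bounded_closure[OF bounded_D] unfolding bounded_pos by blast
  \<comment> \<open>Bounds the parameters of all slices of D through pairs at distance at least half of that of a and b.\<close>
  define \<Lambda> where "\<Lambda> = 4 * R / norm (b - a)"
  define K where "K = cball 0 \<Lambda> - (U \<union> V)"
  define T1 where "T1 = {p. \<forall>l\<in>K. line_pt (fst p) (snd p) l \<in> - closure D}"
  define T2 where "T2 = {p :: (complex ^ 'd) \<times> (complex ^ 'd). norm (b - a) / 2 < norm (snd p - fst p)}"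
  have "open T1" unfolding T1_def
    by (intro open_forall_compact_line) (auto simp: K_def intro!: compact_diff open_Un UV)
  moreover have "open T2" unfolding T2_def by (intro open_Collect_less continuous_intros)
  moreover have "(a, b) \<in> T1"
    using UV(3,4) unfolding T1_def K_def B_def T_def by auto
  moreover have "(a, b) \<in> T2" using ab by (simp add: T2_def)
  moreover have "\<not> joined_in D a' b'" if p: "(a', b') \<in> T1" "(a', b') \<in> T2" "a' \<in> D" "b' \<in> D" for a' b'
  proof
    assume "joined_in D a' b'"
    then obtain N where N: "connected N" "N \<subseteq> {l. line_pt a' b' l \<in> D}" "0 \<in> N" "1 \<in> N"
      unfolding joined_in_def connected_component_def by blast
    have "N \<subseteq> U \<union> V"
    proof
      fix l assume l: "l \<in> N"
      then have lD: "line_pt a' b' l \<in> closure D" using N(2) closure_subset by blast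
      have "cmod (l - 0) * norm (b' - a') = norm (line_pt a' b' l - line_pt a' b' 0)"
        by (rule norm_line_pt_diff[symmetric])
      also have "\<dots> \<le> 2 * R"
        using norm_triangle_ineq4[of "line_pt a' b' l" "line_pt a' b' 0"] R(1)[OF lD] R(1)[of a'] p(3) closure_subset
        by fastforce
      finally have "cmod l * norm (b' - a') \<le> 2 * R" by simp
      moreover have "cmod l * (norm (b - a) / 2) \<le> cmod l * norm (b' - a')"
        using p(2) unfolding T2_def by (intro mult_left_mono) auto
      ultimately have "cmod l * norm (b - a) \<le> 4 * R" by linarith
      then have "cmod l \<le> \<Lambda>" using ab by (simp add: \<Lambda>_def pos_le_divide_eq)
      then show "l \<in> U \<union> V" using p(1) lD unfolding T1_def K_def by auto
    qed
    moreover have "U \<inter> V \<inter> N = {}" using UV(5) by auto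
    ultimately have "U \<inter> N = {} \<or> V \<inter> N = {}" using connectedD[OF N(1) UV(1,2)] by blast
    then show False using 0 1 UV(3,4) N(3,4) by blast
  qed
  ultimately show ?thesis by (intro exI[of _ "T1 \<inter> T2"]) auto
qed

text \<open>Being joined is open and closed in the connected set \<open>D \<times> D\<close> and holds on the diagonal.\<close>

lemma line_slices_connected:
  assumes a: "a \<in> D" and b: "b \<in> D"
  shows "joined_in D a b"
proof (rule ccontr)
  assume nj: "\<not> joined_in D a b"
  define U where "U = {p. joined_in D (fst p) (snd p)}"
  define V where "V = \<Union>{T. open T \<and> (\<forall>p\<in>T. p \<in> D \<times> D \<longrightarrow> \<not> joined_in D (fst p) (snd p))}"
  have U: "open U" unfolding U_def by (rule open_joined_in[OF open_D])
  have V: "open V" unfolding V_def by auto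
  have UV: "U \<inter> V \<inter> (D \<times> D) = {}" unfolding U_def V_def by auto
  have cov: "p \<in> U \<or> p \<in> V" if "p \<in> D \<times> D" for p
  proof (cases "p \<in> U")
    case False
    then have "\<not> joined_in D (fst p) (snd p)" "fst p \<in> D" "snd p \<in> D" using that by (auto simp: U_def)
    from open_not_joined_in[OF this(2,3,1)] obtain T
      where T: "open T" "(fst p, snd p) \<in> T" "\<forall>p\<in>T. fst p \<in> D \<longrightarrow> snd p \<in> D \<longrightarrow> \<not> joined_in D (fst p) (snd p)"
      by blast
    then have "T \<in> {T. open T \<and> (\<forall>p\<in>T. p \<in> D \<times> D \<longrightarrow> \<not> joined_in D (fst p) (snd p))}"
      by (simp add: mem_Times_iff)
    then have "p \<in> V" unfolding V_def using T(2) by (intro UnionI[of T]) simp_all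
    then show ?thesis ..
  qed auto
  have "U \<inter> (D \<times> D) = {} \<or> V \<inter> (D \<times> D) = {}"
    by (rule connectedD[OF connected_Times[OF connected_D connected_D] U V UV]) (use cov in blast)
  moreover have "(a, a) \<in> U"
    using joined_in_refl[OF a] by (simp add: U_def)
  moreover have "(a, b) \<in> V" using cov[of "(a, b)"] nj a b by (auto simp: U_def)
  ultimately show False using a b by blast
qed

text \<open>Suppose the complex tangent hyperplane at \<open>w\<close> contained another point \<open>z\<close> of the closed domain. On the
  line through \<open>w\<close> and \<open>z\<close> the point \<open>w\<close> is isolated in the closed domain, so a small circle around it stays
  outside. This persists for pairs of points of \<open>D\<close> close to \<open>w\<close> and \<open>z\<close>, but in their connected slice the
  two points cannot be joined without crossing the circle.\<close>

lemma complex_tangent_avoids_closure: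
  assumes w: "w \<in> frontier D" and z: "z \<in> closure D" and zw: "z \<noteq> w"
  shows "cpair (del \<rho> w) (w - z) \<noteq> 0"
proof
  assume tan: "cpair (del \<rho> w) (w - z) = 0"
  obtain r where r: "r > 0"
    "\<And>z. z \<in> closure D \<Longrightarrow> norm (w - z) \<le> r \<Longrightarrow> cpair (del \<rho> w) (w - z) = 0 \<Longrightarrow> w = z"
    using tangent_point_isolated[OF w] by blast
  define s where "s = min (1/2) (r / norm (w - z))"
  have s: "0 < s" "s < 1" using r zw by (auto simp: s_def)
  define T where "T = {p. \<forall>l\<in>sphere 0 s. line_pt (fst p) (snd p) l \<in> - closure D}"
  have "open T" unfolding T_def by (intro open_forall_compact_line) auto
  moreover have "(w, z) \<in> T"
    unfolding T_def
  proof (safe, goal_cases)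
    case (1 l)
    then have l: "cmod l = s" "line_pt w z l \<in> closure D" by auto
    have wl: "w - line_pt w z l = l *s (w - z)"
      by (simp add: line_pt_def vec_eq_iff algebra_simps)
    have "s * norm (w - z) \<le> r / norm (w - z) * norm (w - z)" by (intro mult_right_mono) (auto simp: s_def)
    then have "norm (w - line_pt w z l) \<le> r" unfolding wl norm_vector_scale l using zw by simp
    moreover have "cpair (del \<rho> w) (w - line_pt w z l) = 0" unfolding wl cpair_scale tan by simp
    ultimately have "w = line_pt w z l" by (rule r(2)[OF l(2)])
    then have "norm (l *s (w - z)) = 0" using wl by simp
    then show ?case using zw s l unfolding norm_vector_scale by simp
  qed
  moreover have "(w, z) \<in> closure (D \<times> D)"
    using w z by (simp add: closure_Times frontier_def)
  ultimately obtain p where p: "p \<in> T" "p \<in> D \<times> D"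
    by (meson disjoint_iff open_Int_closure_eq_empty)
  then obtain N where N: "connected N" "N \<subseteq> {l. line_pt (fst p) (snd p) l \<in> D}" "0 \<in> N" "1 \<in> N"
    using line_slices_connected[of "fst p" "snd p"] unfolding joined_in_def connected_component_def by auto
  have "connected (cmod ` N)" by (rule connected_continuous_image[OF _ N(1)]) (intro continuous_intros)
  moreover have "0 \<in> cmod ` N" by (rule image_eqI[OF _ N(3)]) simp
  moreover have "1 \<in> cmod ` N" by (rule image_eqI[OF _ N(4)]) simp
  ultimately have "s \<in> cmod ` N" by (rule connectedD_interval) (use s in simp_all)
  then obtain l where l: "l \<in> N" "cmod l = s" by auto
  then have "line_pt (fst p) (snd p) l \<in> closure D" using N(2) closure_subset[of D] by auto
  moreover have "l \<in> sphere 0 s" using l by simp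
  ultimately show False using p(1) unfolding T_def by blast
qed

lemma global_separation:
  obtains c where "c > 0"
    "\<And>w z. w \<in> frontier D \<Longrightarrow> z \<in> closure D \<Longrightarrow> c * (norm (w - z))\<^sup>2 \<le> cmod (cpair (del \<rho> w) (w - z))"
proof -
  obtain r c where rc: "r > 0" "c > 0"
    "\<And>w z. w \<in> frontier D \<Longrightarrow> \<rho> z \<le> 0 \<Longrightarrow> norm (w - z) \<le> r \<Longrightarrow> c * (norm (w - z))\<^sup>2 \<le> cmod (cpair (del \<rho> w) (w - z))"
    using local_separation by blast
  obtain R where R: "\<And>z. z \<in> closure D \<Longrightarrow> norm z \<le> R" "R > 0"
    using bounded_closure[OF bounded_D] unfolding bounded_pos by blast
  define X where "X = frontier D \<times> closure D \<inter> {p. r \<le> norm (fst p - snd p)}"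
  define F where "F p = cmod (cpair (del \<rho> (fst p)) (fst p - snd p))" for p
  have cX: "compact X" unfolding X_def
    by (intro compact_Int_closed compact_Times closed_Collect_le continuous_intros compact_frontier_bounded bounded_D)
       (use bounded_D in simp)
  have "continuous_on X (\<lambda>p. del \<rho> (fst p))"
    by (rule continuous_on_compose2[OF continuous_on_del[OF C2, of UNIV]]) (auto intro!: continuous_intros)
  then have cont_F: "continuous_on X F" unfolding F_def by (intro continuous_intros)
  have "\<exists>\<mu>>0. \<forall>p\<in>X. \<mu> \<le> F p"
  proof (cases "X = {}")
    case False
    then obtain p where p: "p \<in> X" "\<And>q. q \<in> X \<Longrightarrow> F p \<le> F q"
      using continuous_attains_inf[OF cX False cont_F] by blast
    have "fst p \<noteq> snd p" "fst p \<in> frontier D" "snd p \<in> closure D" using p(1) rc(1) unfolding X_def by auto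
    then have "F p > 0" unfolding F_def using complex_tangent_avoids_closure by auto
    then show ?thesis using p(2) by blast
  qed (auto intro: exI[of _ 1])
  then obtain \<mu> where mu: "\<mu> > 0" "\<And>p. p \<in> X \<Longrightarrow> \<mu> \<le> F p" by blast
  show ?thesis
  proof (rule that[of "min c (\<mu> / (2*R)\<^sup>2)"])
    show "min c (\<mu> / (2*R)\<^sup>2) > 0" using rc mu R by simp
    fix w z assume w: "w \<in> frontier D" and z: "z \<in> closure D"
    show "min c (\<mu> / (2*R)\<^sup>2) * (norm (w - z))\<^sup>2 \<le> cmod (cpair (del \<rho> w) (w - z))"
    proof (cases "norm (w - z) \<le> r")
      case True
      have "min c (\<mu> / (2*R)\<^sup>2) * (norm (w - z))\<^sup>2 \<le> c * (norm (w - z))\<^sup>2" by (intro mult_right_mono) auto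
      also have "\<dots> \<le> cmod (cpair (del \<rho> w) (w - z))" using rho_signs z by (intro rc(3) w True) auto
      finally show ?thesis .
    next
      case False
      have "w \<in> closure D" using w by (simp add: frontier_def)
      then have "norm (w - z) \<le> 2 * R" using R(1)[of w] R(1)[OF z] norm_triangle_ineq4[of w z] by linarith
      then have "(norm (w - z))\<^sup>2 \<le> (2*R)\<^sup>2" by (intro power_mono) auto
      then have "min c (\<mu> / (2*R)\<^sup>2) * (norm (w - z))\<^sup>2 \<le> \<mu> / (2*R)\<^sup>2 * (2*R)\<^sup>2"
        using mu by (intro mult_mono) auto
      also have "\<dots> = \<mu>" using R by simp
      also have "\<dots> \<le> F (w, z)" using w z False by (intro mu) (auto simp: X_def)
      finally show ?thesis by (simp add: F_def)
    qed
  qed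
qed


end

section \<open>Volume counting\<close>

text \<open>This bound and the next one are where Lebesgue measure enters. Comparing volumes of balls only makes it
  possible to work in coordinates adapted to the normal direction without changing variables.\<close>

lemma packing_card_le:
  fixes f :: "'i \<Rightarrow> 'a::euclidean_space"
  assumes fin: "finite I" and sub: "\<And>i. i \<in> I \<Longrightarrow> f i \<in> cball c R"
    and sep: "\<And>i j. i \<in> I \<Longrightarrow> j \<in> I \<Longrightarrow> i \<noteq> j \<Longrightarrow> e \<le> dist (f i) (f j)"
    and e: "e > 0" and R: "R \<ge> 0"
  shows "real (card I) * (e/2) ^ DIM('a) \<le> (R + e/2) ^ DIM('a)"
proof -
  let ?v = "unit_ball_vol (real DIM('a))"
  have "disjoint_family_on (\<lambda>i. ball (f i) (e/2)) I"
    unfolding disjoint_family_on_def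
  proof (intro ballI impI equals0I)
    fix i j x assume "i \<in> I" "j \<in> I" "i \<noteq> j" "x \<in> ball (f i) (e/2) \<inter> ball (f j) (e/2)"
    then show False using sep[of i j] dist_triangle2[of "f i" "f j" x] by (simp add: dist_commute)
  qed
  then have "measure lborel (\<Union>i\<in>I. ball (f i) (e/2)) = (\<Sum>i\<in>I. measure lborel (ball (f i) (e/2)))"
    using e by (intro measure_finite_Union fin) (auto simp: emeasure_ball)
  also have "\<dots> = real (card I) * (?v * (e/2) ^ DIM('a))"
    using e by (simp add: content_ball)
  finally have "real (card I) * (?v * (e/2) ^ DIM('a)) = measure lborel (\<Union>i\<in>I. ball (f i) (e/2))" ..
  also have "\<dots> \<le> measure lborel (cball c (R + e/2))"
  proof (rule measure_mono_fmeasurable)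
    show "(\<Union>i\<in>I. ball (f i) (e/2)) \<subseteq> cball c (R + e/2)"
    proof safe
      fix i x assume "i \<in> I" "x \<in> ball (f i) (e/2)"
      then show "x \<in> cball c (R + e/2)" using sub[of i] dist_triangle[of c x "f i"] by simp
    qed
  qed (auto intro!: borel_open open_UN fmeasurable_compact)
  also have "\<dots> = ?v * (R + e/2) ^ DIM('a)" using e R by (simp add: content_cball)
  finally have "?v * (real (card I) * (e/2) ^ DIM('a)) \<le> ?v * (R + e/2) ^ DIM('a)" by (simp add: mult_ac)
  then show ?thesis by simp
qed

lemma covering_volume_le:
  fixes c :: "'a::euclidean_space"
  assumes R: "R \<ge> 0" and fin: "\<And>i::nat. finite (J i)" and r: "\<And>i. r i \<ge> 0"
    and cov: "ball c R \<subseteq> (\<Union>i. \<Union>j\<in>J i. cball (p i j) (r i))"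
  shows "ennreal (R ^ DIM('a)) \<le> (\<Sum>i. ennreal (real (card (J i)) * r i ^ DIM('a)))"
proof -
  let ?v = "unit_ball_vol (real DIM('a))"
  have v: "?v > 0" by simp
  then have v0: "?v \<noteq> 0" by linarith
  have meas: "(\<Union>j\<in>J i. cball (p i j) (r i)) \<in> sets lborel" for i
    by (intro sets.finite_UN fin) auto
  have "ennreal (?v * R ^ DIM('a)) = emeasure lborel (ball c R)" using R by (simp add: emeasure_ball)
  also have "\<dots> \<le> emeasure lborel (\<Union>i. \<Union>j\<in>J i. cball (p i j) (r i))"
    by (intro emeasure_mono cov sets.countable_UN) (use meas in blast)
  also have "\<dots> \<le> (\<Sum>i. emeasure lborel (\<Union>j\<in>J i. cball (p i j) (r i)))"
    by (intro emeasure_subadditive_countably) (use meas in blast)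
  also have "\<dots> \<le> (\<Sum>i. ennreal (?v * (real (card (J i)) * r i ^ DIM('a))))"
  proof (intro suminf_le)
    fix i
    have "emeasure lborel (\<Union>j\<in>J i. cball (p i j) (r i)) \<le> (\<Sum>j\<in>J i. emeasure lborel (cball (p i j) (r i)))"
      by (intro emeasure_subadditive_finite fin) auto
    also have "\<dots> = ennreal (?v * (real (card (J i)) * r i ^ DIM('a)))"
      using r v by (simp add: emeasure_cball ennreal_of_nat_eq_real_of_nat ennreal_mult[symmetric] mult_ac)
    finally show "emeasure lborel (\<Union>j\<in>J i. cball (p i j) (r i)) \<le> ennreal (?v * (real (card (J i)) * r i ^ DIM('a)))" .
  qed auto
  finally have *: "ennreal (?v * R ^ DIM('a)) \<le> (\<Sum>i. ennreal (?v * (real (card (J i)) * r i ^ DIM('a))))" .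
  have "ennreal (R ^ DIM('a)) = ennreal (1 / ?v) * ennreal (?v * R ^ DIM('a))"
    using v R by (subst ennreal_mult[symmetric]) (auto simp del: unit_ball_vol_pos)
  also have "\<dots> \<le> ennreal (1 / ?v) * (\<Sum>i. ennreal (?v * (real (card (J i)) * r i ^ DIM('a))))"
    by (intro mult_left_mono *) auto
  also have "\<dots> = (\<Sum>i. ennreal (1 / ?v) * ennreal (?v * (real (card (J i)) * r i ^ DIM('a))))"
    by (rule ennreal_suminf_cmult[symmetric])
  also have "\<dots> = (\<Sum>i. ennreal (real (card (J i)) * r i ^ DIM('a)))"
    using v r by (intro suminf_cong, subst ennreal_mult[symmetric]) (auto simp: v0)
  finally show ?thesis .
qed

text \<open>The packing bound limits the size of separated subsets, and one of maximal size is a net.\<close>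

lemma bounded_maximal_separated_net:
  fixes A :: "'a::euclidean_space set"
  assumes A: "bounded A" and e: "e > 0"
  obtains X where "finite X" "X \<subseteq> A" "\<And>x y. x \<in> X \<Longrightarrow> y \<in> X \<Longrightarrow> x \<noteq> y \<Longrightarrow> e \<le> dist x y"
    "A \<subseteq> (\<Union>x\<in>X. cball x e)"
proof -
  define P where "P X \<longleftrightarrow> finite X \<and> X \<subseteq> A \<and> (\<forall>x\<in>X. \<forall>y\<in>X. x \<noteq> y \<longrightarrow> e \<le> dist x y)" for X
  obtain R where "R > 0" "\<forall>x\<in>A. norm x \<le> R"
    using A unfolding bounded_pos by blast
  then have R: "R \<ge> 0" "A \<subseteq> cball 0 R" by auto
  define b where "b = nat \<lceil>(R + e/2) ^ DIM('a) / (e/2) ^ DIM('a)\<rceil> + 1"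
  have "P {}" by (simp add: P_def)
  moreover have "\<forall>X. P X \<longrightarrow> card X < b"
  proof safe
    fix X assume X: "P X"
    have "real (card X) * (e/2) ^ DIM('a) \<le> (R + e/2) ^ DIM('a)"
      using X R e unfolding P_def by (intro packing_card_le[of X "\<lambda>x. x" 0]) auto
    then have "real (card X) \<le> (R + e/2) ^ DIM('a) / (e/2) ^ DIM('a)"
      using e by (simp add: pos_le_divide_eq del: power_divide)
    then show "card X < b" unfolding b_def by linarith
  qed
  ultimately obtain X where X: "P X" "\<And>Y. P Y \<Longrightarrow> card Y \<le> card X"
    using ex_has_greatest_nat[of P "{}" card b] by blast
  have "A \<subseteq> (\<Union>x\<in>X. cball x e)"
  proof (rule ccontr)
    assume "\<not> A \<subseteq> (\<Union>x\<in>X. cball x e)"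
    then obtain a where a: "a \<in> A" "\<And>x. x \<in> X \<Longrightarrow> e < dist x a" by (force simp: not_le)
    have "P (insert a X)"
      using X(1) a unfolding P_def by (auto simp: dist_commute less_imp_le)
    moreover have "a \<notin> X" using a(2)[of a] e by auto
    ultimately show False using X(2)[of "insert a X"] X(1) unfolding P_def by auto
  qed
  then show ?thesis using that X(1) unfolding P_def by blast
qed

lemma suminf_constant_prefix:
  assumes "\<And>i. i \<ge> n \<Longrightarrow> h i = 0" "\<And>i. i < n \<Longrightarrow> h i = c"
  shows "(\<Sum>i. h i :: ennreal) = of_nat n * c"
proof -
  have "(\<Sum>i. h i) = (\<Sum>i<n. h i)" by (rule suminf_finite) (use assms in auto)
  also have "\<dots> = of_nat n * c" using assms by simp
  finally show ?thesis .
qed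

section \<open>Caps of the boundary\<close>

text \<open>The properties of the boundary on which the measure estimates rest: the gradient is bounded
  below (\<open>m\<close>), the normalised tangent functional is Lipschitz (\<open>L\<close>), \<open>\<rho>\<close> has a uniform first-order expansion (\<open>K\<close>), and the boundary bends
  away quadratically from every complex tangent hyperplane, near or far (\<open>\<kappa>\<close>).\<close>

locale separated_hypersurface =
  fixes D :: "(complex ^ 'd) set" and \<rho> :: "complex ^ 'd \<Rightarrow> real" and L K m \<kappa> :: real
  assumes D_open: "open D" and D_bounded: "bounded D" and D_ne: "D \<noteq> {}" and D_eq: "D = {z. \<rho> z < 0}"
    and cont: "continuous_on UNIV \<rho>" and cont_del: "continuous_on UNIV (del \<rho>)"
    and pos: "L > 0" "K > 0" "m > 0" "\<kappa> > 0"
    and m_le: "\<And>w. w \<in> frontier D \<Longrightarrow> m \<le> norm (del \<rho> w)"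
    and lip: "\<And>w z v. w \<in> frontier D \<Longrightarrow> z \<in> frontier D \<Longrightarrow>
       cmod (nform \<rho> w v - nform \<rho> z v) \<le> L * norm (w - z) * norm v"
    and taylor: "\<And>w v. w \<in> frontier D \<Longrightarrow> norm v \<le> 1 \<Longrightarrow>
       \<bar>\<rho> (w + v) - 2 * norm (del \<rho> w) * Re (nform \<rho> w v)\<bar> \<le> K * (norm v)\<^sup>2"
    and sep: "\<And>w z. w \<in> frontier D \<Longrightarrow> z \<in> frontier D \<Longrightarrow>
       \<kappa> * (norm (w - z))\<^sup>2 \<le> cmod (nform \<rho> w (w - z))"

lemma (in bounded_C_convex_domain) boundary_separated_hypersurface:
  obtains L K m \<kappa> where "separated_hypersurface D \<rho> L K m \<kappa>"
proof -
  obtain c where c: "c > 0"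
    "\<And>w z. w \<in> frontier D \<Longrightarrow> z \<in> closure D \<Longrightarrow> c * (norm (w - z))\<^sup>2 \<le> cmod (cpair (del \<rho> w) (w - z))"
    using global_separation by blast
  obtain R where R: "\<And>w. w \<in> frontier D \<Longrightarrow> norm w \<le> R"
    using compact_imp_bounded[OF frontier_compact_ne(1)] unfolding bounded_iff by blast
  obtain B where B: "B > 0" "\<And>x u v. x \<in> cball 0 (R+1) \<Longrightarrow> \<bar>hess \<rho> x u v\<bar> \<le> B * (norm u * norm v)"
    using hess_bounded_on_compact[OF C2 compact_cball] by blast
  have cn: "continuous_on (frontier D) (\<lambda>w. norm (del \<rho> w))"
    by (intro continuous_intros continuous_on_del[OF C2])
  obtain p where p: "p \<in> frontier D" "\<And>w. w \<in> frontier D \<Longrightarrow> norm (del \<rho> p) \<le> norm (del \<rho> w)"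
    using continuous_attains_inf[OF frontier_compact_ne(1) frontier_compact_ne(2)[OF D_ne] cn] by blast
  obtain q where q: "q \<in> frontier D" "\<And>w. w \<in> frontier D \<Longrightarrow> norm (del \<rho> w) \<le> norm (del \<rho> q)"
    using continuous_attains_sup[OF frontier_compact_ne(1) frontier_compact_ne(2)[OF D_ne] cn] by blast
  define m where "m = norm (del \<rho> p)"
  define M where "M = norm (del \<rho> q)"
  have m: "m > 0" unfolding m_def using del_nonzero_on_frontier[OF p(1)] by simp
  have M: "M > 0" unfolding M_def using del_nonzero_on_frontier[OF q(1)] by simp
  have in_ball: "w \<in> cball 0 (R+1)" if "w \<in> frontier D" for w using R[OF that] by simp
  have "separated_hypersurface D \<rho> (2 * B / m) B m (c / M)"
  proof
    show "continuous_on UNIV \<rho>" "continuous_on UNIV (del \<rho>)"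
      by (rule C2_continuous[OF C2] continuous_on_del[OF C2])+
    show "m \<le> norm (del \<rho> w)" if "w \<in> frontier D" for w using p(2)[OF that] by (simp add: m_def)
    show "cmod (nform \<rho> w v - nform \<rho> z v) \<le> 2 * B / m * norm (w - z) * norm v"
      if "w \<in> frontier D" "z \<in> frontier D" for w z v
      by (rule nform_lipschitz[OF C2 B(2) convex_cball in_ball[OF that(1)] in_ball[OF that(2)] _ m])
         (use B(1) p(2) that in \<open>auto simp: m_def\<close>)
    show "\<bar>\<rho> (w + v) - 2 * norm (del \<rho> w) * Re (nform \<rho> w v)\<bar> \<le> B * (norm v)\<^sup>2"
      if w: "w \<in> frontier D" and v: "norm v \<le> 1" for w v
    proof -
      obtain t where t: "0 < t" "t < 1"
        "\<rho> (w + v) = \<rho> w + frechet_derivative \<rho> (at w) v + hess \<rho> (w + t *\<^sub>R v) v v / 2"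
        using Taylor_C2[OF C2] by blast
      have "2 * norm (del \<rho> w) * Re (nform \<rho> w v) = frechet_derivative \<rho> (at w) v"
        unfolding frechet_derivative_eq_del[OF C2] nform_def using del_nonzero_on_frontier[OF w] by simp
      then have "\<rho> (w + v) - 2 * norm (del \<rho> w) * Re (nform \<rho> w v) = hess \<rho> (w + t *\<^sub>R v) v v / 2"
        using t(3) rho_signs(2) w by auto
      moreover have "\<bar>hess \<rho> (w + t *\<^sub>R v) v v\<bar> \<le> B * (norm v * norm v)"
      proof (rule B(2))
        have "norm (t *\<^sub>R v) \<le> norm v" using t by (simp add: mult_left_le_one_le)
        then show "w + t *\<^sub>R v \<in> cball 0 (R+1)"
          using norm_triangle_ineq[of w "t *\<^sub>R v"] R[OF w] v by simp
      qed
      ultimately show ?thesis by (simp add: power2_eq_square)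
    qed
    show "c / M * (norm (w - z))\<^sup>2 \<le> cmod (nform \<rho> w (w - z))"
      if w: "w \<in> frontier D" and z: "z \<in> frontier D" for w z
    proof -
      have "c * (norm (w - z))\<^sup>2 / M \<le> cmod (cpair (del \<rho> w) (w - z)) / norm (del \<rho> w)"
        using c(2)[OF w] z del_nonzero_on_frontier[OF w] q(2)[OF w] M c(1)
        by (intro frac_le) (auto simp: frontier_def M_def)
      then show ?thesis by (simp add: norm_nform)
    qed
  qed (use open_D bounded_D D_ne D_eq m M B c in auto)
  then show ?thesis by (rule that)
qed

context separated_hypersurface begin

abbreviation "bD \<equiv> frontier D"
abbreviation "ell \<equiv> nform \<rho>"
abbreviation "nu \<equiv> nvec \<rho>"

text \<open>The tangent functional is taken at the moving point \<open>w\<close>: a cap consists of the points whose constraint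
  excludes \<open>z\<close>, and not of the points that the constraint of \<open>z\<close> excludes.\<close>

definition cap :: "complex ^ 'd \<Rightarrow> real \<Rightarrow> (complex ^ 'd) set" where
  "cap z d = {w \<in> bD. cmod (ell w (w - z)) \<le> d}"

lemma frontier_zero: "w \<in> bD \<Longrightarrow> \<rho> w = 0"
  using frontier_sublevel(2)[OF cont D_eq] by auto

lemma del_nonzero: "w \<in> bD \<Longrightarrow> del \<rho> w \<noteq> 0"
  using m_le[of w] pos by auto

lemma compact_frontier: "compact (bD)" and frontier_ne: "bD \<noteq> {}"
  using bounded_domain_frontier[OF D_bounded] D_ne by auto

lemma continuous_on_nform:
  assumes "continuous_on X F" "continuous_on X G" "\<And>x. x \<in> X \<Longrightarrow> F x \<in> bD"
  shows "continuous_on X (\<lambda>x. ell (F x) (G x))"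
  unfolding nform_def using assms del_nonzero
  by (intro continuous_intros continuous_on_compose2[OF cont_del]) auto

lemma compact_cap: "compact (cap z d)"
proof -
  have "closedin (top_of_set (bD)) (bD \<inter> (\<lambda>w. cmod (ell w (w - z))) -` {..d})"
    by (intro continuous_closedin_preimage continuous_on_nform continuous_intros) auto
  then have "compact (bD \<inter> (\<lambda>w. cmod (ell w (w - z))) -` {..d})"
    using closedin_compact compact_frontier by blast
  moreover have "cap z d = bD \<inter> (\<lambda>w. cmod (ell w (w - z))) -` {..d}"
    by (auto simp: cap_def)
  ultimately show ?thesis by simp
qed

text \<open>Chosen such that over distances of at most \<open>2 * \<tau> * sqrt d\<close> the Taylor error and the turning of the tangent
  functional are small fractions of \<open>d\<close>.\<close>

definition \<tau> :: real where "\<tau> = min (1/2) (min (m / (32 * K)) (1 / (8 * L)))"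

lemma tau: "\<tau> > 0" "\<tau> \<le> 1/2" "32 * K * \<tau>\<^sup>2 \<le> m" "8 * L * \<tau>\<^sup>2 \<le> 1"
proof -
  show t: "\<tau> > 0" "\<tau> \<le> 1/2" using pos by (auto simp: \<tau>_def)
  have sq: "\<tau>\<^sup>2 \<le> \<tau>" using t by (simp add: power2_eq_square mult_left_le)
  have "32 * K * \<tau>\<^sup>2 \<le> 32 * K * \<tau>" using sq pos by (intro mult_left_mono) auto
  also have "\<dots> \<le> 32 * K * (m / (32 * K))" using pos by (intro mult_left_mono) (auto simp: \<tau>_def)
  finally show "32 * K * \<tau>\<^sup>2 \<le> m" using pos by simp
  have "8 * L * \<tau>\<^sup>2 \<le> 8 * L * \<tau>" using sq pos by (intro mult_left_mono) auto
  also have "\<dots> \<le> 8 * L * (1 / (8 * L))" using pos by (intro mult_left_mono) (auto simp: \<tau>_def)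
  finally show "8 * L * \<tau>\<^sup>2 \<le> 1" using pos by simp
qed

text \<open>On the segment of the normal line through \<open>z + y\<close> with \<open>\<bar>t\<bar> \<le> d / 4\<close> the first-order term of \<open>\<rho>\<close> changes
  sign and dominates the error at both ends, so the segment runs from \<open>D\<close> to its complement.\<close>

lemma normal_line_meets_frontier:
  assumes z: "z \<in> bD" and d: "0 < d" "d \<le> \<tau>\<^sup>2"
    and y: "\<bar>Re (ell z y)\<bar> \<le> d / 8" "norm y \<le> \<tau> * sqrt d"
  obtains t where "\<bar>t\<bar> \<le> d / 4" "z + y + t *\<^sub>R nu z \<in> bD"
    "norm (y + t *\<^sub>R nu z) \<le> 2 * \<tau> * sqrt d"
proof -
  let ?n = "nu z"
  have n1: "norm ?n = 1" "ell z ?n = 1" by (simp_all add: norm_nvec nform_nvec del_nonzero[OF z])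
  have sd: "sqrt d \<le> \<tau>" using d tau real_le_lsqrt[of \<tau> d] by auto
  have "sqrt d * sqrt d \<le> \<tau> * sqrt d" using sd d by (intro mult_right_mono) auto
  then have d_le: "d \<le> \<tau> * sqrt d" using d by simp
  have ny: "norm (y + t *\<^sub>R ?n) \<le> 2 * \<tau> * sqrt d" if "\<bar>t\<bar> \<le> d / 4" for t
    using norm_triangle_ineq[of y "t *\<^sub>R ?n"] y(2) that d_le n1 by simp
  have "\<tau> * sqrt d \<le> (1/2) * (1/2)" using tau sd d by (intro mult_mono) auto
  then have ny1: "norm (y + t *\<^sub>R ?n) \<le> 1" if "\<bar>t\<bar> \<le> d / 4" for t
    using ny[OF that] by linarith
  have ny2: "K * (norm (y + t *\<^sub>R ?n))\<^sup>2 \<le> m * d / 8" if "\<bar>t\<bar> \<le> d / 4" for t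
  proof -
    have "(norm (y + t *\<^sub>R ?n))\<^sup>2 \<le> (2 * \<tau> * sqrt d)\<^sup>2"
      by (intro power_mono ny that) auto
    also have "\<dots> = 4 * \<tau>\<^sup>2 * d" using d by (simp add: power_mult_distrib)
    finally have "K * (norm (y + t *\<^sub>R ?n))\<^sup>2 \<le> K * (4 * \<tau>\<^sup>2 * d)" using pos by (intro mult_left_mono) auto
    also have "\<dots> = (32 * K * \<tau>\<^sup>2) * (d / 8)" by simp
    also have "\<dots> \<le> m * (d / 8)" using tau d by (intro mult_right_mono) auto
    finally show ?thesis by simp
  qed
  have lin: "Re (ell z (y + t *\<^sub>R ?n)) = Re (ell z y) + t" for t
    by (simp add: nform_add nform_scaleR n1)
  define g where "g t = z + y + t *\<^sub>R ?n" for t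
  have g: "g t = z + (y + t *\<^sub>R ?n)" for t by (simp add: g_def)
  have mz: "m \<le> norm (del \<rho> z)" by (rule m_le[OF z])
  have mm: "m * d / 4 \<le> 2 * norm (del \<rho> z) * s" if "d/8 \<le> s" for s
  proof -
    have "2 * m * (d/8) \<le> 2 * norm (del \<rho> z) * s" using mz that d pos by (intro mult_mono) auto
    then show ?thesis by (simp add: mult.commute)
  qed
  have md: "m * d > 0" using pos d by simp
  have "\<rho> (g (d/4)) > 0"
  proof -
    have a: "\<bar>d/4\<bar> \<le> d/4" using d by simp
    have "m * d / 4 \<le> 2 * norm (del \<rho> z) * Re (ell z (y + (d/4) *\<^sub>R ?n))"
      by (rule mm) (use y(1) lin[of "d/4"] in linarith)
    then show ?thesis using taylor[OF z ny1[OF a]] ny2[OF a] md unfolding g by linarith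
  qed
  moreover have "\<rho> (g (-(d/4))) < 0"
  proof -
    have a: "\<bar>-(d/4)\<bar> \<le> d/4" using d by simp
    have "m * d / 4 \<le> 2 * norm (del \<rho> z) * (- Re (ell z (y + (-(d/4)) *\<^sub>R ?n)))"
      by (rule mm) (use y(1) lin[of "-(d/4)"] in linarith)
    then show ?thesis using taylor[OF z ny1[OF a]] ny2[OF a] md unfolding g by linarith
  qed
  moreover have "connected (g ` {-(d/4)..d/4})"
    unfolding g_def by (intro connected_continuous_image continuous_intros) auto
  ultimately have "g ` {-(d/4)..d/4} \<inter> bD \<noteq> {}"
  proof (intro connected_Int_frontier)
    assume "0 < \<rho> (g (d/4))" "\<rho> (g (-(d/4))) < 0"
    moreover have "g (d/4) \<in> g ` {-(d/4)..d/4}" "g (-(d/4)) \<in> g ` {-(d/4)..d/4}" using d by auto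
    ultimately show "g ` {-(d/4)..d/4} \<inter> D \<noteq> {}" "g ` {-(d/4)..d/4} - D \<noteq> {}"
      unfolding D_eq by (blast, force)
  qed
  then obtain t where t: "t \<in> {-(d/4)..d/4}" "g t \<in> bD" by blast
  then have "\<bar>t\<bar> \<le> d/4" by auto
  then show ?thesis using that t(2) ny unfolding g_def by blast
qed

text \<open>The slab of vectors \<open>y\<close> with \<open>cmod (ell z y) \<le> d / 8\<close> and \<open>norm y \<le> \<tau> * sqrt d\<close> plays the role of a
  coordinate chart: along the normal direction it projects into the cap.\<close>

lemma slab_projects_to_cap:
  assumes z: "z \<in> bD" and d: "0 < d" "d \<le> \<tau>\<^sup>2"
    and y: "cmod (ell z y) \<le> d / 8" "norm y \<le> \<tau> * sqrt d"
  obtains t where "\<bar>t\<bar> \<le> d / 4" "z + y + t *\<^sub>R nu z \<in> cap z d"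
proof -
  let ?n = "nu z"
  have "\<bar>Re (ell z y)\<bar> \<le> d / 8" using y(1) abs_Re_le_cmod order_trans by blast
  then obtain t where t: "\<bar>t\<bar> \<le> d / 4" "z + y + t *\<^sub>R ?n \<in> bD" "norm (y + t *\<^sub>R ?n) \<le> 2 * \<tau> * sqrt d"
    using normal_line_meets_frontier[OF z d _ y(2)] by blast
  define w where "w = z + y + t *\<^sub>R ?n"
  have wz: "w - z = y + t *\<^sub>R ?n" by (simp add: w_def)
  have "(norm (w - z))\<^sup>2 \<le> (2 * \<tau> * sqrt d)\<^sup>2" unfolding wz by (intro power_mono t) auto
  also have "\<dots> = 4 * \<tau>\<^sup>2 * d" using d by (simp add: power_mult_distrib)
  finally have "L * (norm (w - z))\<^sup>2 \<le> L * (4 * \<tau>\<^sup>2 * d)" using pos by (intro mult_left_mono) auto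
  also have "\<dots> = (8 * L * \<tau>\<^sup>2) * (d / 2)" by simp
  also have "\<dots> \<le> 1 * (d / 2)" using tau d by (intro mult_right_mono) auto
  finally have "cmod (ell w (w - z) - ell z (w - z)) \<le> d / 2"
    using lip[of w z "w - z"] t(2) z by (simp add: w_def[symmetric] power2_eq_square mult_ac)
  moreover have "cmod (ell z (w - z)) \<le> d/8 + d/4"
    unfolding wz nform_add nform_scaleR nform_nvec[OF del_nonzero[OF z]]
    using norm_triangle_ineq[of "ell z y" "of_real t * 1"] y(1) t(1) by simp
  ultimately have "cmod (ell w (w - z)) \<le> d"
    using norm_triangle_ineq2[of "ell w (w - z)" "ell z (w - z)"] d by linarith
  then show ?thesis using that t unfolding cap_def w_def by blast
qed

end

section \<open>Hausdorff measure of caps\<close>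

lemma exists_slightly_larger:
  fixes d b \<eta> :: real
  assumes "d < b" "\<eta> > 0"
  obtains e where "d < e" "e \<le> b" "e ^ k \<le> d ^ k + \<eta>"
proof -
  have "((\<lambda>e. e ^ k) \<longlongrightarrow> d ^ k) (at_right d)" by (intro tendsto_intros)
  then have "\<forall>\<^sub>F e in at_right d. e ^ k < d ^ k + \<eta>" using assms(2) by (intro order_tendstoD) auto
  moreover have "\<forall>\<^sub>F e in at_right d. e \<in> {d<..<b}" using assms(1) by (intro eventually_at_right_real)
  ultimately have "\<forall>\<^sub>F e in at_right d. e ^ k < d ^ k + \<eta> \<and> e \<in> {d<..<b}" by (rule eventually_conj)
  then obtain e where "e ^ k < d ^ k + \<eta> \<and> e \<in> {d<..<b}"
    using eventually_happens'[OF trivial_limit_at_right_real] by blast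
  then show ?thesis using that by auto
qed

lemma hausdorff_gauge_eq:
  assumes "k > 0" "bounded U"
  shows "hausdorff_gauge k U = ennreal (unit_ball_vol (real k) / 2 ^ k) * ennreal (diameter U ^ k)"
proof -
  have d: "diameter U \<ge> 0" using assms(2) by (rule diameter_ge_0)
  have "hausdorff_gauge k U = ennreal (unit_ball_vol (real k) * (diameter U / 2) ^ k)"
    using assms(1) by (simp add: hausdorff_gauge_def)
  also have "\<dots> = ennreal (unit_ball_vol (real k) / 2 ^ k * diameter U ^ k)"
    by (simp add: power_divide)
  also have "\<dots> = ennreal (unit_ball_vol (real k) / 2 ^ k) * ennreal (diameter U ^ k)"
    using d by (intro ennreal_mult) auto
  finally show ?thesis .
qed

lemma floor_div_bounds:
  fixes x h R :: real
  assumes h: "h > 0" and x: "\<bar>x\<bar> \<le> R"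
  shows "\<lfloor>x / h\<rfloor> \<in> {- \<lceil>R / h\<rceil> .. \<lceil>R / h\<rceil>}"
    and "\<lfloor>x / h\<rfloor> = \<lfloor>y / h\<rfloor> \<Longrightarrow> \<bar>x - y\<bar> \<le> h"
    and "\<bar>x - of_int \<lfloor>x / h\<rfloor> * h\<bar> \<le> h"
proof -
  have "x / h \<le> R / h" "- (R / h) \<le> x / h" using x h by (auto simp: divide_right_mono field_simps)
  then show "\<lfloor>x / h\<rfloor> \<in> {- \<lceil>R / h\<rceil> .. \<lceil>R / h\<rceil>}"
    unfolding atLeastAtMost_iff by linarith
  show "\<bar>x - of_int \<lfloor>x / h\<rfloor> * h\<bar> \<le> h"
  proof -
    have "\<bar>x / h - of_int \<lfloor>x / h\<rfloor>\<bar> \<le> 1" by linarith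
    then have "\<bar>x / h - of_int \<lfloor>x / h\<rfloor>\<bar> * h \<le> 1 * h" using h by (intro mult_right_mono) auto
    also have "\<bar>x / h - of_int \<lfloor>x / h\<rfloor>\<bar> * h = \<bar>(x / h - of_int \<lfloor>x / h\<rfloor>) * h\<bar>" using h by (simp add: abs_mult)
    also have "(x / h - of_int \<lfloor>x / h\<rfloor>) * h = x - of_int \<lfloor>x / h\<rfloor> * h" using h by (simp add: field_simps)
    finally show ?thesis by simp
  qed
  assume "\<lfloor>x / h\<rfloor> = \<lfloor>y / h\<rfloor>"
  then have "\<bar>x / h - y / h\<bar> \<le> 1" by linarith
  then have "\<bar>x / h - y / h\<bar> * h \<le> 1 * h" using h by (intro mult_right_mono) auto
  also have "\<bar>x / h - y / h\<bar> * h = \<bar>(x / h - y / h) * h\<bar>" using h by (simp add: abs_mult)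
  also have "(x / h - y / h) * h = x - y" using h by (simp add: field_simps)
  finally show "\<bar>x - y\<bar> \<le> h" by simp
qed

lemma card_symmetric_int_interval:
  assumes "x \<ge> 0" shows "real (card {- \<lceil>x\<rceil> .. \<lceil>x\<rceil>}) \<le> 2 * x + 3" "real (card {- \<lceil>x\<rceil> .. \<lceil>x\<rceil>}) > 0"
proof -
  have c: "\<lceil>x\<rceil> \<ge> 0" using assms by linarith
  then have "real (card {- \<lceil>x\<rceil> .. \<lceil>x\<rceil>}) = of_int (2 * \<lceil>x\<rceil> + 1)" by simp
  then have "real (card {- \<lceil>x\<rceil> .. \<lceil>x\<rceil>}) = 2 * real_of_int \<lceil>x\<rceil> + 1" by (simp only: of_int_add of_int_mult of_int_numeral of_int_1)
  moreover have "real_of_int \<lceil>x\<rceil> \<le> x + 1" "real_of_int \<lceil>x\<rceil> \<ge> 0" using c by linarith+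
  ultimately show "real (card {- \<lceil>x\<rceil> .. \<lceil>x\<rceil>}) \<le> 2 * x + 3" "real (card {- \<lceil>x\<rceil> .. \<lceil>x\<rceil>}) > 0" by linarith+
qed

context separated_hypersurface begin

text \<open>Any cover of the cap yields a cover of a Euclidean ball. Sort the vectors of the ball of radius
  \<open>\<tau> * sqrt d / 2\<close> into cells by the value of \<open>ell z\<close>; there are \<open>O(1 / d)\<close> cells, and two vectors of one
  cell differ by a vector of the slab. Hence every vector is, up to a representative of its cell, a
  point of some \<open>U i\<close> shifted along the normal by at most \<open>d / 4\<close>. Rounding this shift to a multiple of \<open>e i\<close>
  leaves \<open>O(d / e i)\<close> balls of radius \<open>2 * e i\<close> for each cell. The powers of \<open>d\<close> cancel and one factor
  \<open>e i\<close> is lost, which leaves the exponent of the surface measure.\<close>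

lemma cap_cover_lower_bound:
  assumes z: "z \<in> bD" and d: "0 < d" "d \<le> \<tau>\<^sup>2"
    and U: "cap z d \<subseteq> (\<Union>i. U i)" "\<And>i. bounded (U i)"
    and e: "\<And>i. diameter (U i) < e i" "\<And>i. e i \<le> 2 * d"
  shows "ennreal ((\<tau> * sqrt d / 2) ^ (2 * CARD('d)))
     \<le> (\<Sum>i::nat. ennreal (11200 * \<tau>\<^sup>2 * 2 ^ (2 * CARD('d)) * e i ^ (2 * CARD('d) - 1)))"
proof -
  let ?n = "nu z"
  define n where "n = 2 * CARD('d)"
  have DIMn: "DIM(complex ^ 'd) = n" by (simp add: n_def)
  have n0: "n > 0" by (simp add: n_def)
  define R where "R = \<tau> * sqrt d / 2"
  \<comment> \<open>Two vectors in a cell of side d / 16 have values of ell z at distance at most d / 8.\<close>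
  define h where "h = d / 16"
  have h: "h > 0" using d by (simp add: h_def)
  have R: "R > 0" using d tau by (simp add: R_def)
  have epos: "e i > 0" for i using e(1)[of i] diameter_ge_0[OF U(2), of i] by linarith
  define cell where "cell y = (\<lfloor>Re (ell z y) / h\<rfloor>, \<lfloor>Im (ell z y) / h\<rfloor>)" for y
  define I where "I = {- \<lceil>R / h\<rceil> .. \<lceil>R / h\<rceil>} \<times> {- \<lceil>R / h\<rceil> .. \<lceil>R / h\<rceil>}"
  define rep where "rep c = (SOME y. y \<in> ball 0 R \<and> cell y = c)" for c
  have rep: "rep (cell y) \<in> ball 0 R" "cell (rep (cell y)) = cell y" if "y \<in> ball 0 R" for y
    using someI[of "\<lambda>y'. y' \<in> ball 0 R \<and> cell y' = cell y" y] that unfolding rep_def by auto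
  define u0 where "u0 i = (SOME u. u \<in> U i)" for i
  define J where "J i = I \<times> {- \<lceil>(d/4) / e i\<rceil> .. \<lceil>(d/4) / e i\<rceil>}" for i
  \<comment> \<open>The pair j consists of a cell and of the rounded position on the normal line.\<close>
  define p where "p i j = rep (fst j) + u0 i - z - (of_int (snd j) * e i) *\<^sub>R ?n" for i and j :: "(int \<times> int) \<times> int"
  have small: "\<bar>Re (ell z y)\<bar> \<le> R" "\<bar>Im (ell z y)\<bar> \<le> R" if "y \<in> ball 0 R" for y
    using that norm_nform_le[of \<rho> z y] abs_Re_le_cmod[of "ell z y"] abs_Im_le_cmod[of "ell z y"]
    by auto
  have cov: "ball 0 R \<subseteq> (\<Union>i. \<Union>j\<in>J i. cball (p i j) (2 * e i))"
  proof
    fix y :: "complex ^ 'd" assume y: "y \<in> ball 0 R"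
    define y' where "y' = rep (cell y)"
    have y': "y' \<in> ball 0 R" "cell y' = cell y" using rep[OF y] by (simp_all add: y'_def)
    have "\<bar>Re (ell z y) - Re (ell z y')\<bar> \<le> h" "\<bar>Im (ell z y) - Im (ell z y')\<bar> \<le> h"
      using y'(2) unfolding cell_def by (auto intro!: floor_div_bounds(2)[OF h order_refl])
    then have "cmod (ell z (y - y')) \<le> h + h"
      unfolding nform_diff by (intro order_trans[OF cmod_le] add_mono) auto
    then have a: "cmod (ell z (y - y')) \<le> d / 8" by (simp add: h_def)
    have b: "norm (y - y') \<le> \<tau> * sqrt d"
      using y y'(1) norm_triangle_ineq4[of y y'] by (simp add: R_def)
    obtain t where t: "\<bar>t\<bar> \<le> d / 4" "z + (y - y') + t *\<^sub>R ?n \<in> cap z d"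
      using slab_projects_to_cap[OF z d a b] by blast
    then obtain i where i: "z + (y - y') + t *\<^sub>R ?n \<in> U i" using U(1) by blast
    then have "u0 i \<in> U i" unfolding u0_def by (rule someI)
    then have du: "dist (z + (y - y') + t *\<^sub>R ?n) (u0 i) < e i"
      using diameter_bounded_bound[OF U(2) i] e(1)[of i] by fastforce
    define k where "k = \<lfloor>t / e i\<rfloor>"
    have j: "(cell y, k) \<in> J i"
      unfolding J_def I_def k_def cell_def mem_Times_iff fst_conv snd_conv
      using floor_div_bounds(1)[OF h small(1)[OF y]] floor_div_bounds(1)[OF h small(2)[OF y]]
        floor_div_bounds(1)[OF epos t(1), of i] by blast
    have "p i (cell y, k) - y = (u0 i - (z + (y - y') + t *\<^sub>R ?n)) + (t - of_int k * e i) *\<^sub>R ?n"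
      unfolding p_def y'_def by (simp add: algebra_simps)
    then have "norm (p i (cell y, k) - y) \<le> norm (u0 i - (z + (y - y') + t *\<^sub>R ?n)) + norm ((t - of_int k * e i) *\<^sub>R ?n)"
      using norm_triangle_ineq by metis
    also have "norm ((t - of_int k * e i) *\<^sub>R ?n) \<le> e i"
      using floor_div_bounds(3)[OF epos t(1), of i] norm_nvec[OF del_nonzero[OF z]] by (simp add: k_def)
    finally have "y \<in> cball (p i (cell y, k)) (2 * e i)"
      using du by (simp add: dist_norm norm_minus_commute)
    then show "y \<in> (\<Union>i. \<Union>j\<in>J i. cball (p i j) (2 * e i))" using j by blast
  qed
  have fin: "finite (J i)" for i unfolding J_def I_def by auto
  have e2: "0 \<le> 2 * e i" for i using epos[of i] by simp
  have "ennreal (R ^ n) \<le> (\<Sum>i. ennreal (real (card (J i)) * (2 * e i) ^ n))"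
    by (rule covering_volume_le[OF less_imp_le[OF R] fin e2 cov, unfolded DIMn])
  also have "\<dots> \<le> (\<Sum>i. ennreal (11200 * \<tau>\<^sup>2 * 2 ^ n * e i ^ (n - 1)))"
  proof (intro suminf_le ennreal_leI)
    fix i
    have sd: "sqrt d \<le> \<tau>" using d tau real_le_lsqrt[of \<tau> d] by auto
    have Rh: "R / h = 8 * \<tau> / sqrt d"
      using d real_sqrt_mult_self[of d] by (simp add: R_def h_def field_simps)
    have "R / h \<ge> 1" unfolding Rh using sd d by (simp add: field_simps) (use tau in linarith)
    then have c1: "real (card {- \<lceil>R / h\<rceil> .. \<lceil>R / h\<rceil>}) \<le> 5 * (R / h)"
      using card_symmetric_int_interval(1)[of "R / h"] by linarith
    have c2: "real (card I) \<le> (5 * (R / h)) * (5 * (R / h))"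
      unfolding I_def card_cartesian_product of_nat_mult using R h by (intro mult_mono c1) auto
    also have "\<dots> = 1600 * \<tau>\<^sup>2 / d"
      unfolding Rh using d by (simp add: power2_eq_square)
    finally have cI: "real (card I) \<le> 1600 * \<tau>\<^sup>2 / d" .
    have "1 \<le> 2 * d / e i" using e(2)[of i] epos[of i] by simp
    then have cK: "real (card {- \<lceil>(d/4) / e i\<rceil> .. \<lceil>(d/4) / e i\<rceil>}) \<le> 7 * (d / e i)"
      using card_symmetric_int_interval(1)[of "(d/4) / e i"] d epos[of i] by (simp add: field_simps)
    have "real (card (J i)) \<le> (1600 * \<tau>\<^sup>2 / d) * (7 * (d / e i))"
      unfolding J_def card_cartesian_product of_nat_mult using d by (intro mult_mono cI cK) auto
    also have "\<dots> = 11200 * \<tau>\<^sup>2 / e i" using d by simp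
    finally have "real (card (J i)) * (2 * e i) ^ n \<le> 11200 * \<tau>\<^sup>2 / e i * (2 * e i) ^ n"
      using epos[of i] by (intro mult_right_mono) auto
    also have "\<dots> = 11200 * \<tau>\<^sup>2 * 2 ^ n * e i ^ (n - 1)"
    proof -
      have "(2 * e i) ^ n = 2 ^ n * e i * e i ^ (n - 1)"
        using n0 by (simp add: power_mult_distrib power_eq_if[of "e i" n])
      then show ?thesis using epos[of i] by simp
    qed
    finally show "real (card (J i)) * (2 * e i) ^ n \<le> 11200 * \<tau>\<^sup>2 * 2 ^ n * e i ^ (n - 1)" .
  qed auto
  finally show ?thesis unfolding R_def n_def .
qed

text \<open>The covering estimate needs radii strictly larger than the diameters, which may be zero. They are
  enlarged so little that the total loss is half of the volume to be covered, and the other half gives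
  the bound.\<close>

lemma cap_hausdorff_lower_bound:
  obtains c where "c > 0"
    "\<And>z d. z \<in> bD \<Longrightarrow> 0 < d \<Longrightarrow> d \<le> \<tau>\<^sup>2 \<Longrightarrow>
       ennreal (c * d ^ CARD('d)) \<le> hausdorff_outer (2 * CARD('d) - 1) (cap z d)"
proof -
  define n where "n = 2 * CARD('d)"
  define k where "k = n - 1"
  have k0: "k > 0" using zero_less_card_finite[where 'a='d] unfolding k_def n_def by linarith
  define Q where "Q = 11200 * \<tau>\<^sup>2 * 2 ^ n"
  have Q: "Q > 0" using tau by (simp add: Q_def)
  define g where "g = unit_ball_vol (real k) / 2 ^ k"
  have g: "g > 0" by (simp add: g_def)
  define c where "c = g * (\<tau> / 2) ^ n / (2 * Q)"
  have c: "c > 0" using tau Q g by (simp add: c_def)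
  show ?thesis
  proof (rule that[OF c])
    fix z d assume z: "z \<in> bD" and d: "0 < d" "d \<le> \<tau>\<^sup>2"
    define V where "V = (\<tau> * sqrt d / 2) ^ n"
    have V: "V > 0" using tau d by (simp add: V_def)
    have Vd: "V = (\<tau> / 2) ^ n * d ^ CARD('d)"
      using d by (simp add: V_def n_def power_mult power_mult_distrib power_divide)
    have "ennreal (c * d ^ CARD('d)) \<le> hausdorff_content k d (cap z d)"
      unfolding hausdorff_content_def
    proof (rule INF_greatest, clarify)
      fix U :: "nat \<Rightarrow> (complex ^ 'd) set"
      assume U: "cap z d \<subseteq> (\<Union>i. U i)" "\<forall>i. bounded (U i) \<and> diameter (U i) \<le> d"
      define \<eta> where "\<eta> = V / (2 * Q)"
      have eta: "\<eta> > 0" using V Q by (simp add: \<eta>_def)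
      have "\<exists>e. diameter (U i) < e \<and> e \<le> 2 * d \<and> e ^ k \<le> diameter (U i) ^ k + \<eta> * (1/2) ^ Suc i" for i
      proof -
        have "diameter (U i) < 2 * d" using U(2)[rule_format, of i] d by linarith
        moreover have "\<eta> * (1/2) ^ Suc i > 0" using eta by simp
        ultimately show ?thesis
          using exists_slightly_larger[of "diameter (U i)" "2 * d" "\<eta> * (1/2) ^ Suc i" k] by blast
      qed
      then obtain e where e: "\<And>i. diameter (U i) < e i" "\<And>i. e i \<le> 2 * d"
        "\<And>i. e i ^ k \<le> diameter (U i) ^ k + \<eta> * (1/2) ^ Suc i" by metis
      have dpos: "diameter (U i) \<ge> 0" for i using U(2) diameter_ge_0 by blast
      have "ennreal V \<le> (\<Sum>i. ennreal (Q * e i ^ k))"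
        using cap_cover_lower_bound[OF z d U(1) _ e(1,2)] U(2) unfolding V_def Q_def k_def n_def by simp
      also have "\<dots> \<le> (\<Sum>i. ennreal Q * ennreal (diameter (U i) ^ k) + ennreal (Q * \<eta> * (1/2) ^ Suc i))"
      proof (intro suminf_le)
        fix i
        have "Q * e i ^ k \<le> Q * (diameter (U i) ^ k + \<eta> * (1/2) ^ Suc i)"
          using Q by (intro mult_left_mono e) auto
        then have "ennreal (Q * e i ^ k) \<le> ennreal (Q * diameter (U i) ^ k + Q * \<eta> * (1/2) ^ Suc i)"
          by (intro ennreal_leI) (simp add: algebra_simps)
        also have "\<dots> = ennreal Q * ennreal (diameter (U i) ^ k) + ennreal (Q * \<eta> * (1/2) ^ Suc i)"
          using Q eta dpos[of i] by (subst ennreal_plus) (auto simp: ennreal_mult)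
        finally show "ennreal (Q * e i ^ k) \<le> \<dots>" .
      qed auto
      also have "\<dots> = ennreal Q * (\<Sum>i. ennreal (diameter (U i) ^ k)) + (\<Sum>i. ennreal (Q * \<eta> * (1/2) ^ Suc i))"
        by (subst suminf_add[symmetric]) (auto simp: ennreal_suminf_cmult)
      also have "(\<Sum>i. ennreal (Q * \<eta> * (1/2) ^ Suc i)) = ennreal (Q * \<eta>)"
        using Q eta sums_mult[OF power_half_series, of "Q * \<eta>"] by (intro suminf_ennreal_eq) auto
      also have "Q * \<eta> = V / 2" using Q by (simp add: \<eta>_def)
      finally have main: "ennreal V \<le> ennreal Q * (\<Sum>i. ennreal (diameter (U i) ^ k)) + ennreal (V / 2)" .
      have sumg: "(\<Sum>i. hausdorff_gauge k (U i)) = ennreal g * (\<Sum>i. ennreal (diameter (U i) ^ k))"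
        unfolding ennreal_suminf_cmult[symmetric] g_def using U(2) k0
        by (intro suminf_cong hausdorff_gauge_eq) auto
      show "ennreal (c * d ^ CARD('d)) \<le> (\<Sum>i. hausdorff_gauge k (U i))"
      proof (cases "(\<Sum>i. ennreal (diameter (U i) ^ k))")
        case (real s)
        have "ennreal V \<le> ennreal (Q * s + V / 2)"
          using main real Q V by (simp add: ennreal_mult)
        then have "V / 2 \<le> Q * s" using real Q V by (subst (asm) ennreal_le_iff) auto
        then have "g * (V / (2 * Q)) \<le> g * s"
          using Q g by (intro mult_left_mono) (auto simp: field_simps)
        moreover have "g * (V / (2 * Q)) = c * d ^ CARD('d)" by (simp add: c_def Vd)
        ultimately have "ennreal (c * d ^ CARD('d)) \<le> ennreal (g * s)" by (intro ennreal_leI) simp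
        also have "\<dots> = ennreal g * ennreal s" using real g by (intro ennreal_mult) auto
        finally show ?thesis unfolding sumg real .
      next
        case top
        then show ?thesis unfolding sumg using g by (simp add: ennreal_mult_top)
      qed
    qed
    also have "\<dots> \<le> hausdorff_outer k (cap z d)"
      unfolding hausdorff_outer_def using d by (intro SUP_upper) auto
    finally show "ennreal (c * d ^ CARD('d)) \<le> hausdorff_outer (2 * CARD('d) - 1) (cap z d)"
      by (simp add: k_def n_def)
  qed
qed

text \<open>Quadratic separation confines a cap to a Euclidean ball of radius of order \<open>sqrt d\<close>, and on that ball the
  functionals at \<open>x\<close> and at \<open>z\<close> differ by \<open>O(d)\<close>.\<close>

lemma cap_localized:
  assumes z: "z \<in> bD" and x: "x \<in> cap z d"
  shows "(norm (x - z))\<^sup>2 \<le> d / \<kappa>" "cmod (ell z (x - z)) \<le> (1 + L / \<kappa>) * d"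
proof -
  have xF: "x \<in> bD" "cmod (ell x (x - z)) \<le> d" using x by (auto simp: cap_def)
  show *: "(norm (x - z))\<^sup>2 \<le> d / \<kappa>"
    using sep[OF xF(1) z] xF(2) pos by (simp add: pos_le_divide_eq mult.commute)
  have "cmod (ell z (x - z)) \<le> cmod (ell x (x - z)) + cmod (ell z (x - z) - ell x (x - z))"
    using norm_triangle_sub by blast
  also have "\<dots> \<le> d + L * norm (z - x) * norm (x - z)"
    using xF(2) lip[OF z xF(1), of "x - z"] by linarith
  also have "L * norm (z - x) * norm (x - z) = L * (norm (x - z))\<^sup>2"
    by (simp add: power2_eq_square norm_minus_commute)
  also have "d + L * (norm (x - z))\<^sup>2 \<le> d + L * (d / \<kappa>)"
    using * pos by (intro add_left_mono mult_left_mono) auto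
  finally show "cmod (ell z (x - z)) \<le> (1 + L / \<kappa>) * d" by (simp add: algebra_simps)
qed

text \<open>Two boundary points cannot differ by almost exactly \<open>t\<close> times the normal, since \<open>\<rho>\<close> would have to change by
  about \<open>t\<close>. Therefore small translates of the boundary along the normal stay apart.\<close>

lemma normal_translates_separated:
  assumes z: "z \<in> bD" and x: "x \<in> bD" "x' \<in> bD"
    and near: "L * norm (x - z) \<le> 1/2"
    and t: "4 * e \<le> t" "t \<le> 1/2" "8 * K * t < m" and e: "e > 0"
  shows "e \<le> norm (x' - x - t *\<^sub>R nu z)"
proof (rule ccontr)
  assume "\<not> e \<le> norm (x' - x - t *\<^sub>R nu z)"
  then have lt: "norm (x' - x - t *\<^sub>R nu z) < e" by simp
  let ?n = "nu z"
  define v where "v = x' - x"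
  define r where "r = x' - x - t *\<^sub>R ?n"
  have n1: "norm ?n = 1" "ell z ?n = 1" by (simp_all add: norm_nvec nform_nvec del_nonzero[OF z])
  have tp: "t > 0" using t e by linarith
  have vr: "v = t *\<^sub>R ?n + r" by (simp add: v_def r_def)
  have r: "norm r < e" using lt by (simp add: r_def)
  have nv: "norm v \<le> 2 * t"
    using norm_triangle_ineq[of "t *\<^sub>R ?n" r] r t e tp n1 unfolding vr by simp
  have "cmod (ell x ?n - 1) \<le> 1/2"
    using lip[OF x(1) z, of ?n] near n1 by simp
  then have "Re (ell x ?n) \<ge> 1/2"
    using abs_Re_le_cmod[of "ell x ?n - 1"] by simp
  then have "t * Re (ell x ?n) \<ge> t * (1/2)" using tp by (intro mult_left_mono) auto
  moreover have "Re (ell x r) \<ge> - e"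
    using abs_Re_le_cmod[of "ell x r"] norm_nform_le[of \<rho> x r] r by linarith
  moreover have "Re (ell x v) = t * Re (ell x ?n) + Re (ell x r)"
    unfolding vr by (simp add: nform_add nform_scaleR)
  ultimately have Rv: "Re (ell x v) \<ge> t / 4" using t by linarith
  have "norm v \<le> 1" using nv t by linarith
  moreover have "\<rho> (x + v) = 0" using frontier_zero[OF x(2)] by (simp add: v_def)
  ultimately have "2 * norm (del \<rho> x) * Re (ell x v) \<le> K * (norm v)\<^sup>2"
    using taylor[OF x(1), of v] by linarith
  also have "\<dots> \<le> K * (2 * t)\<^sup>2" using nv pos by (intro mult_left_mono power_mono) auto
  finally have 1: "2 * norm (del \<rho> x) * Re (ell x v) \<le> 4 * K * t\<^sup>2" by (simp add: power_mult_distrib)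
  have "2 * m * (t / 4) \<le> 2 * norm (del \<rho> x) * Re (ell x v)"
    using m_le[OF x(1)] Rv tp pos by (intro mult_mono) auto
  with 1 have "m * t \<le> 8 * K * t * t" by (simp add: power2_eq_square)
  moreover have "8 * K * t * t < m * t" using t tp by (intro mult_strict_right_mono) auto
  ultimately show False by linarith
qed

text \<open>The three bounds serve, in this order, the unit radius in the Taylor expansion, the turning of the
  functional on a cap by at most 1/2, and the translates of the previous lemma.\<close>

definition upper_radius :: real where
  "upper_radius = min (1/2) (min (\<kappa> / (4 * L\<^sup>2)) (m / (16 * K)))"

text \<open>Put translates of an \<open>e\<close>-separated set \<open>X\<close> of the cap next to each other: about \<open>d / (4 * e)\<close> translates by
  multiples of \<open>4 * e\<close> along the normal, and about \<open>1 / d\<close> translates by the points of a square lattice of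
  mesh \<open>h\<close>, of order \<open>d\<close>, in the complex line spanned by the normal. The former are separated because they
  leave the boundary, the latter because \<open>ell z\<close> tells them apart. Everything remains \<open>e\<close>-separated in a
  ball of radius of order \<open>sqrt d\<close>, and counting points in it bounds the size of \<open>X\<close>.\<close>

lemma cap_separated_card_bound:
  assumes z: "z \<in> bD" and d: "0 < d" "d \<le> upper_radius" and e: "0 < e" "e \<le> d"
    and X: "finite X" "X \<subseteq> cap z d" "\<And>x y. x \<in> X \<Longrightarrow> y \<in> X \<Longrightarrow> x \<noteq> y \<Longrightarrow> e \<le> dist x y"
  shows "real (card X) * e ^ (2 * CARD('d) - 1)
    \<le> 4 * 2 ^ (2 * CARD('d)) * (1 / sqrt \<kappa> + 2 + 2 * (2 * (1 + L / \<kappa>) + 3)) ^ (2 * CARD('d)) * d ^ CARD('d)"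
proof -
  let ?n = "nu z"
  have n1: "norm ?n = 1" "ell z ?n = 1" by (simp_all add: norm_nvec nform_nvec del_nonzero[OF z])
  define N where "N = 2 * CARD('d)"
  have DIMn: "DIM(complex ^ 'd) = N" by (simp add: N_def)
  have N0: "N > 0" by (simp add: N_def)
  define B where "B = 1 + L / \<kappa>"
  have B: "B > 0" using pos by (simp add: B_def add_pos_pos)
  \<comment> \<open>Two points of the cap have values of ell z within 2 * B * d, and normal shifts add at most d.\<close>
  define h where "h = (2 * B + 3) * d"
  have h: "h > 0" using B d by (simp add: h_def)
  have d1: "d \<le> 1/2" "d \<le> \<kappa> / (4 * L\<^sup>2)" "d \<le> m / (16 * K)" using d by (auto simp: upper_radius_def)
  have sd: "0 < sqrt d" "d \<le> sqrt d" "sqrt d * sqrt d = d"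
    using d d1 by (auto simp: real_le_rsqrt power2_eq_square mult_left_le)
  define P where "P = nat \<lceil>d / (4 * e)\<rceil>"
  define Q where "Q = nat \<lceil>1 / sqrt d\<rceil>"
  have P: "d / (4 * e) \<le> real P" "\<And>k. k < P \<Longrightarrow> 4 * e * real k \<le> d"
  proof -
    show "d / (4 * e) \<le> real P" unfolding P_def by linarith
    fix k assume "k < P"
    then have "real k \<le> d / (4 * e)" unfolding P_def by linarith
    then have "real k * (4 * e) \<le> d" using e by (simp add: pos_le_divide_eq)
    then show "4 * e * real k \<le> d" by (simp only: mult.commute)
  qed
  have Q: "1 / sqrt d \<le> real Q" "\<And>k. k < Q \<Longrightarrow> real k \<le> 1 / sqrt d"
    unfolding Q_def by linarith+
  define I where "I = X \<times> {..<P} \<times> {..<Q} \<times> {..<Q}"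
  define g :: "nat \<times> nat \<times> nat \<Rightarrow> complex" where
    "g i = of_real (4 * e * real (fst i)) + of_real h * Complex (real (fst (snd i))) (real (snd (snd i)))" for i
  define f where "f i = fst i + g (snd i) *s ?n" for i
  have xF: "x \<in> bD" if "x \<in> X" for x using X(2) that by (auto simp: cap_def)
  have xn: "norm (x - z) \<le> sqrt (d / \<kappa>)" "cmod (ell z (x - z)) \<le> B * d" if "x \<in> X" for x
    using cap_localized[OF z, of x d] X(2) that unfolding B_def by (auto intro: real_le_rsqrt)
  have near: "L * norm (x - z) \<le> 1/2" if "x \<in> X" for x
  proof -
    have "L * norm (x - z) \<le> L * sqrt (d / \<kappa>)" using xn(1)[OF that] pos by (intro mult_left_mono) auto
    also have "\<dots> = sqrt (L\<^sup>2 * (d / \<kappa>))"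
      using pos by (simp only: real_sqrt_mult[of "L\<^sup>2"] real_sqrt_abs abs_of_pos)
    also have "\<dots> \<le> sqrt (1/4)" using d1(2) pos by (intro real_sqrt_le_mono) (simp add: field_simps)
    also have "\<dots> = 1/2" by (simp add: real_sqrt_divide)
    finally show ?thesis .
  qed
  have sepn: "e \<le> norm (x' - x - (4 * e * (real k - real k')) *\<^sub>R ?n)"
    if x: "x \<in> X" "x' \<in> X" and k: "k' < k" "k < P" for x x' k k'
  proof (rule normal_translates_separated[OF z xF[OF x(1)] xF[OF x(2)] near[OF x(1)] _ _ _ e(1)])
    have "1 \<le> real k - real k'" using k(1) by linarith
    then have "4 * e * 1 \<le> 4 * e * (real k - real k')" using e by (intro mult_left_mono) auto
    then show "4 * e \<le> 4 * e * (real k - real k')" by simp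
    have "4 * e * (real k - real k') \<le> 4 * e * real k" using e by (intro mult_left_mono) auto
    then have le: "4 * e * (real k - real k') \<le> d" using P(2)[OF k(2)] by linarith
    then show "4 * e * (real k - real k') \<le> 1/2" using d1 by linarith
    have "8 * K * (4 * e * (real k - real k')) \<le> 8 * K * (m / (16 * K))"
      using le d1(3) pos by (intro mult_left_mono) auto
    also have "\<dots> < m" using pos by simp
    finally show "8 * K * (4 * e * (real k - real k')) < m" .
  qed
  have sep': "e \<le> dist (f i) (f j)" if ij: "i \<in> I" "j \<in> I" "i \<noteq> j" for i j
  proof -
    obtain x k a b where i: "i = (x, k, a, b)" by (cases i) auto
    obtain x' k' a' b' where j: "j = (x', k', a', b')" by (cases j) auto
    have xx: "x \<in> X" "x' \<in> X" "k < P" "k' < P" using ij unfolding i j I_def by auto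
    have fd: "f i - f j = (x - x') + (g (k, a, b) - g (k', a', b')) *s ?n"
      by (simp add: f_def i j vec_eq_iff algebra_simps)
    show ?thesis
    proof (cases "a = a' \<and> b = b'")
      case True
      then have gd: "g (k, a, b) - g (k', a', b') = of_real (4 * e * (real k - real k'))"
        by (simp add: g_def algebra_simps)
      have sc: "of_real r *s ?n = r *\<^sub>R ?n" for r
        by (simp add: vec_eq_iff scaleR_conv_of_real[where 'a=complex])
      have fd': "f i - f j = x - x' + (4 * e * (real k - real k')) *\<^sub>R ?n"
        unfolding fd gd sc ..
      consider "k < k'" | "k' < k" | "k = k'" by linarith
      then show ?thesis
      proof cases
        case 1
        have "f i - f j = x - x' - (4 * e * (real k' - real k)) *\<^sub>R ?n"
          unfolding fd' by (simp add: algebra_simps)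
        then show ?thesis using sepn[OF xx(2,1) 1 xx(4)] by (simp add: dist_norm)
      next
        case 2
        have "f i - f j = - (x' - x - (4 * e * (real k - real k')) *\<^sub>R ?n)"
          unfolding fd' by (simp add: algebra_simps)
        then show ?thesis using sepn[OF xx(1,2) 2 xx(3)] by (simp only: dist_norm norm_minus_cancel)
      next
        case 3
        then have "x \<noteq> x'" using ij(3) True by (simp add: i j)
        moreover have "f i - f j = x - x'" unfolding fd' using 3 by simp
        ultimately show ?thesis using X(3)[of x x'] xx by (simp add: dist_norm)
      qed
    next
      case False
      define c where "c = Complex (real a) (real b) - Complex (real a') (real b')"
      have c1: "cmod c \<ge> 1"
      proof -
        have "\<bar>real a - real a'\<bar> \<ge> 1 \<or> \<bar>real b - real b'\<bar> \<ge> 1" using False by linarith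
        then have "\<bar>Re c\<bar> \<ge> 1 \<or> \<bar>Im c\<bar> \<ge> 1" by (simp add: c_def)
        then show ?thesis using abs_Re_le_cmod[of c] abs_Im_le_cmod[of c] by linarith
      qed
      have gd: "g (k, a, b) - g (k', a', b') = of_real (4 * e * real k - 4 * e * real k') + of_real h * c"
        by (simp add: g_def c_def algebra_simps)
      have "ell z (f i - f j) = ell z (x - z) - ell z (x' - z) + (of_real (4 * e * real k - 4 * e * real k') + of_real h * c)"
        unfolding fd gd nform_add nform_scale n1 nform_diff by simp
      then have hc: "of_real h * c = ell z (f i - f j) - ell z (x - z) + ell z (x' - z) - of_real (4 * e * real k - 4 * e * real k')"
        by (simp add: algebra_simps)
      have "h * 1 \<le> h * cmod c" using c1 h by (intro mult_left_mono) auto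
      also have "\<dots> = cmod (of_real h * c)" using h by (simp add: norm_mult)
      also have "\<dots> \<le> cmod (ell z (f i - f j)) + cmod (ell z (x - z)) + cmod (ell z (x' - z)) + cmod (of_real (4 * e * real k - 4 * e * real k'))"
        unfolding hc by (intro order_trans[OF norm_triangle_ineq4] order_trans[OF norm_triangle_ineq] add_mono order_refl)
      also have "\<dots> \<le> norm (f i - f j) + B * d + B * d + d"
      proof (intro add_mono norm_nform_le xn(2) xx)
        have "4 * e * real k \<le> d" "4 * e * real k' \<le> d" "0 \<le> 4 * e * real k" "0 \<le> 4 * e * real k'"
          using P(2) xx e by auto
        then show "cmod (of_real (4 * e * real k - 4 * e * real k')) \<le> d" unfolding norm_of_real by linarith
      qed
      finally have "2 * d \<le> norm (f i - f j)" by (simp add: h_def algebra_simps)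
      then show ?thesis using e d by (simp add: dist_norm)
    qed
  qed
  define R where "R = (1 / sqrt \<kappa> + 1 + 2 * (2 * B + 3)) * sqrt d"
  have R0: "R \<ge> 0" using B pos sd by (auto simp: R_def)
  have sub: "f i \<in> cball z R" if "i \<in> I" for i
  proof -
    obtain x k a b where i: "i = (x, k, a, b)" by (cases i) auto
    have xx: "x \<in> X" "k < P" "a < Q" "b < Q" using that unfolding i I_def by auto
    have "norm (f i - z) = norm ((x - z) + g (k, a, b) *s ?n)" by (simp add: f_def i algebra_simps)
    also have "\<dots> \<le> norm (x - z) + cmod (g (k, a, b))"
      using norm_triangle_ineq[of "x - z" "g (k, a, b) *s ?n"] by (simp add: norm_vector_scale n1)
    also have "\<dots> \<le> sqrt (d / \<kappa>) + (d + h * (1 / sqrt d + 1 / sqrt d))"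
    proof (intro add_mono xn(1) xx)
      have "cmod (g (k, a, b)) \<le> cmod (of_real (4 * e * real k)) + cmod (of_real h * Complex (real a) (real b))"
        unfolding g_def fst_conv snd_conv by (rule norm_triangle_ineq)
      also have "\<dots> = 4 * e * real k + h * cmod (Complex (real a) (real b))"
        unfolding norm_mult norm_of_real using e h by simp
      also have "\<dots> \<le> d + h * (1 / sqrt d + 1 / sqrt d)"
      proof (intro add_mono P(2) mult_left_mono xx)
        have "cmod (Complex (real a) (real b)) \<le> real a + real b"
          using cmod_le[of "Complex (real a) (real b)"] by simp
        then show "cmod (Complex (real a) (real b)) \<le> 1 / sqrt d + 1 / sqrt d"
          using Q(2)[OF xx(3)] Q(2)[OF xx(4)] by linarith
      qed (use h in simp)
      finally show "cmod (g (k, a, b)) \<le> d + h * (1 / sqrt d + 1 / sqrt d)" .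
    qed
    also have "h * (1 / sqrt d + 1 / sqrt d) = 2 * (2 * B + 3) * (d / sqrt d)" by (simp add: h_def)
    also have "d / sqrt d = sqrt d" using d by (simp add: real_div_sqrt)
    also have "sqrt (d / \<kappa>) + (d + 2 * (2 * B + 3) * sqrt d) \<le> R"
      unfolding R_def real_sqrt_divide using sd(2) by (simp add: algebra_simps)
    finally show ?thesis by (simp add: dist_norm norm_minus_commute)
  qed
  have "finite I" using X(1) by (simp add: I_def)
  then have "real (card I) * (e/2) ^ N \<le> (R + e/2) ^ N"
    using packing_card_le[of I f z R e, unfolded DIMn] sub sep' e(1) R0 by blast
  also have "\<dots> \<le> ((1 / sqrt \<kappa> + 2 + 2 * (2 * B + 3)) * sqrt d) ^ N"
  proof (intro power_mono)
    show "R + e/2 \<le> (1 / sqrt \<kappa> + 2 + 2 * (2 * B + 3)) * sqrt d"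
      using e sd(2) by (simp add: R_def algebra_simps)
  qed (use R0 e in auto)
  also have "\<dots> = (1 / sqrt \<kappa> + 2 + 2 * (2 * B + 3)) ^ N * d ^ CARD('d)"
    using d by (simp add: power_mult_distrib N_def power_mult)
  finally have main: "real (card I) * (e/2) ^ N \<le> (1 / sqrt \<kappa> + 2 + 2 * (2 * B + 3)) ^ N * d ^ CARD('d)" .
  have "1 / (4 * e) = d / (4 * e) * (1 / sqrt d * (1 / sqrt d))"
    using sd(3) d by simp
  also have "\<dots> \<le> real P * (real Q * real Q)"
    using P(1) Q(1) d e by (intro mult_mono) auto
  finally have PQ: "1 / (4 * e) \<le> real P * (real Q * real Q)" .
  have "real (card X) * (1 / (4 * e)) \<le> real (card X) * (real P * (real Q * real Q))"
    using PQ by (intro mult_left_mono) auto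
  also have "\<dots> = real (card I)" by (simp add: I_def card_cartesian_product)
  finally have "real (card X) * (1 / (4 * e)) * (e/2) ^ N \<le> real (card I) * (e/2) ^ N"
    using e by (intro mult_right_mono) auto
  also note main
  also have "(e/2) ^ N = e * e ^ (N - 1) / 2 ^ N"
    using N0 by (simp add: power_divide power_eq_if[of e N])
  finally have "real (card X) * (1 / (4 * e)) * (e * e ^ (N - 1) / 2 ^ N) \<le> (1 / sqrt \<kappa> + 2 + 2 * (2 * B + 3)) ^ N * d ^ CARD('d)" .
  then have "real (card X) * e ^ (N - 1) / (4 * 2 ^ N) \<le> (1 / sqrt \<kappa> + 2 + 2 * (2 * B + 3)) ^ N * d ^ CARD('d)"
    using e by simp
  then have "real (card X) * e ^ (N - 1) \<le> (4 * 2 ^ N) * ((1 / sqrt \<kappa> + 2 + 2 * (2 * B + 3)) ^ N * d ^ CARD('d))"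
    by (subst (asm) pos_divide_le_eq) (simp_all add: mult.commute)
  then show ?thesis unfolding N_def B_def by (simp only: mult.assoc)
qed

text \<open>Balls of radius \<open>e\<close> around a maximal \<open>e\<close>-separated subset cover the cap, for arbitrarily small \<open>e\<close>.\<close>

lemma cap_hausdorff_upper_bound:
  obtains C where "C > 0"
    "\<And>z d. z \<in> bD \<Longrightarrow> 0 < d \<Longrightarrow> d \<le> upper_radius \<Longrightarrow>
       hausdorff_outer (2 * CARD('d) - 1) (cap z d) \<le> ennreal (C * d ^ CARD('d))"
proof -
  define k where "k = 2 * CARD('d) - 1"
  have k0: "k > 0" using zero_less_card_finite[where 'a='d] unfolding k_def by linarith
  define B where "B = 4 * 2 ^ (2 * CARD('d)) * (1 / sqrt \<kappa> + 2 + 2 * (2 * (1 + L / \<kappa>) + 3)) ^ (2 * CARD('d))"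
  have B: "B > 0" unfolding B_def using pos by (intro mult_pos_pos zero_less_power add_pos_pos) auto
  define v where "v = unit_ball_vol (real k)"
  have v: "v > 0" by (simp add: v_def)
  show ?thesis
  proof (rule that[of "v * B"])
    show "v * B > 0" using v B by simp
    fix z d assume z: "z \<in> bD" and d: "0 < d" "d \<le> upper_radius"
    have "hausdorff_content k r (cap z d) \<le> ennreal (v * B * d ^ CARD('d))" if r: "r > 0" for r
    proof -
      define e where "e = min (r/2) d"
      have e: "0 < e" "e \<le> d" "2 * e \<le> r" using r d by (auto simp: e_def)
      obtain X where X: "finite X" "X \<subseteq> cap z d" "\<And>x y. x \<in> X \<Longrightarrow> y \<in> X \<Longrightarrow> x \<noteq> y \<Longrightarrow> e \<le> dist x y"
        "cap z d \<subseteq> (\<Union>x\<in>X. cball x e)"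
        by (rule bounded_maximal_separated_net[OF compact_imp_bounded[OF compact_cap[of z d]] e(1)]) metis
      obtain xs where xs: "set xs = X" "distinct xs" using finite_distinct_list[OF X(1)] by blast
      define U where "U i = (if i < length xs then cball (xs ! i) e else {})" for i
      have diam: "diameter (cball x e) = 2 * e" for x :: "complex ^ 'd"
        using e by (simp add: diameter_cball)
      have "cap z d \<subseteq> (\<Union>i. U i)"
      proof
        fix w assume "w \<in> cap z d"
        then obtain x where x: "x \<in> set xs" "w \<in> cball x e" using X(4) xs by blast
        then obtain i where "i < length xs" "x = xs ! i" by (metis in_set_conv_nth)
        then show "w \<in> (\<Union>i. U i)" using x(2) by (auto simp: U_def)
      qed
      moreover have "\<forall>i. bounded (U i) \<and> diameter (U i) \<le> r" using e diam by (auto simp: U_def)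
      ultimately have "hausdorff_content k r (cap z d) \<le> (\<Sum>i. hausdorff_gauge k (U i))"
        unfolding hausdorff_content_def by (intro INF_lower) auto
      also have "\<dots> = of_nat (card X) * ennreal (v * e ^ k)"
      proof -
        have "card X = length xs" using xs distinct_card by metis
        then show ?thesis
          using e by (intro suminf_constant_prefix) (auto simp: U_def hausdorff_gauge_def diam v_def)
      qed
      also have "\<dots> = ennreal (real (card X) * (v * e ^ k))"
        using v e by (simp add: ennreal_of_nat_eq_real_of_nat ennreal_mult)
      also have "\<dots> \<le> ennreal (v * B * d ^ CARD('d))"
      proof (rule ennreal_leI)
        have "v * (real (card X) * e ^ k) \<le> v * (B * d ^ CARD('d))"
          unfolding B_def k_def using v
          by (intro mult_left_mono cap_separated_card_bound[OF z d e(1,2) X(1,2,3)]) auto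
        then show "real (card X) * (v * e ^ k) \<le> v * B * d ^ CARD('d)" by (simp add: mult_ac)
      qed
      finally show ?thesis .
    qed
    then show "hausdorff_outer (2 * CARD('d) - 1) (cap z d) \<le> ennreal (v * B * d ^ CARD('d))"
      unfolding hausdorff_outer_def k_def[symmetric] by (intro SUP_least) auto
  qed
qed

lemma upper_radius_pos: "upper_radius > 0"
  using pos by (auto simp: upper_radius_def)

text \<open>Start in the real tangent direction \<open>\<i> *s nu p\<close> and correct along the normal. The correction is real under
  \<open>ell p\<close>, so it leaves the imaginary part unchanged.\<close>

lemma frontier_tangential_point:
  assumes p: "p \<in> bD" and t: "0 < t" "t \<le> \<tau>\<^sup>2"
  obtains x where "x \<in> bD" "norm (x - p) \<le> 2 * t" "Im (ell p (x - p)) = t"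
proof -
  let ?n = "nu p"
  have n1: "norm ?n = 1" "ell p ?n = 1" by (simp_all add: norm_nvec nform_nvec del_nonzero[OF p])
  define d where "d = t\<^sup>2 / \<tau>\<^sup>2"
  have sd: "\<tau> * sqrt d = t" using t tau by (simp add: d_def real_sqrt_divide)
  have "t * t \<le> \<tau>\<^sup>2 * \<tau>\<^sup>2" using t by (intro mult_mono) auto
  then have d: "0 < d" "d \<le> \<tau>\<^sup>2"
    using t tau by (auto simp: d_def pos_divide_le_eq power2_eq_square)
  have "t * t \<le> t * \<tau>\<^sup>2" using t by (intro mult_left_mono) auto
  then have dt: "d \<le> t" using tau by (simp add: d_def pos_divide_le_eq power2_eq_square)
  have f: "ell p (Complex 0 t *s ?n) = Complex 0 t" by (simp add: nform_scale n1)
  have g: "norm (Complex 0 t *s ?n) = t" using t by (simp add: norm_vector_scale n1 cmod_def)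
  obtain s where s: "\<bar>s\<bar> \<le> d / 4" "p + Complex 0 t *s ?n + s *\<^sub>R ?n \<in> bD"
    using normal_line_meets_frontier[OF p d, of "Complex 0 t *s ?n"] f g sd d by auto
  show ?thesis
  proof (rule that[OF s(2)])
    have "norm (Complex 0 t *s ?n + s *\<^sub>R ?n) \<le> t + \<bar>s\<bar>"
      using norm_triangle_ineq[of "Complex 0 t *s ?n" "s *\<^sub>R ?n"] g n1 by simp
    then show "norm (p + Complex 0 t *s ?n + s *\<^sub>R ?n - p) \<le> 2 * t" using s(1) dt d by (simp add: add.assoc)
    have "p + Complex 0 t *s ?n + s *\<^sub>R ?n - p = Complex 0 t *s ?n + s *\<^sub>R ?n" by simp
    then show "Im (ell p (p + Complex 0 t *s ?n + s *\<^sub>R ?n - p)) = t"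
      by (simp only: nform_add f nform_scaleR n1) simp
  qed
qed

text \<open>The imaginary parts of \<open>ell p\<close> at the chosen points are distinct multiples of \<open>s\<close>, and \<open>ell p\<close> does not increase norms.\<close>

lemma frontier_many_separated_points:
  assumes p: "p \<in> bD" and s: "s > 0" and k: "real k * s \<le> \<tau>\<^sup>2"
  obtains x where "\<And>i. i < k \<Longrightarrow> x i \<in> bD" "\<And>i. i < k \<Longrightarrow> norm (x i - p) \<le> 2 * real k * s"
    "\<And>i j. i < k \<Longrightarrow> j < k \<Longrightarrow> i \<noteq> j \<Longrightarrow> s \<le> norm (x i - x j)"
proof -
  have "\<exists>x. x \<in> bD \<and> norm (x - p) \<le> 2 * real k * s \<and> Im (ell p (x - p)) = real (Suc i) * s" if "i < k" for i
  proof -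
    have le: "real (Suc i) * s \<le> real k * s" using that s by (intro mult_right_mono) auto
    then obtain x where x: "x \<in> bD" "norm (x - p) \<le> 2 * (real (Suc i) * s)" "Im (ell p (x - p)) = real (Suc i) * s"
      using frontier_tangential_point[OF p, of "real (Suc i) * s"] s k by (metis mult_pos_pos of_nat_0_less_iff order_trans zero_less_Suc)
    then show ?thesis using le by (intro exI[of _ x]) auto
  qed
  then obtain x where x: "\<And>i. i < k \<Longrightarrow> x i \<in> bD" "\<And>i. i < k \<Longrightarrow> norm (x i - p) \<le> 2 * real k * s"
    "\<And>i. i < k \<Longrightarrow> Im (ell p (x i - p)) = real (Suc i) * s" by metis
  have "s \<le> norm (x i - x j)" if ij: "i < k" "j < k" "i \<noteq> j" for i j
  proof -
    have "Im (ell p (x i - x j)) = Im (ell p (x i - p)) - Im (ell p (x j - p))"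
      by (simp add: nform_diff)
    also have "\<dots> = (real i - real j) * s" using x(3) ij by (simp add: algebra_simps)
    finally have "\<bar>Im (ell p (x i - x j))\<bar> = \<bar>real i - real j\<bar> * s" using s by (simp add: abs_mult)
    moreover have "\<bar>real i - real j\<bar> \<ge> 1" using ij(3) by linarith
    then have "1 * s \<le> \<bar>real i - real j\<bar> * s" using s by (intro mult_right_mono) auto
    ultimately show ?thesis
      using abs_Im_le_cmod[of "ell p (x i - x j)"] norm_nform_le[of \<rho> p "x i - x j"] by linarith
  qed
  then show ?thesis using that x by blast
qed

end

section \<open>Induced polyhedra\<close>

lemma countable_compact_connected_basis:
  obtains B :: "'a::euclidean_space set set" where "countable B" "\<And>b. b \<in> B \<Longrightarrow> compact b \<and> connected b"
    "\<And>U x. open U \<Longrightarrow> x \<in> U \<Longrightarrow> \<exists>b\<in>B. x \<in> interior b \<and> b \<subseteq> U"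
proof -
  obtain Q :: "'a set" where Q: "countable Q" "\<And>X. open X \<Longrightarrow> X \<noteq> {} \<Longrightarrow> \<exists>q\<in>Q. q \<in> X"
    using countable_dense_setE by blast
  define B where "B = (\<lambda>(q, r). cball q r) ` (Q \<times> \<rat>)"
  show ?thesis
  proof (rule that[of B])
    show "countable B" unfolding B_def using Q(1) countable_rat by blast
    show "compact b \<and> connected b" if "b \<in> B" for b using that by (auto simp: B_def)
    fix U :: "'a set" and x assume U: "open U" "x \<in> U"
    obtain e where e: "e > 0" "ball x e \<subseteq> U" using openE[OF U] by blast
    obtain r where r: "r \<in> \<rat>" "0 < r" "r < e / 2" using Rats_dense_in_real[of 0 "e/2"] e by auto
    obtain q where q: "q \<in> Q" "q \<in> ball x r" using Q(2)[of "ball x r"] r by auto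
    have "x \<in> ball q r" using q by (simp add: dist_commute)
    then have 1: "x \<in> interior (cball q r)" by (simp add: interior_cball)
    have "cball q r \<subseteq> ball x e"
    proof
      fix y assume "y \<in> cball q r"
      then show "y \<in> ball x e" using q r dist_triangle[of x y q] by simp
    qed
    then show "\<exists>b\<in>B. x \<in> interior b \<and> b \<subseteq> U" using 1 e q r by (force simp: B_def)
  qed
qed

text \<open>An open component that leaves \<open>D\<close> contains a path from \<open>D\<close> to the complement, and finitely many basis sets
  inside the component that cover the path and meet it form a connected set. In this way the uncountable
  choice of a path is replaced by the countable choice of a finite family \<open>F\<close>.\<close>

lemma component_leaves_iff_probe:
  fixes U D :: "'a::euclidean_space set"
  assumes B: "\<And>b. b \<in> B \<Longrightarrow> compact b \<and> connected b"
    "\<And>U x. open U \<Longrightarrow> x \<in> U \<Longrightarrow> \<exists>b\<in>B. x \<in> interior b \<and> b \<subseteq> U"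
    and U: "open U"
  shows "(\<exists>C\<in>components U. C \<inter> D \<noteq> {} \<and> \<not> C \<subseteq> D) \<longleftrightarrow>
    (\<exists>F. finite F \<and> F \<subseteq> B \<and> connected (\<Union>F) \<and> \<Union>F \<inter> D \<noteq> {} \<and> \<not> \<Union>F \<subseteq> D \<and> \<Union>F \<subseteq> U)"
proof
  assume "\<exists>C\<in>components U. C \<inter> D \<noteq> {} \<and> \<not> C \<subseteq> D"
  then obtain C x y where C: "C \<in> components U" and x: "x \<in> C" "x \<in> D" and y: "y \<in> C" "y \<notin> D" by blast
  have opC: "open C" using open_components[OF U C] .
  have "path_connected C" using in_components_connected[OF C] opC connected_open_path_connected by blast
  then obtain g where g: "path g" "path_image g \<subseteq> C" "pathstart g = x" "pathfinish g = y"
    using x y unfolding path_connected_def by blast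
  have P: "compact (path_image g)" "connected (path_image g)" "x \<in> path_image g" "y \<in> path_image g"
    using g compact_path_image connected_path_image pathstart_in_path_image pathfinish_in_path_image by metis+
  have "path_image g \<subseteq> (\<Union>b\<in>{b \<in> B. b \<subseteq> C}. interior b)"
    using g(2) B(2)[OF opC] by blast
  then obtain F' where F': "F' \<subseteq> {b \<in> B. b \<subseteq> C}" "finite F'" "path_image g \<subseteq> (\<Union>b\<in>F'. interior b)"
    using compactE_image[OF P(1), of "{b \<in> B. b \<subseteq> C}" interior] by auto
  define F where "F = {b \<in> F'. b \<inter> path_image g \<noteq> {}}"
  have PF: "path_image g \<subseteq> \<Union>F"
    using F'(3) interior_subset unfolding F_def by fastforce
  have "connected (\<Union>((\<lambda>b. b \<union> path_image g) ` F))"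
  proof (rule connected_Union)
    show "\<Inter>((\<lambda>b. b \<union> path_image g) ` F) \<noteq> {}" using P(3) by blast
    fix s assume "s \<in> (\<lambda>b. b \<union> path_image g) ` F"
    then show "connected s" using B(1) P(2) F'(1) unfolding F_def by (auto intro!: connected_Un)
  qed
  moreover have "\<Union>((\<lambda>b. b \<union> path_image g) ` F) = \<Union>F"
    using PF by blast
  ultimately have "connected (\<Union>F)" by simp
  moreover have "finite F" "F \<subseteq> B" "\<Union>F \<subseteq> C" using F' by (auto simp: F_def)
  moreover have "x \<in> \<Union>F" "y \<in> \<Union>F" using PF P by auto
  moreover have "C \<subseteq> U" using C by (rule in_components_subset)
  ultimately show "\<exists>F. finite F \<and> F \<subseteq> B \<and> connected (\<Union>F) \<and> \<Union>F \<inter> D \<noteq> {} \<and> \<not> \<Union>F \<subseteq> D \<and> \<Union>F \<subseteq> U"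
    using x y by (intro exI[of _ F]) blast
next
  assume "\<exists>F. finite F \<and> F \<subseteq> B \<and> connected (\<Union>F) \<and> \<Union>F \<inter> D \<noteq> {} \<and> \<not> \<Union>F \<subseteq> D \<and> \<Union>F \<subseteq> U"
  then obtain V where V: "connected V" "V \<inter> D \<noteq> {}" "\<not> V \<subseteq> D" "V \<subseteq> U" by blast
  then have "U \<noteq> {}" by blast
  then obtain C where "C \<in> components U" "V \<subseteq> C" using exists_component_superset[OF V(4) _ V(1)] by blast
  then show "\<exists>C\<in>components U. C \<inter> D \<noteq> {} \<and> \<not> C \<subseteq> D" using V by blast
qed

context separated_hypersurface begin

text \<open>The set whose components make up the induced polyhedron.\<close>

definition far_region :: "(complex ^ 'd) set \<Rightarrow> (complex ^ 'd \<Rightarrow> real) \<Rightarrow> (complex ^ 'd) set" where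
  "far_region \<Phi> \<delta> = (\<Inter>w\<in>\<Phi>. {z. \<delta> w < cmod (ell w (w - z))})"

lemma polyhedron_subset_iff:
  "induced_polyhedron D \<rho> \<Phi> \<delta> \<subseteq> D \<longleftrightarrow> \<not> (\<exists>C\<in>components (far_region \<Phi> \<delta>). C \<inter> D \<noteq> {} \<and> \<not> C \<subseteq> D)"
  unfolding induced_polyhedron_def far_region_def norm_nform by blast

lemma open_far_region:
  assumes "finite \<Phi>" shows "open (far_region \<Phi> \<delta>)"
  unfolding far_region_def
proof (intro open_INT assms ballI open_Collect_less continuous_intros)
  fix w show "continuous_on UNIV (\<lambda>z. ell w (w - z))"
    by (cases "del \<rho> w = 0") (auto simp: nform_def intro!: continuous_intros)
qed

lemma polyhedron_inside_if_frontier_covered: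
  assumes "\<And>z. z \<in> bD \<Longrightarrow> \<exists>w\<in>\<Phi>. cmod (ell w (w - z)) \<le> \<delta> w"
  shows "induced_polyhedron D \<rho> \<Phi> \<delta> \<subseteq> D"
  unfolding polyhedron_subset_iff
proof
  assume "\<exists>C\<in>components (far_region \<Phi> \<delta>). C \<inter> D \<noteq> {} \<and> \<not> C \<subseteq> D"
  then obtain C where C: "C \<in> components (far_region \<Phi> \<delta>)" "C \<inter> D \<noteq> {}" "C - D \<noteq> {}" by blast
  then obtain z where z: "z \<in> C" "z \<in> bD"
    using connected_Int_frontier[OF in_components_connected[OF C(1)] C(2,3)] by blast
  then have "z \<in> far_region \<Phi> \<delta>" using in_components_subset[OF C(1)] by blast
  then show False using assms[OF z(2)] unfolding far_region_def by force
qed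

text \<open>The functionals do not increase norms, so hitting the half-size cap of a net point within \<open>c / 2\<close> of \<open>x\<close>
  blocks \<open>x\<close> itself.\<close>

lemma polyhedron_inside_if_net_hit:
  assumes \<Phi>: "\<Phi> \<subseteq> bD" and \<delta>: "\<And>w. w \<in> bD \<Longrightarrow> c \<le> \<delta> w"
    and Z: "bD \<subseteq> (\<Union>z\<in>Z. cball z (c/2))" and hit: "\<And>z. z \<in> Z \<Longrightarrow> \<Phi> \<inter> cap z (c/2) \<noteq> {}"
  shows "induced_polyhedron D \<rho> \<Phi> \<delta> \<subseteq> D"
proof (rule polyhedron_inside_if_frontier_covered)
  fix x assume "x \<in> bD"
  then obtain z where z: "z \<in> Z" "dist z x \<le> c/2" using Z by auto
  then obtain w where w: "w \<in> \<Phi>" "cmod (ell w (w - z)) \<le> c/2" using hit[OF z(1)] by (auto simp: cap_def)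
  have "ell w (w - x) = ell w (w - z) + ell w (z - x)" by (simp add: nform_diff)
  then have "cmod (ell w (w - x)) \<le> cmod (ell w (w - z)) + cmod (ell w (z - x))"
    using norm_triangle_ineq by metis
  also have "cmod (ell w (z - x)) \<le> c/2"
    using norm_nform_le[of \<rho> w "z - x"] z(2) by (simp add: dist_norm)
  finally have "cmod (ell w (w - x)) \<le> \<delta> w" using w \<delta>[of w] \<Phi> by fastforce
  then show "\<exists>w\<in>\<Phi>. cmod (ell w (w - x)) \<le> \<delta> w" using w by blast
qed

text \<open>The component of an unblocked boundary point is open, so it contains points of \<open>D\<close> besides that boundary
  point, which is not in \<open>D\<close>.\<close>

lemma polyhedron_not_inside_if_frontier_point_free:
  assumes fin: "finite \<Phi>" and z: "z \<in> bD"
    and far: "\<And>w. w \<in> \<Phi> \<Longrightarrow> \<delta> w < cmod (ell w (w - z))"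
  shows "\<not> induced_polyhedron D \<rho> \<Phi> \<delta> \<subseteq> D"
proof -
  have zU: "z \<in> far_region \<Phi> \<delta>" using far by (auto simp: far_region_def)
  define C where "C = connected_component_set (far_region \<Phi> \<delta>) z"
  have C: "C \<in> components (far_region \<Phi> \<delta>)" using zU by (auto simp: components_def C_def)
  have zC: "z \<in> C" using zU by (simp add: C_def)
  have "open C" using open_components[OF open_far_region[OF fin] C] .
  moreover have "z \<in> closure D" "z \<notin> D" using z D_open by (auto simp: frontier_def interior_open)
  ultimately have "C \<inter> D \<noteq> {}" "\<not> C \<subseteq> D" using zC open_Int_closure_eq_empty by blast+
  then show ?thesis unfolding polyhedron_subset_iff using C by blast
qed

text \<open>The points whose constraint cuts into \<open>V\<close> are the projection of a closed subset of the product of the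
  boundary with \<open>V\<close>.\<close>

lemma compact_blocking_set:
  assumes V: "compact V" and \<delta>: "continuous_on (bD) \<delta>"
  shows "compact {w \<in> bD. \<exists>z\<in>V. cmod (ell w (w - z)) \<le> \<delta> w}"
proof -
  let ?S = "bD \<times> V"
  have "continuous_on ?S (\<lambda>p. cmod (ell (fst p) (fst p - snd p)) - \<delta> (fst p))"
    by (intro continuous_intros continuous_on_nform continuous_on_compose2[OF \<delta>]) auto
  then have "closedin (top_of_set ?S) (?S \<inter> (\<lambda>p. cmod (ell (fst p) (fst p - snd p)) - \<delta> (fst p)) -` {..0})"
    by (intro continuous_closedin_preimage) auto
  then have "compact (?S \<inter> (\<lambda>p. cmod (ell (fst p) (fst p - snd p)) - \<delta> (fst p)) -` {..0})"
    using closedin_compact compact_Times[OF compact_frontier V] by blast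
  then have "compact (fst ` (?S \<inter> (\<lambda>p. cmod (ell (fst p) (fst p - snd p)) - \<delta> (fst p)) -` {..0}))"
    by (intro compact_continuous_image continuous_intros)
  moreover have "fst ` (?S \<inter> (\<lambda>p. cmod (ell (fst p) (fst p - snd p)) - \<delta> (fst p)) -` {..0})
      = {w \<in> bD. \<exists>z\<in>V. cmod (ell w (w - z)) \<le> \<delta> w}"
    by (force simp: image_iff)
  ultimately show ?thesis by simp
qed

text \<open>The polyhedron leaves \<open>D\<close> if and only if for some member \<open>F\<close> of a countable family no point of \<open>\<Phi> \<omega>\<close> lies in
  the compact set \<open>A F\<close> of points that block \<open>\<Union>F\<close>.\<close>

lemma measurable_polyhedron_inside:
  assumes fin: "\<And>\<omega>. \<omega> \<in> space M \<Longrightarrow> finite (\<Phi> \<omega>)" and sub: "\<And>\<omega>. \<omega> \<in> space M \<Longrightarrow> \<Phi> \<omega> \<subseteq> bD"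
    and void: "\<And>A. A \<in> sets borel \<Longrightarrow> {\<omega> \<in> space M. \<Phi> \<omega> \<inter> A = {}} \<in> sets M"
    and \<delta>: "continuous_on (bD) \<delta>"
  shows "{\<omega> \<in> space M. induced_polyhedron D \<rho> (\<Phi> \<omega>) \<delta> \<subseteq> D} \<in> sets M"
proof -
  obtain B :: "(complex ^ 'd) set set" where B: "countable B" "\<And>b. b \<in> B \<Longrightarrow> compact b \<and> connected b"
    "\<And>U x. open U \<Longrightarrow> x \<in> U \<Longrightarrow> \<exists>b\<in>B. x \<in> interior b \<and> b \<subseteq> U"
    using countable_compact_connected_basis by blast
  define \<F> where "\<F> = {F. finite F \<and> F \<subseteq> B \<and> connected (\<Union>F) \<and> \<Union>F \<inter> D \<noteq> {} \<and> \<not> \<Union>F \<subseteq> D}"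
  have "countable {F. finite F \<and> F \<subseteq> B}" using B(1) countable_Collect_finite_subset by blast
  then have cF: "countable \<F>" by (rule countable_subset[rotated]) (auto simp: \<F>_def)
  define A where "A F = {w \<in> bD. \<exists>z\<in>\<Union>F. cmod (ell w (w - z)) \<le> \<delta> w}" for F
  have "A F \<in> sets borel" if "F \<in> \<F>" for F
  proof -
    have "compact (\<Union>F)" using that B(2) by (auto simp: \<F>_def intro!: compact_Union)
    then have "compact (A F)" unfolding A_def by (rule compact_blocking_set[OF _ \<delta>])
    then show ?thesis by (rule borel_compact)
  qed
  then have "(\<Union>F\<in>\<F>. {\<omega> \<in> space M. \<Phi> \<omega> \<inter> A F = {}}) \<in> sets M"
    using cF void by (intro sets.countable_UN') auto
  then have "space M - (\<Union>F\<in>\<F>. {\<omega> \<in> space M. \<Phi> \<omega> \<inter> A F = {}}) \<in> sets M" by blast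
  also have "space M - (\<Union>F\<in>\<F>. {\<omega> \<in> space M. \<Phi> \<omega> \<inter> A F = {}}) = {\<omega> \<in> space M. induced_polyhedron D \<rho> (\<Phi> \<omega>) \<delta> \<subseteq> D}"
  proof -
    have "(\<exists>F\<in>\<F>. \<Phi> \<omega> \<inter> A F = {}) \<longleftrightarrow> \<not> induced_polyhedron D \<rho> (\<Phi> \<omega>) \<delta> \<subseteq> D" if w: "\<omega> \<in> space M" for \<omega>
    proof -
      have "(\<Phi> \<omega> \<inter> A F = {}) \<longleftrightarrow> \<Union>F \<subseteq> far_region (\<Phi> \<omega>) \<delta>" for F
      proof -
        have "(\<Phi> \<omega> \<inter> A F = {}) \<longleftrightarrow> (\<forall>w\<in>\<Phi> \<omega>. \<forall>z\<in>\<Union>F. \<delta> w < cmod (ell w (w - z)))"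
          using sub[OF w] unfolding A_def by (simp only: not_le[symmetric]) blast
        also have "\<dots> \<longleftrightarrow> \<Union>F \<subseteq> far_region (\<Phi> \<omega>) \<delta>" unfolding far_region_def by blast
        finally show ?thesis .
      qed
      then have "(\<exists>F\<in>\<F>. \<Phi> \<omega> \<inter> A F = {}) \<longleftrightarrow> (\<exists>F\<in>\<F>. \<Union>F \<subseteq> far_region (\<Phi> \<omega>) \<delta>)" by simp
      also have "\<dots> \<longleftrightarrow> (\<exists>C\<in>components (far_region (\<Phi> \<omega>) \<delta>). C \<inter> D \<noteq> {} \<and> \<not> C \<subseteq> D)"
        by (subst component_leaves_iff_probe[OF B(2,3) open_far_region[OF fin[OF w]]])
           (simp_all add: \<F>_def Bex_def conj_assoc)
      finally show ?thesis by (simp only: polyhedron_subset_iff not_not)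
    qed
    then show ?thesis by blast
  qed
  finally show ?thesis .
qed

end

section \<open>Surface area and densities\<close>

lemma hausdorff_measure_space_sets:
  "space (hausdorff_measure k :: 'a::metric_space measure) = UNIV"
  "sets (hausdorff_measure k :: 'a measure) = sets borel"
  unfolding hausdorff_measure_def using sets.sigma_sets_eq[of "borel :: 'a measure"]
  by (simp_all add: space_measure_of_conv sets_measure_of_conv)

text \<open>\<^const>\<open>measure_of\<close> is the zero measure when the given set function is not countably additive. A density with
  integral 1 excludes this, and so the surface measure takes the values of the Hausdorff outer measure.\<close>

lemma emeasure_surface_measure:
  fixes S :: "'a::euclidean_space set"
  assumes dens: "(\<integral>\<^sup>+ z. ennreal (f z) \<partial>surface_measure S) = 1"
    and S: "S \<in> sets borel" and A: "A \<in> sets borel" "A \<subseteq> S"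
  shows "emeasure (surface_measure S) A = hausdorff_outer (DIM('a) - 1) A"
proof -
  let ?H = "hausdorff_measure (DIM('a) - 1) :: 'a measure"
  note sp = hausdorff_measure_space_sets(1) and st = hausdorff_measure_space_sets(2)
  have em: "emeasure ?H X = (if measure_space UNIV (sets (borel :: 'a measure)) (hausdorff_outer (DIM('a) - 1)) then hausdorff_outer (DIM('a) - 1) X else 0)"
    if "X \<in> sets borel" for X
    using that sets.sigma_sets_eq[of "borel :: 'a measure"]
    unfolding hausdorff_measure_def by (simp add: emeasure_measure_of_conv)
  have em_r: "emeasure (surface_measure S) X = emeasure ?H X" if "X \<subseteq> S" for X
    unfolding surface_measure_def using that S by (intro emeasure_restrict_space) (auto simp: sp st)
  have "measure_space UNIV (sets (borel :: 'a measure)) (hausdorff_outer (DIM('a) - 1))"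
  proof (rule ccontr)
    assume n: "\<not> ?thesis"
    have "emeasure (surface_measure S) (space (surface_measure S)) = 0"
      using em_r[of "space (surface_measure S)"] em[of S] n S
      by (simp add: surface_measure_def space_restrict_space sp)
    then have "AE z in surface_measure S. ennreal (f z) = 0"
      by (intro AE_I'[of "space (surface_measure S)"]) (auto simp: null_sets_def)
    then have "(\<integral>\<^sup>+ z. ennreal (f z) \<partial>surface_measure S) = (\<integral>\<^sup>+ z. 0 \<partial>surface_measure S)"
      by (rule nn_integral_cong_AE)
    then show False using dens by simp
  qed
  then show ?thesis using em_r[OF A(2)] em[OF A(1)] by simp
qed

lemma space_surface_measure: "space (surface_measure S) = S"
  and sets_surface_measure_iff: "S \<in> sets borel \<Longrightarrow> A \<subseteq> S \<Longrightarrow> A \<in> sets borel \<Longrightarrow> A \<in> sets (surface_measure S)"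
  by (auto simp: surface_measure_def space_restrict_space sets_restrict_space_iff hausdorff_measure_space_sets)

lemma distributed_prob_bounds:
  fixes X :: "'s \<Rightarrow> 'a::euclidean_space"
  assumes M: "prob_space M" and X: "distributed M (surface_measure S) X (\<lambda>z. ennreal (f z))"
    and dens: "(\<integral>\<^sup>+ z. ennreal (f z) \<partial>surface_measure S) = 1"
    and S: "S \<in> sets borel" and A: "A \<in> sets borel" "A \<subseteq> S"
    and f: "\<And>z. z \<in> S \<Longrightarrow> a \<le> f z \<and> f z \<le> b" and a: "a > 0"
  shows "ennreal a * hausdorff_outer (DIM('a) - 1) A \<le> ennreal (measure M (X -` A \<inter> space M))"
    and "ennreal (measure M (X -` A \<inter> space M)) \<le> ennreal b * hausdorff_outer (DIM('a) - 1) A"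
proof -
  interpret prob_space M by (rule M)
  let ?S = "surface_measure S"
  have As: "A \<in> sets ?S" by (rule sets_surface_measure_iff[OF S A(2,1)])
  have eq: "ennreal (measure M (X -` A \<inter> space M)) = (\<integral>\<^sup>+ z. ennreal (f z) * indicator A z \<partial>?S)"
    using distributed_emeasure[OF X As] by (simp add: emeasure_eq_measure)
  have H: "emeasure ?S A = hausdorff_outer (DIM('a) - 1) A"
    by (rule emeasure_surface_measure[OF dens S A])
  have "ennreal a * emeasure ?S A = (\<integral>\<^sup>+ z. ennreal a * indicator A z \<partial>?S)"
    using As by (simp add: nn_integral_cmult_indicator)
  also have "\<dots> \<le> (\<integral>\<^sup>+ z. ennreal (f z) * indicator A z \<partial>?S)"
    using f A(2) by (intro nn_integral_mono) (auto simp: space_surface_measure intro!: mult_right_mono ennreal_leI)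
  finally show "ennreal a * hausdorff_outer (DIM('a) - 1) A \<le> ennreal (measure M (X -` A \<inter> space M))"
    unfolding eq H .
  have "(\<integral>\<^sup>+ z. ennreal (f z) * indicator A z \<partial>?S) \<le> (\<integral>\<^sup>+ z. ennreal b * indicator A z \<partial>?S)"
    using f A(2) by (intro nn_integral_mono) (auto simp: space_surface_measure intro!: mult_right_mono ennreal_leI)
  also have "\<dots> = ennreal b * emeasure ?S A"
    using As by (simp add: nn_integral_cmult_indicator)
  finally show "ennreal (measure M (X -` A \<inter> space M)) \<le> ennreal b * hausdorff_outer (DIM('a) - 1) A"
    unfolding eq H .
qed

section \<open>Void probabilities of the two processes\<close>

definition void_event :: "'s measure \<Rightarrow> ('s \<Rightarrow> 'a set) \<Rightarrow> 'a set \<Rightarrow> 's set" where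
  "void_event M \<Phi> A = {\<omega> \<in> space M. \<Phi> \<omega> \<inter> A = {}}"

text \<open>What the binomial and the Poisson process have in common, with \<open>p A\<close> the probability that a single point
  falls into \<open>A\<close>: the probability of missing \<open>A\<close> lies between \<open>(1 - p A) ^ n\<close> and \<open>exp (- n * p A)\<close>, the former for the
  binomial and the latter for the Poisson process, and missing two disjoint sets is not positively correlated.\<close>

definition void_bounds :: "'s measure \<Rightarrow> 'a::topological_space set \<Rightarrow> ('a set \<Rightarrow> real) \<Rightarrow> nat \<Rightarrow> ('s \<Rightarrow> 'a set) \<Rightarrow> bool" where
  "void_bounds M S p n \<Phi> \<longleftrightarrow>
     (\<forall>\<omega>\<in>space M. finite (\<Phi> \<omega>) \<and> \<Phi> \<omega> \<subseteq> S) \<and>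
     (\<forall>A\<in>sets borel. void_event M \<Phi> A \<in> sets M \<and>
        (1 - p A) ^ n \<le> measure M (void_event M \<Phi> A) \<and> measure M (void_event M \<Phi> A) \<le> exp (- real n * p A)) \<and>
     (\<forall>A\<in>sets borel. \<forall>B\<in>sets borel. A \<inter> B = {} \<longrightarrow>
        measure M (void_event M \<Phi> (A \<union> B)) \<le> measure M (void_event M \<Phi> A) * measure M (void_event M \<Phi> B))"

locale iid_process = prob_space M for M :: "'s measure" +
  fixes S :: "'a::euclidean_space set" and N :: "'a measure" and f :: "'a \<Rightarrow> real" and W :: "nat \<Rightarrow> 's \<Rightarrow> 'a"
  assumes S: "S \<in> sets borel" and spN: "space N = S"
    and stN: "\<And>A. A \<in> sets borel \<Longrightarrow> A \<inter> S \<in> sets N"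
    and W: "iid_points M N f W"
begin

definition hit :: "'a set \<Rightarrow> real" where "hit A = prob (W 0 -` A \<inter> space M)"

lemma W_measurable: "W i \<in> measurable M N"
  using W unfolding iid_points_def distributed_def by auto

lemma W_in: "\<omega> \<in> space M \<Longrightarrow> W i \<omega> \<in> S"
  using measurable_space[OF W_measurable] spN by auto

lemma W_event: "A \<in> sets borel \<Longrightarrow> W i -` A \<inter> space M \<in> sets M"
proof -
  assume "A \<in> sets borel"
  from measurable_sets[OF W_measurable stN[OF this], of i]
  have "W i -` (A \<inter> S) \<inter> space M \<in> sets M" .
  also have "W i -` (A \<inter> S) \<inter> space M = W i -` A \<inter> space M" using W_in by auto
  finally show ?thesis .
qed

lemma W_hit: assumes A: "A \<in> sets borel" shows "prob (W i -` A \<inter> space M) = hit A"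
proof -
  have eq: "W i -` A \<inter> space M = W i -` (A \<inter> S) \<inter> space M" for i using W_in by auto
  have d: "emeasure M (W i -` (A \<inter> S) \<inter> space M) = (\<integral>\<^sup>+ z. ennreal (f z) * indicator (A \<inter> S) z \<partial>N)" for i
    using W unfolding iid_points_def by (intro distributed_emeasure stN A) auto
  show ?thesis unfolding hit_def eq measure_def d ..
qed

lemma hit_bounds: "0 \<le> hit A" "hit A \<le> 1"
  by (auto simp: hit_def)

lemma power_one_minus_hit_le: "(1 - hit A) ^ n \<le> exp (- real n * hit A)"
proof -
  have "1 - hit A \<le> exp (- hit A)" using exp_ge_add_one_self[of "- hit A"] by simp
  then have "(1 - hit A) ^ n \<le> exp (- hit A) ^ n" using hit_bounds by (intro power_mono) auto
  also have "\<dots> = exp (- real n * hit A)" by (simp add: exp_of_nat_mult[symmetric])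
  finally show ?thesis .
qed

lemma hit_Un:
  assumes "A \<in> sets borel" "B \<in> sets borel" "A \<inter> B = {}"
  shows "hit (A \<union> B) = hit A + hit B"
proof -
  have "W 0 -` (A \<union> B) \<inter> space M = (W 0 -` A \<inter> space M) \<union> (W 0 -` B \<inter> space M)" by auto
  then show ?thesis unfolding hit_def using assms
    by (simp only:) (rule finite_measure_Union, auto intro: W_event)
qed

lemma void_binomial_eq:
  "void_event M (binomial_process W n) A = (\<Inter>i\<in>{..<n}. W i -` (- A) \<inter> space M) \<inter> space M"
  unfolding void_event_def binomial_process_def by auto

lemma void_binomial_sets:
  assumes "A \<in> sets borel" shows "void_event M (binomial_process W n) A \<in> sets M"
proof -
  have "void_event M (binomial_process W n) A = {\<omega> \<in> space M. \<forall>i\<in>{..<n}. W i \<omega> \<in> - A}"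
    unfolding void_event_def binomial_process_def by auto
  moreover have "\<dots> \<in> sets M"
  proof (rule sets.sets_Collect_finite_All)
    fix i
    have "{\<omega> \<in> space M. W i \<omega> \<in> - A} = W i -` (- A) \<inter> space M" by auto
    then show "{\<omega> \<in> space M. W i \<omega> \<in> - A} \<in> sets M" using W_event[of "- A" i] assms by auto
  qed auto
  ultimately show ?thesis by simp
qed

lemma void_binomial_prob:
  assumes A: "A \<in> sets borel"
  shows "prob (void_event M (binomial_process W n) A) = (1 - hit A) ^ n"
proof (cases "n = 0")
  case True
  then show ?thesis by (simp add: void_binomial_eq prob_space)
next
  case False
  have ind: "indep_vars (\<lambda>_. N) W UNIV" using W by (simp add: iid_points_def)
  have c: "- A \<in> sets borel" using A by auto
  have "prob (\<Inter>i\<in>{..<n}. W i -` ((- A) \<inter> S) \<inter> space M) = (\<Prod>i\<in>{..<n}. prob (W i -` ((- A) \<inter> S) \<inter> space M))"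
    using False by (intro indep_varsD[OF ind] stN c) auto
  also have "(\<Inter>i\<in>{..<n}. W i -` ((- A) \<inter> S) \<inter> space M) = void_event M (binomial_process W n) A"
    unfolding void_binomial_eq using W_in False by auto
  also have "(\<Prod>i\<in>{..<n}. prob (W i -` ((- A) \<inter> S) \<inter> space M)) = (\<Prod>i\<in>{..<n}. 1 - hit A)"
  proof (rule prod.cong)
    fix i
    have "W i -` ((- A) \<inter> S) \<inter> space M = space M - (W i -` A \<inter> space M)" using W_in by auto
    then show "prob (W i -` ((- A) \<inter> S) \<inter> space M) = 1 - hit A"
      using prob_compl[OF W_event[OF A], of i] W_hit[OF A] by simp
  qed simp
  finally show ?thesis by simp
qed

lemma binomial_void_bounds: "void_bounds M S hit n (binomial_process W n)"
  unfolding void_bounds_def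
proof (intro conjI ballI impI)
  fix \<omega> assume "\<omega> \<in> space M"
  then show "finite (binomial_process W n \<omega>)" "binomial_process W n \<omega> \<subseteq> S"
    using W_in by (auto simp: binomial_process_def)
next
  fix A :: "'a set" assume A: "A \<in> sets borel"
  show "void_event M (binomial_process W n) A \<in> sets M" by (rule void_binomial_sets[OF A])
  show "(1 - hit A) ^ n \<le> prob (void_event M (binomial_process W n) A)" by (simp add: void_binomial_prob[OF A])
  show "prob (void_event M (binomial_process W n) A) \<le> exp (- real n * hit A)"
    unfolding void_binomial_prob[OF A] by (rule power_one_minus_hit_le)
next
  fix A B :: "'a set" assume A: "A \<in> sets borel" and B: "B \<in> sets borel" and AB: "A \<inter> B = {}"
  have AuB: "A \<union> B \<in> sets borel" using A B by auto
  have "0 \<le> 1 - hit (A \<union> B)" using hit_bounds by simp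
  moreover have "1 - hit (A \<union> B) \<le> (1 - hit A) * (1 - hit B)"
    unfolding hit_Un[OF A B AB] using hit_bounds[of A] hit_bounds[of B] by (simp add: algebra_simps)
  ultimately have "(1 - hit (A \<union> B)) ^ n \<le> ((1 - hit A) * (1 - hit B)) ^ n" by (intro power_mono) auto
  then show "prob (void_event M (binomial_process W n) (A \<union> B))
      \<le> prob (void_event M (binomial_process W n) A) * prob (void_event M (binomial_process W n) B)"
    by (simp add: void_binomial_prob A B AuB power_mult_distrib)
qed

text \<open>Conditioning on the number \<open>k\<close> of points gives the binomial void probability \<open>(1 - hit A) ^ k\<close>, and its mean
  over the Poisson distribution is an exponential series.\<close>

lemma void_poisson:
  assumes P: "poisson_count_indep M N W (real n) T" and n: "n \<ge> 1" and A: "A \<in> sets borel"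
  shows "void_event M (poisson_process W (\<lambda>_. T) n) A \<in> sets M"
    and "prob (void_event M (poisson_process W (\<lambda>_. T) n) A) = exp (- real n * hit A)"
proof -
  have T: "T \<in> measurable M (count_space UNIV)"
    and dT: "distr M (count_space UNIV) T = measure_pmf (poisson_pmf (real n))"
    and ind: "indep_set (sets (vimage_algebra (space M) T (count_space UNIV)))
       (sets (vimage_algebra (space M) (\<lambda>\<omega> i. W i \<omega>) (PiM UNIV (\<lambda>_. N))))"
    using P by (auto simp: poisson_count_indep_def)
  define E where "E k = {\<omega> \<in> space M. T \<omega> = k}" for k
  define V where "V k = void_event M (binomial_process W k) A" for k
  have Es: "E k \<in> sets M" for k
    using measurable_sets[OF T, of "{k}"] by (simp add: E_def vimage_def Int_def conj_commute)
  have Vs: "V k \<in> sets M" for k unfolding V_def by (rule void_binomial_sets[OF A])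
  have un: "void_event M (poisson_process W (\<lambda>_. T) n) A = (\<Union>k. E k \<inter> V k)"
    by (auto simp: void_event_def poisson_process_def binomial_process_def E_def V_def)
  show "void_event M (poisson_process W (\<lambda>_. T) n) A \<in> sets M"
    unfolding un using Es Vs by auto
  have pE: "prob (E k) = pmf (poisson_pmf (real n)) k" for k
  proof -
    have "prob (E k) = measure (distr M (count_space UNIV) T) {k}"
      using T by (subst measure_distr) (auto simp: E_def intro!: arg_cong[where f="measure M"])
    then show ?thesis unfolding dT by (simp add: measure_pmf_single)
  qed
  have pEV: "prob (E k \<inter> V k) = prob (E k) * prob (V k)" for k
  proof (rule indep_setD[OF ind])
    have "E k = T -` {k} \<inter> space M" by (auto simp: E_def)
    then show "E k \<in> sets (vimage_algebra (space M) T (count_space UNIV))"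
      by (auto intro!: in_vimage_algebra)
    \<comment> \<open>The event depends on the whole sequence only through its first k members.\<close>
    have "V k = (\<lambda>\<omega> i. W i \<omega>) -` ({x \<in> space (PiM UNIV (\<lambda>_. N)). \<forall>i\<in>{..<k}. x i \<in> (- A) \<inter> S}) \<inter> space M"
      unfolding V_def void_event_def binomial_process_def using W_in spN
      by (auto simp: space_PiM)
    moreover have "{x \<in> space (PiM UNIV (\<lambda>_. N)). \<forall>i\<in>{..<k}. x i \<in> (- A) \<inter> S} \<in> sets (PiM UNIV (\<lambda>_. N))"
    proof (rule sets.sets_Collect_finite_All)
      fix i
      have "(- A) \<inter> S \<in> sets N" using A by (intro stN) auto
      from measurable_sets[OF measurable_component_singleton[of i UNIV "\<lambda>_. N"] this]
      show "{x \<in> space (PiM UNIV (\<lambda>_. N)). x i \<in> (- A) \<inter> S} \<in> sets (PiM UNIV (\<lambda>_. N))"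
        by (simp add: vimage_def Int_def conj_commute)
    qed auto
    ultimately show "V k \<in> sets (vimage_algebra (space M) (\<lambda>\<omega> i. W i \<omega>) (PiM UNIV (\<lambda>_. N)))"
      by (simp only: in_vimage_algebra)
  qed
  have "(\<lambda>k. prob (E k \<inter> V k)) sums prob (\<Union>k. E k \<inter> V k)"
    using Es Vs by (intro finite_measure_UNION) (auto simp: disjoint_family_on_def E_def)
  moreover have "(\<lambda>k. prob (E k \<inter> V k)) sums exp (- real n * hit A)"
  proof -
    let ?l = "real n * (1 - hit A)"
    have "(\<lambda>k. ?l ^ k /\<^sub>R fact k) sums exp ?l" by (rule exp_converges)
    then have "(\<lambda>k. exp (- real n) * (?l ^ k /\<^sub>R fact k)) sums (exp (- real n) * exp ?l)" by (rule sums_mult)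
    also have "exp (- real n) * exp ?l = exp (- real n * hit A)"
      by (simp add: exp_add[symmetric] algebra_simps)
    also have "(\<lambda>k. exp (- real n) * (?l ^ k /\<^sub>R fact k)) = (\<lambda>k. prob (E k \<inter> V k))"
    proof
      fix k
      have "prob (E k \<inter> V k) = pmf (poisson_pmf (real n)) k * (1 - hit A) ^ k"
        using pEV[of k] pE[of k] void_binomial_prob[OF A, of k] by (simp add: V_def)
      then show "exp (- real n) * (?l ^ k /\<^sub>R fact k) = prob (E k \<inter> V k)"
        using n by (simp add: power_mult_distrib divide_inverse mult_ac)
    qed
    finally show ?thesis .
  qed
  ultimately show "prob (void_event M (poisson_process W (\<lambda>_. T) n) A) = exp (- real n * hit A)"
    unfolding un by (rule sums_unique2)
qed

lemma poisson_void_bounds: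
  assumes P: "poisson_count_indep M N W (real n) (T n)" and n: "n \<ge> 1"
  shows "void_bounds M S hit n (poisson_process W T n)"
proof -
  have eq: "poisson_process W T n = poisson_process W (\<lambda>_. T n) n" by (simp add: poisson_process_def fun_eq_iff)
  note v = void_poisson[OF P n]
  show ?thesis
    unfolding void_bounds_def eq
  proof (intro conjI ballI impI)
    fix \<omega> assume "\<omega> \<in> space M"
    then show "finite (poisson_process W (\<lambda>_. T n) n \<omega>)" "poisson_process W (\<lambda>_. T n) n \<omega> \<subseteq> S"
      using W_in by (auto simp: poisson_process_def)
  next
    fix A :: "'a set" assume A: "A \<in> sets borel"
    show "void_event M (poisson_process W (\<lambda>_. T n) n) A \<in> sets M" by (rule v(1)[OF A])
    show "prob (void_event M (poisson_process W (\<lambda>_. T n) n) A) \<le> exp (- real n * hit A)" by (simp add: v(2)[OF A])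
    show "(1 - hit A) ^ n \<le> prob (void_event M (poisson_process W (\<lambda>_. T n) n) A)"
      unfolding v(2)[OF A] by (rule power_one_minus_hit_le)
  next
    fix A B :: "'a set" assume A: "A \<in> sets borel" and B: "B \<in> sets borel" and AB: "A \<inter> B = {}"
    have AuB: "A \<union> B \<in> sets borel" using A B by auto
    show "prob (void_event M (poisson_process W (\<lambda>_. T n) n) (A \<union> B))
      \<le> prob (void_event M (poisson_process W (\<lambda>_. T n) n) A) * prob (void_event M (poisson_process W (\<lambda>_. T n) n) B)"
      unfolding v(2)[OF A] v(2)[OF B] v(2)[OF AuB] hit_Un[OF A B AB]
      by (simp add: exp_add[symmetric] algebra_simps)
  qed
qed

end

text \<open>Chebyshev's inequality for the number of events \<open>Z i\<close> that occur: since the events are pairwise not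
  positively correlated, its variance is at most its mean.\<close>

lemma (in prob_space) second_moment_none:
  assumes fin: "finite I" and Z: "\<And>i. i \<in> I \<Longrightarrow> Z i \<in> events"
    and neg: "\<And>i j. i \<in> I \<Longrightarrow> j \<in> I \<Longrightarrow> i \<noteq> j \<Longrightarrow> prob (Z i \<inter> Z j) \<le> prob (Z i) * prob (Z j)"
    and pos: "(\<Sum>i\<in>I. prob (Z i)) > 0"
  shows "prob {\<omega> \<in> space M. \<forall>i\<in>I. \<omega> \<notin> Z i} \<le> 1 / (\<Sum>i\<in>I. prob (Z i))"
proof -
  define X :: "'a \<Rightarrow> real" where "X \<omega> = (\<Sum>i\<in>I. indicator (Z i) \<omega>)" for \<omega>
  let ?m = "\<Sum>i\<in>I. prob (Z i)"
  have Xm[measurable]: "X \<in> borel_measurable M" unfolding X_def using Z by measurable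
  have iZ: "integrable M (indicator (Z i) :: 'a \<Rightarrow> real)" if "i \<in> I" for i using Z[OF that] by (simp add: integrable_indicator_iff emeasure_eq_measure)
  have iZ2: "integrable M (\<lambda>\<omega>. indicator (Z i) \<omega> * indicator (Z j) \<omega> :: real)" if "i \<in> I" "j \<in> I" for i j
    using Z that by (simp add: indicator_inter_arith[symmetric] integrable_indicator_iff emeasure_eq_measure sets.Int)
  have EX: "expectation X = ?m" unfolding X_def using iZ Z by (simp add: Bochner_Integration.integral_sum)
  have X2: "(\<lambda>\<omega>. (X \<omega>)\<^sup>2) = (\<lambda>\<omega>. \<Sum>i\<in>I. \<Sum>j\<in>I. indicator (Z i) \<omega> * indicator (Z j) \<omega>)"
    unfolding X_def power2_eq_square sum_product ..
  have iX2: "integrable M (\<lambda>\<omega>. (X \<omega>)\<^sup>2)" unfolding X2 using iZ2 by (intro Bochner_Integration.integrable_sum) auto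
  have iX: "integrable M X" unfolding X_def using iZ by (intro Bochner_Integration.integrable_sum) auto
  have "expectation (\<lambda>\<omega>. (X \<omega>)\<^sup>2) = (\<Sum>i\<in>I. \<Sum>j\<in>I. prob (Z i \<inter> Z j))"
  proof -
    have "expectation (\<lambda>\<omega>. (X \<omega>)\<^sup>2) = (\<Sum>i\<in>I. \<Sum>j\<in>I. expectation (\<lambda>\<omega>. indicator (Z i) \<omega> * indicator (Z j) \<omega>))"
      unfolding X2 using iZ2 by (simp add: Bochner_Integration.integral_sum Bochner_Integration.integrable_sum)
    also have "\<dots> = (\<Sum>i\<in>I. \<Sum>j\<in>I. prob (Z i \<inter> Z j))"
      using Z by (intro sum.cong refl) (simp add: indicator_inter_arith[symmetric] sets.Int)
    finally show ?thesis .
  qed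
  also have "\<dots> \<le> (\<Sum>i\<in>I. \<Sum>j\<in>I. (if i = j then prob (Z i) else 0) + prob (Z i) * prob (Z j))"
    by (intro sum_mono) (use neg in auto)
  also have "\<dots> = ?m + ?m\<^sup>2"
    using fin by (simp add: sum.distrib power2_eq_square sum_product)
  finally have "variance X \<le> ?m"
    using variance_eq[OF iX iX2] EX by simp
  have "prob {\<omega> \<in> space M. \<forall>i\<in>I. \<omega> \<notin> Z i} \<le> prob {\<omega> \<in> space M. \<bar>X \<omega> - expectation X\<bar> \<ge> ?m}"
  proof (rule finite_measure_mono)
    show "{\<omega> \<in> space M. \<forall>i\<in>I. \<omega> \<notin> Z i} \<subseteq> {\<omega> \<in> space M. \<bar>X \<omega> - expectation X\<bar> \<ge> ?m}"
    proof safe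
      fix \<omega> assume "\<forall>i\<in>I. \<omega> \<notin> Z i"
      then have "X \<omega> = 0" by (simp add: X_def)
      then show "?m \<le> \<bar>X \<omega> - expectation X\<bar>" by (simp add: EX)
    qed
  qed measurable
  also have "\<dots> \<le> variance X / ?m\<^sup>2"
    using pos by (intro Chebyshev_inequality iX2) auto
  also have "\<dots> \<le> ?m / ?m\<^sup>2" using \<open>variance X \<le> ?m\<close> by (intro divide_right_mono) auto
  also have "\<dots> = 1 / ?m" by (simp add: power2_eq_square)
  finally show ?thesis .
qed


section \<open>Thresholds\<close>

lemma delta_seq_power:
  assumes "n \<ge> 2" "d > 0"
  shows "delta_seq d n > 0" "delta_seq d n ^ d = ln (real n) / real n"
proof -
  have x: "ln (real n) / real n > 0" using assms by simp
  show "delta_seq d n > 0" using x assms by (simp add: delta_seq_def)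
  show "delta_seq d n ^ d = ln (real n) / real n"
  proof -
    have "ln (real n) > 0" "n > 0" using assms by simp_all
    then show ?thesis
      using x assms unfolding delta_seq_def
      by (subst powr_realpow[symmetric]) (simp_all add: powr_powr)
  qed
qed

lemma delta_seq_tendsto_0:
  assumes "d > 0" shows "delta_seq d \<longlonglongrightarrow> 0"
  unfolding delta_seq_def[abs_def]
proof (rule tendsto_zero_powrI)
  show "(\<lambda>n. ln (real n) / real n) \<longlonglongrightarrow> 0" by (rule lim_ln_over_n)
  show "(\<lambda>n. 1 / real d) \<longlonglongrightarrow> 1 / real d" by simp
  show "\<forall>\<^sub>F n in sequentially. 0 \<le> ln (real n) / real n"
    by (rule eventually_sequentiallyI[of 1]) auto
qed (use assms in simp)

text \<open>Along a curve in the boundary, \<open>n powr (1 / (4 * d))\<close> points with gaps of the order of the diameter of a cap fit into any fixed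
  neighbourhood. The product is \<open>(ln n / sqrt n) powr (1 / (2 * d))\<close>.\<close>

lemma many_small_steps_tendsto_0:
  assumes "d > 0"
  shows "(\<lambda>n. real n powr (1 / (4 * real d)) * sqrt (delta_seq d n)) \<longlonglongrightarrow> 0"
proof -
  have "(\<lambda>n. (sqrt (real n) * (ln (real n) / real n)) powr (1 / (2 * real d))) \<longlonglongrightarrow> 0"
  proof (rule tendsto_zero_powrI)
    have "sqrt (real n) * (ln (real n) / real n) = ln (real n) / real n powr (1/2)" for n
      by (cases "n = 0") (simp_all add: powr_half_sqrt real_div_sqrt field_simps)
    then show "(\<lambda>n. sqrt (real n) * (ln (real n) / real n)) \<longlonglongrightarrow> 0"
      using lim_ln_over_power[of "1/2"] by simp
    show "(\<lambda>n. 1 / (2 * real d)) \<longlonglongrightarrow> 1 / (2 * real d)" by simp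
    show "\<forall>\<^sub>F n in sequentially. 0 \<le> sqrt (real n) * (ln (real n) / real n)"
      by (rule eventually_sequentiallyI[of 1]) auto
  qed (use assms in simp)
  moreover have "\<forall>\<^sub>F n in sequentially. (sqrt (real n) * (ln (real n) / real n)) powr (1 / (2 * real d))
      = real n powr (1 / (4 * real d)) * sqrt (delta_seq d n)"
  proof (rule eventually_sequentiallyI[of 2])
    fix n :: nat assume n: "2 \<le> n"
    have "(sqrt (real n) * (ln (real n) / real n)) powr (1 / (2 * real d))
       = sqrt (real n) powr (1 / (2 * real d)) * (ln (real n) / real n) powr (1 / (2 * real d))"
      by (rule powr_mult)
    also have "sqrt (real n) powr (1 / (2 * real d)) = real n powr (1 / (4 * real d))"
      using n by (simp add: powr_half_sqrt[symmetric] powr_powr)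
    also have "(ln (real n) / real n) powr (1 / (2 * real d)) = sqrt (delta_seq d n)"
      using n by (simp add: delta_seq_def powr_half_sqrt[symmetric] powr_powr mult.commute)
    finally show "(sqrt (real n) * (ln (real n) / real n)) powr (1 / (2 * real d))
      = real n powr (1 / (4 * real d)) * sqrt (delta_seq d n)" .
  qed
  ultimately show ?thesis by (rule Lim_transform_eventually)
qed

lemma exp_le_one_minus:
  fixes x :: real assumes "0 \<le> x" "x \<le> 1/2" shows "exp (- 2 * x) \<le> 1 - x"
proof -
  have "1 \<le> (1 + 2 * x) * (1 - x)" using assms mult_left_mono[of x "1/2" x] by (simp add: algebra_simps)
  also have "\<dots> \<le> exp (2 * x) * (1 - x)" using assms exp_ge_add_one_self[of "2 * x"] by (intro mult_right_mono) auto
  finally have "exp (- 2 * x) * 1 \<le> exp (- 2 * x) * (exp (2 * x) * (1 - x))" by (intro mult_left_mono) auto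
  also have "\<dots> = 1 - x" by (simp add: mult.assoc[symmetric] exp_add[symmetric])
  finally show ?thesis by simp
qed

lemma void_boundsD:
  assumes "void_bounds M S p n \<Phi>"
  shows "\<And>\<omega>. \<omega> \<in> space M \<Longrightarrow> finite (\<Phi> \<omega>)" "\<And>\<omega>. \<omega> \<in> space M \<Longrightarrow> \<Phi> \<omega> \<subseteq> S"
    "\<And>A. A \<in> sets borel \<Longrightarrow> void_event M \<Phi> A \<in> sets M"
    "\<And>A. A \<in> sets borel \<Longrightarrow> (1 - p A) ^ n \<le> measure M (void_event M \<Phi> A)"
    "\<And>A. A \<in> sets borel \<Longrightarrow> measure M (void_event M \<Phi> A) \<le> exp (- real n * p A)"
    "\<And>A B. A \<in> sets borel \<Longrightarrow> B \<in> sets borel \<Longrightarrow> A \<inter> B = {} \<Longrightarrow>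
       measure M (void_event M \<Phi> (A \<union> B)) \<le> measure M (void_event M \<Phi> A) * measure M (void_event M \<Phi> B)"
  using assms unfolding void_bounds_def by auto

context separated_hypersurface begin

text \<open>The constants depend on the domain and on the bounds for the density, but not on the sizes \<open>g\<close>.\<close>

lemma cap_probability_bounds:
  assumes a: "a > 0" and b: "b > 0"
    and lo: "\<And>A. A \<in> sets borel \<Longrightarrow> A \<subseteq> bD \<Longrightarrow> ennreal a * hausdorff_outer (2 * CARD('d) - 1) A \<le> ennreal (p A)"
    and up: "\<And>A. A \<in> sets borel \<Longrightarrow> A \<subseteq> bD \<Longrightarrow> ennreal (p A) \<le> ennreal b * hausdorff_outer (2 * CARD('d) - 1) A"
    and p0: "\<And>A. p A \<ge> 0"
  obtains c C r where "c > 0" "C > 0" "r > 0"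
    "\<And>z d. z \<in> bD \<Longrightarrow> 0 < d \<Longrightarrow> d \<le> r \<Longrightarrow> c * d ^ CARD('d) \<le> p (cap z d)"
    "\<And>z d. z \<in> bD \<Longrightarrow> 0 < d \<Longrightarrow> d \<le> r \<Longrightarrow> p (cap z d) \<le> C * d ^ CARD('d)"
proof -
  obtain c where c: "c > 0" "\<And>z d. z \<in> bD \<Longrightarrow> 0 < d \<Longrightarrow> d \<le> \<tau>\<^sup>2 \<Longrightarrow>
       ennreal (c * d ^ CARD('d)) \<le> hausdorff_outer (2 * CARD('d) - 1) (cap z d)"
    using cap_hausdorff_lower_bound by metis
  obtain C where C: "C > 0" "\<And>z d. z \<in> bD \<Longrightarrow> 0 < d \<Longrightarrow> d \<le> upper_radius \<Longrightarrow>
       hausdorff_outer (2 * CARD('d) - 1) (cap z d) \<le> ennreal (C * d ^ CARD('d))"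
    using cap_hausdorff_upper_bound by metis
  have capb: "cap z d \<in> sets borel" "cap z d \<subseteq> bD" for z d
    using borel_compact[OF compact_cap] by (auto simp: cap_def)
  show ?thesis
  proof (rule that[of "a * c" "b * C" "min (\<tau>\<^sup>2) upper_radius"])
    show "a * c > 0" "b * C > 0" "min (\<tau>\<^sup>2) upper_radius > 0"
      using a b c C tau upper_radius_pos by auto
    fix z d assume z: "z \<in> bD" and d: "0 < d" "d \<le> min (\<tau>\<^sup>2) upper_radius"
    have "ennreal (a * c * d ^ CARD('d)) = ennreal a * ennreal (c * d ^ CARD('d))"
      using a c d by (simp add: ennreal_mult[symmetric] mult.assoc)
    also have "\<dots> \<le> ennreal a * hausdorff_outer (2 * CARD('d) - 1) (cap z d)"
      using d by (intro mult_left_mono c z) auto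
    also have "\<dots> \<le> ennreal (p (cap z d))" by (intro lo capb)
    finally show "a * c * d ^ CARD('d) \<le> p (cap z d)" using p0 by simp
    have "ennreal (p (cap z d)) \<le> ennreal b * hausdorff_outer (2 * CARD('d) - 1) (cap z d)" by (intro up capb)
    also have "\<dots> \<le> ennreal b * ennreal (C * d ^ CARD('d))"
      using d by (intro mult_left_mono C z) auto
    also have "\<dots> = ennreal (b * C * d ^ CARD('d))"
      using b C d by (simp add: ennreal_mult[symmetric] mult.assoc)
    finally show "p (cap z d) \<le> b * C * d ^ CARD('d)"
      using b C d by (subst (asm) ennreal_le_iff) auto
  qed
qed

lemma inside_event_measurable:
  assumes V: "void_bounds M (bD) p n \<Phi>" and g: "positive_continuous_on (bD) g"
  shows "{\<omega> \<in> space M. induced_polyhedron D \<rho> (\<Phi> \<omega>) (\<lambda>w. g w * s) \<subseteq> D} \<in> sets M"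
  using void_boundsD[OF V] g unfolding void_event_def positive_continuous_on_def
  by (intro measurable_polyhedron_inside continuous_intros) auto

text \<open>A net of mesh proportional to \<open>delta_seq\<close> has at most a constant times \<open>delta_seq powr (- 2 * d)\<close> points, that is
  \<open>O(n\<^sup>2)\<close>, and the cap of each of them is missed with probability at most \<open>n powr (- c * (G/2) ^ d)\<close>.\<close>

lemma void_cap_union_bound:
  assumes M: "prob_space M" and V: "void_bounds M (bD) p n \<Phi>"
    and c: "c > 0" and n: "n \<ge> 2" and G: "G > 0" and Gr: "G * delta_seq CARD('d) n / 2 \<le> r" "G * delta_seq CARD('d) n / 4 \<le> 1"
    and cp: "\<And>z d. z \<in> bD \<Longrightarrow> 0 < d \<Longrightarrow> d \<le> r \<Longrightarrow> c * d ^ CARD('d) \<le> p (cap z d)"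
    and R: "R \<ge> 0" "bD \<subseteq> cball 0 R" and ln1: "ln (real n) \<ge> 1"
    and g: "\<And>w. w \<in> bD \<Longrightarrow> G \<le> g w"
    and meas: "{\<omega> \<in> space M. induced_polyhedron D \<rho> (\<Phi> \<omega>) (\<lambda>w. g w * delta_seq CARD('d) n) \<subseteq> D} \<in> sets M"
  shows "1 - prob_inside M D \<rho> g n \<Phi> \<le> (4 * (R + 1) / G) ^ (2 * CARD('d)) * (real n powr (2 - c * (G/2) ^ CARD('d)))"
proof -
  interpret prob_space M by (rule M)
  let ?d = "delta_seq CARD('d) n"
  define e where "e = G * ?d / 2"
  have d: "?d > 0" "?d ^ CARD('d) = ln (real n) / real n"
    using delta_seq_power[OF n, of "CARD('d)"] zero_less_card_finite[where 'a='d] by auto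
  have e: "e > 0" using G d by (simp add: e_def)
  obtain Z where Z: "finite Z" "Z \<subseteq> bD" "\<And>x y. x \<in> Z \<Longrightarrow> y \<in> Z \<Longrightarrow> x \<noteq> y \<Longrightarrow> e \<le> dist x y"
    "bD \<subseteq> (\<Union>z\<in>Z. cball z e)"
    by (rule bounded_maximal_separated_net[OF compact_imp_bounded[OF compact_frontier] e]) metis
  define I where "I = {\<omega> \<in> space M. induced_polyhedron D \<rho> (\<Phi> \<omega>) (\<lambda>w. g w * ?d) \<subseteq> D}"
  have capb: "cap z d \<in> sets borel" for z d by (rule borel_compact[OF compact_cap])
  have "space M - I \<subseteq> (\<Union>z\<in>Z. void_event M \<Phi> (cap z e))"
  proof
    fix \<omega> assume w: "\<omega> \<in> space M - I"
    show "\<omega> \<in> (\<Union>z\<in>Z. void_event M \<Phi> (cap z e))"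
    proof (rule ccontr)
      assume n: "\<omega> \<notin> (\<Union>z\<in>Z. void_event M \<Phi> (cap z e))"
      have "induced_polyhedron D \<rho> (\<Phi> \<omega>) (\<lambda>w. g w * ?d) \<subseteq> D"
      proof (rule polyhedron_inside_if_net_hit[where c="G * ?d" and Z=Z])
        show "\<Phi> \<omega> \<subseteq> bD" using void_boundsD(2)[OF V] w by auto
        show "G * ?d \<le> g w * ?d" if "w \<in> bD" for w using g[OF that] d by simp
        show "bD \<subseteq> (\<Union>z\<in>Z. cball z (G * ?d / 2))" using Z(4) by (simp add: e_def)
        show "\<Phi> \<omega> \<inter> cap z (G * ?d / 2) \<noteq> {}" if "z \<in> Z" for z
          using n w that by (auto simp: void_event_def e_def)
      qed
      then show False using w by (auto simp: I_def)
    qed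
  qed
  then have "prob (space M - I) \<le> prob (\<Union>z\<in>Z. void_event M \<Phi> (cap z e))"
    using Z(1) void_boundsD(3)[OF V capb] by (intro finite_measure_mono) auto
  also have "\<dots> \<le> (\<Sum>z\<in>Z. prob (void_event M \<Phi> (cap z e)))"
    using Z(1) void_boundsD(3)[OF V capb] by (intro measure_UNION_le) auto
  also have "\<dots> \<le> (\<Sum>z\<in>Z. real n powr (- (c * (G/2) ^ CARD('d))))"
  proof (rule sum_mono)
    fix z assume z: "z \<in> Z"
    have ed: "e ^ CARD('d) = (G/2) ^ CARD('d) * (ln (real n) / real n)"
    proof -
      have "e = (G/2) * ?d" by (simp add: e_def)
      then show ?thesis by (simp only: power_mult_distrib d(2))
    qed
    have "c * e ^ CARD('d) \<le> p (cap z e)"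
      using z Z(2) e Gr(1) by (intro cp) (auto simp: e_def)
    then have "real n * (c * e ^ CARD('d)) \<le> real n * p (cap z e)" by (intro mult_left_mono) auto
    then have "exp (- real n * p (cap z e)) \<le> exp (- (real n * (c * e ^ CARD('d))))" by simp
    also have "real n * (c * e ^ CARD('d)) = c * (G/2) ^ CARD('d) * ln (real n)"
      unfolding ed using n by simp
    also have "exp (- (c * (G/2) ^ CARD('d) * ln (real n))) = real n powr (- (c * (G/2) ^ CARD('d)))"
      using n by (simp add: powr_def)
    finally show "prob (void_event M \<Phi> (cap z e)) \<le> real n powr (- (c * (G/2) ^ CARD('d)))"
      using void_boundsD(5)[OF V capb, of z e] by linarith
  qed
  also have "\<dots> = real (card Z) * real n powr (- (c * (G/2) ^ CARD('d)))" by simp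
  also have "\<dots> \<le> ((4 * (R + 1) / G) ^ (2 * CARD('d)) * real n powr 2) * real n powr (- (c * (G/2) ^ CARD('d)))"
  proof (rule mult_right_mono)
    have "real (card Z) * (e/2) ^ DIM(complex ^ 'd) \<le> (R + e/2) ^ DIM(complex ^ 'd)"
      by (rule packing_card_le[where f="\<lambda>x. x" and c=0]) (use Z R e in auto)
    moreover have "DIM(complex ^ 'd) = 2 * CARD('d)" by simp
    ultimately have "real (card Z) * (e/2) ^ (2 * CARD('d)) \<le> (R + e/2) ^ (2 * CARD('d))" by (simp only:)
    also have "\<dots> \<le> (R + 1) ^ (2 * CARD('d))" using R e Gr(2) by (intro power_mono) (auto simp: e_def)
    finally have "real (card Z) \<le> (R + 1) ^ (2 * CARD('d)) / (e/2) ^ (2 * CARD('d))"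
      using e by (simp add: pos_le_divide_eq del: power_divide)
    also have "\<dots> = (4 * (R + 1) / G / ?d) ^ (2 * CARD('d))"
      unfolding power_divide[symmetric] e_def using G d by (simp add: mult.commute)
    also have "\<dots> = (4 * (R + 1) / G) ^ (2 * CARD('d)) * (1 / (?d ^ CARD('d))\<^sup>2)"
      by (simp add: power_divide power_mult_distrib power_mult[symmetric] mult.commute)
    also have "\<dots> \<le> (4 * (R + 1) / G) ^ (2 * CARD('d)) * real n powr 2"
    proof (rule mult_left_mono)
      have "1 / (?d ^ CARD('d))\<^sup>2 = (real n / ln (real n))\<^sup>2" unfolding d(2) by (simp add: power_divide)
      also have "\<dots> \<le> (real n)\<^sup>2"
      proof (rule power_mono)
        have "real n * 1 \<le> real n * ln (real n)" using ln1 by (intro mult_left_mono) auto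
        then show "real n / ln (real n) \<le> real n" using ln1 by (simp add: pos_divide_le_eq)
      qed (use ln1 in auto)
      also have "\<dots> = real n powr 2" using n by (simp add: powr_numeral)
      finally show "1 / (?d ^ CARD('d))\<^sup>2 \<le> real n powr 2" .
    qed (use R G in auto)
    finally show "real (card Z) \<le> (4 * (R + 1) / G) ^ (2 * CARD('d)) * real n powr 2" .
  qed auto
  also have "\<dots> = (4 * (R + 1) / G) ^ (2 * CARD('d)) * (real n powr 2 * real n powr (- (c * (G/2) ^ CARD('d))))"
    by (rule mult.assoc)
  also have "real n powr 2 * real n powr (- (c * (G/2) ^ CARD('d))) = real n powr (2 - c * (G/2) ^ CARD('d))"
    by (simp only: powr_add[symmetric] diff_conv_add_uminus)
  finally have fin: "prob (space M - I) \<le> (4 * (R + 1) / G) ^ (2 * CARD('d)) * (real n powr (2 - c * (G/2) ^ CARD('d)))" .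
  have "prob (space M - I) = 1 - prob I"
    by (rule prob_compl) (use meas in \<open>simp add: I_def\<close>)
  with fin show ?thesis unfolding prob_inside_def I_def by linarith
qed

proposition large_constants_inside:
  assumes M: "prob_space M" and V: "\<And>n. n \<ge> 1 \<Longrightarrow> void_bounds M (bD) p n (\<Phi> n)"
    and c: "c > 0" "r > 0"
    and cp: "\<And>z d. z \<in> bD \<Longrightarrow> 0 < d \<Longrightarrow> d \<le> r \<Longrightarrow> c * d ^ CARD('d) \<le> p (cap z d)"
    and \<alpha>: "\<alpha> > 0"
  shows "\<exists>C>0. \<forall>g. positive_continuous_on (bD) g \<longrightarrow> (INF z\<in>bD. g z) > C \<longrightarrow>
        (\<lambda>n. 1 - prob_inside M D \<rho> g n (\<Phi> n)) \<in> O(\<lambda>n. real n powr (- \<alpha>))"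
proof -
  have d0: "CARD('d) > 0" by simp
  \<comment> \<open>Makes c * (G/2) ^ d at least 2 + \<alpha>, where 2 pays for the size of the net.\<close>
  define G where "G = 2 * max 1 ((2 + \<alpha>) / c)"
  have G: "G > 0" by (simp add: G_def)
  have "max 1 ((2 + \<alpha>) / c) ^ 1 \<le> max 1 ((2 + \<alpha>) / c) ^ CARD('d)" using d0 by (intro power_increasing) auto
  then have "(2 + \<alpha>) / c \<le> (G/2) ^ CARD('d)" by (simp add: G_def)
  then have Ga: "2 + \<alpha> \<le> c * (G/2) ^ CARD('d)" using c by (simp add: pos_divide_le_eq mult.commute)
  obtain R where "R > 0" "\<forall>x\<in>bD. norm x \<le> R"
    using compact_imp_bounded[OF compact_frontier] unfolding bounded_pos by blast
  then have R: "R \<ge> 0" "bD \<subseteq> cball 0 R" by auto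
  define B where "B = (4 * (R + 1) / G) ^ (2 * CARD('d))"
  have B: "B \<ge> 0" using R G by (simp add: B_def)
  show ?thesis
  proof (intro exI[of _ G] conjI G allI impI)
    fix g assume g: "positive_continuous_on (bD) g" and inf: "(INF z\<in>bD. g z) > G"
    have bb: "bdd_below (g ` bD)" using g unfolding positive_continuous_on_def by (intro bdd_belowI[of _ 0]) (auto intro: less_imp_le)
    have gG: "G \<le> g w" if "w \<in> bD" for w
      using cINF_lower[OF bb that] inf by linarith
    have lim: "(\<lambda>n. G * delta_seq CARD('d) n) \<longlonglongrightarrow> 0"
      using tendsto_mult_right_zero[OF delta_seq_tendsto_0[OF d0], of G] by simp
    have ln1: "\<forall>\<^sub>F n in sequentially. ln (real n) \<ge> 1"
      by (rule eventually_sequentiallyI[of 3]) (use exp_le in \<open>simp add: ln_ge_iff\<close>)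
    have "\<forall>\<^sub>F n in sequentially. G * delta_seq CARD('d) n < 2 * r" "\<forall>\<^sub>F n in sequentially. G * delta_seq CARD('d) n < 4"
      using c by (auto intro!: order_tendstoD(2)[OF lim])
    moreover note ln1
    moreover have "\<forall>\<^sub>F n in sequentially. n \<ge> (2::nat)" by (rule eventually_ge_at_top)
    ultimately have "\<forall>\<^sub>F n in sequentially. norm (1 - prob_inside M D \<rho> g n (\<Phi> n)) \<le> B * norm (real n powr (- \<alpha>))"
    proof eventually_elim
      case (elim n)
      interpret prob_space M by (rule M)
      have n1: "n \<ge> 1" using elim by simp
      have "1 - prob_inside M D \<rho> g n (\<Phi> n) \<le> B * real n powr (2 - c * (G/2) ^ CARD('d))"
        unfolding B_def
        by (rule void_cap_union_bound[OF M V[OF n1] c(1) _ G _ _ cp R _ gG inside_event_measurable[OF V[OF n1] g]])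
           (use elim in auto)
      also have "\<dots> \<le> B * real n powr (- \<alpha>)"
        using B Ga n1 by (intro mult_left_mono powr_mono) auto
      finally show ?case unfolding prob_inside_def by simp
    qed
    then show "(\<lambda>n. 1 - prob_inside M D \<rho> g n (\<Phi> n)) \<in> O(\<lambda>n. real n powr (- \<alpha>))" by (rule bigoI)
  qed
qed

lemma caps_disjoint:
  assumes "x \<in> bD" "y \<in> bD" "0 < d" "2 * sqrt (d / \<kappa>) < norm (x - y)"
  shows "cap x d \<inter> cap y d = {}"
proof (rule equals0I)
  fix w assume w: "w \<in> cap x d \<inter> cap y d"
  have "norm (w - x) \<le> sqrt (d / \<kappa>)" "norm (w - y) \<le> sqrt (d / \<kappa>)"
    using cap_localized(1)[OF assms(1), of w d] cap_localized(1)[OF assms(2), of w d] w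
    by (auto intro: real_le_rsqrt)
  then show False using assms(4) norm_triangle_ineq4[of "w - y" "w - x"] by simp
qed

text \<open>Take \<open>k\<close> boundary points near \<open>q\<close> whose caps of size \<open>c0 * delta_seq\<close> are disjoint. If one of these caps is
  missed, its centre is not blocked at all: a blocking point \<open>v\<close> would be close to the centre by
  quadratic separation, whatever the size \<open>g v \<le> Gm\<close>, hence close to \<open>q\<close>, where \<open>g \<le> c0\<close>, and so it would lie in the
  cap. The second moment method bounds the probability that all caps are hit.\<close>

lemma small_cap_missed:
  assumes M: "prob_space M" and V: "void_bounds M (bD) p n \<Phi>" and n: "n \<ge> 2"
    and C: "C > 0" "0 < c0" "c0 \<le> 1" and dr: "delta_seq CARD('d) n \<le> r"
    and cp: "\<And>z d. z \<in> bD \<Longrightarrow> 0 < d \<Longrightarrow> d \<le> r \<Longrightarrow> p (cap z d) \<le> C * d ^ CARD('d)"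
    and p0: "\<And>A. p A \<ge> 0" and half: "C * c0 ^ CARD('d) * (ln (real n) / real n) \<le> 1/2"
    and q: "q \<in> bD" and near: "\<And>w. w \<in> bD \<Longrightarrow> norm (w - q) < r1 \<Longrightarrow> g w \<le> c0"
    and Gm: "Gm > 0" "\<And>w. w \<in> bD \<Longrightarrow> g w \<le> Gm"
    and k: "k > 0" "real k * (3 * sqrt (delta_seq CARD('d) n / \<kappa>)) \<le> \<tau>\<^sup>2"
      "2 * real k * (3 * sqrt (delta_seq CARD('d) n / \<kappa>)) + sqrt (Gm * delta_seq CARD('d) n / \<kappa>) < r1"
  shows "prob_inside M D \<rho> g n \<Phi> \<le> 1 / (real k * real n powr (- 2 * (C * c0 ^ CARD('d))))"
proof -
  interpret prob_space M by (rule M)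
  let ?d = "delta_seq CARD('d) n"
  have d: "?d > 0" "?d ^ CARD('d) = ln (real n) / real n"
    using delta_seq_power[OF n, of "CARD('d)"] zero_less_card_finite[where 'a='d] by auto
  define s where "s = 3 * sqrt (?d / \<kappa>)"
  have s: "s > 0" using d pos by (simp add: s_def)
  obtain x where x: "\<And>i. i < k \<Longrightarrow> x i \<in> bD" "\<And>i. i < k \<Longrightarrow> norm (x i - q) \<le> 2 * real k * s"
    "\<And>i j. i < k \<Longrightarrow> j < k \<Longrightarrow> i \<noteq> j \<Longrightarrow> s \<le> norm (x i - x j)"
    by (rule frontier_many_separated_points[OF q s, of k]) (use k(2) s_def in auto)
  have capb: "cap z d \<in> sets borel" for z d by (rule borel_compact[OF compact_cap])
  have cd: "0 < c0 * ?d" "c0 * ?d \<le> ?d" using C d by (auto simp: mult_left_le_one_le)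
  define Z where "Z i = void_event M \<Phi> (cap (x i) (c0 * ?d))" for i
  have Zs: "Z i \<in> sets M" for i unfolding Z_def by (rule void_boundsD(3)[OF V capb])
  define K where "K = C * c0 ^ CARD('d)"
  define P where "P = real n powr (- 2 * K)"
  have P0: "P > 0" using n by (simp add: P_def)
  have PZ: "P \<le> prob (Z i)" if i: "i < k" for i
  proof -
    define y where "y = K * (ln (real n) / real n)"
    have y: "0 \<le> y" "y \<le> 1/2" using half C n by (auto simp: y_def K_def)
    have "p (cap (x i) (c0 * ?d)) \<le> C * (c0 * ?d) ^ CARD('d)"
      using cd dr by (intro cp x i) auto
    also have "\<dots> = y" by (simp add: y_def K_def power_mult_distrib d(2))
    finally have py: "p (cap (x i) (c0 * ?d)) \<le> y" .
    have "P = exp (- 2 * y) ^ n"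
      using n by (simp add: P_def powr_def y_def exp_of_nat_mult[symmetric])
    also have "\<dots> \<le> (1 - y) ^ n" by (intro power_mono exp_le_one_minus y) auto
    also have "\<dots> \<le> (1 - p (cap (x i) (c0 * ?d))) ^ n" using py y by (intro power_mono) auto
    also have "\<dots> \<le> prob (Z i)" unfolding Z_def by (rule void_boundsD(4)[OF V capb])
    finally show ?thesis .
  qed
  have sumP: "real k * P \<le> (\<Sum>i<k. prob (Z i))"
    using sum_mono[of "{..<k}" "\<lambda>_. P" "\<lambda>i. prob (Z i)"] PZ by simp
  have kP: "real k * P > 0" using k P0 by simp
  have ss: "2 * sqrt (c0 * ?d / \<kappa>) < s"
  proof -
    have "sqrt (c0 * ?d / \<kappa>) \<le> sqrt (?d / \<kappa>)"
      using cd(2) pos by (intro real_sqrt_le_mono divide_right_mono) auto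
    moreover have "sqrt (?d / \<kappa>) > 0" using d pos by simp
    ultimately show ?thesis unfolding s_def by linarith
  qed
  have "prob {\<omega> \<in> space M. induced_polyhedron D \<rho> (\<Phi> \<omega>) (\<lambda>w. g w * ?d) \<subseteq> D} \<le> prob {\<omega> \<in> space M. \<forall>i\<in>{..<k}. \<omega> \<notin> Z i}"
  proof (rule finite_measure_mono)
    show "{\<omega> \<in> space M. \<forall>i\<in>{..<k}. \<omega> \<notin> Z i} \<in> events"
      using Zs by (intro sets.sets_Collect_finite_All) (auto simp: set_diff_eq[symmetric])
    show "{\<omega> \<in> space M. induced_polyhedron D \<rho> (\<Phi> \<omega>) (\<lambda>w. g w * ?d) \<subseteq> D} \<subseteq> {\<omega> \<in> space M. \<forall>i\<in>{..<k}. \<omega> \<notin> Z i}"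
    proof (rule subsetI, rule ccontr)
      fix \<omega> assume w: "\<omega> \<in> {\<omega> \<in> space M. induced_polyhedron D \<rho> (\<Phi> \<omega>) (\<lambda>w. g w * ?d) \<subseteq> D}"
        and "\<omega> \<notin> {\<omega> \<in> space M. \<forall>i\<in>{..<k}. \<omega> \<notin> Z i}"
      then obtain i where i: "i < k" "\<omega> \<in> Z i" and wM: "\<omega> \<in> space M" by auto
      have "\<not> induced_polyhedron D \<rho> (\<Phi> \<omega>) (\<lambda>w. g w * ?d) \<subseteq> D"
      proof (rule polyhedron_not_inside_if_frontier_point_free[OF void_boundsD(1)[OF V wM] x(1)[OF i(1)]], rule ccontr)
        fix v assume v: "v \<in> \<Phi> \<omega>" and "\<not> g v * ?d < cmod (ell v (v - x i))"
        then have le: "cmod (ell v (v - x i)) \<le> g v * ?d" by simp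
        have vF: "v \<in> bD" using void_boundsD(2)[OF V wM] v by auto
        have "\<kappa> * (norm (v - x i))\<^sup>2 \<le> g v * ?d" using sep[OF vF x(1)[OF i(1)]] le by linarith
        also have "\<dots> \<le> Gm * ?d" using Gm(2)[OF vF] d by (intro mult_right_mono) auto
        finally have "(norm (v - x i))\<^sup>2 \<le> Gm * ?d / \<kappa>" using pos by (simp add: pos_le_divide_eq mult.commute)
        then have "norm (v - x i) \<le> sqrt (Gm * ?d / \<kappa>)" by (rule real_le_rsqrt)
        then have "norm (v - q) < r1"
          using norm_triangle_ineq[of "v - x i" "x i - q"] x(2)[OF i(1)] k(3) by (simp add: s_def)
        then have "g v \<le> c0" by (rule near[OF vF])
        then have "g v * ?d \<le> c0 * ?d" using d by (intro mult_right_mono) auto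
        then have "v \<in> cap (x i) (c0 * ?d)" using le vF by (simp add: cap_def)
        then show False using i(2) v by (auto simp: Z_def void_event_def)
      qed
      then show False using w by auto
    qed
  qed
  also have "\<dots> \<le> 1 / (\<Sum>i<k. prob (Z i))"
  proof (rule second_moment_none)
    fix i j assume ij: "i \<in> {..<k}" "j \<in> {..<k}" "i \<noteq> j"
    have "cap (x i) (c0 * ?d) \<inter> cap (x j) (c0 * ?d) = {}"
      using x(3)[of i j] ij ss cd by (intro caps_disjoint x) auto
    from void_boundsD(6)[OF V capb capb this]
    show "prob (Z i \<inter> Z j) \<le> prob (Z i) * prob (Z j)"
    proof -
      have "Z i \<inter> Z j = void_event M \<Phi> (cap (x i) (c0 * ?d) \<union> cap (x j) (c0 * ?d))"
        by (auto simp: Z_def void_event_def)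
      then show ?thesis using \<open>prob (void_event M \<Phi> (cap (x i) (c0 * ?d) \<union> cap (x j) (c0 * ?d))) \<le> _\<close> by (simp add: Z_def)
    qed
  qed (use Zs sumP kP in auto)
  also have "\<dots> \<le> 1 / (real k * P)" using sumP kP by (intro divide_left_mono) auto
  finally show ?thesis unfolding prob_inside_def P_def K_def .
qed

proposition small_constants_not_inside:
  assumes M: "prob_space M" and V: "\<And>n. n \<ge> 1 \<Longrightarrow> void_bounds M (bD) p n (\<Phi> n)"
    and C: "C > 0" "r > 0" and p0: "\<And>A. p A \<ge> 0"
    and cp: "\<And>z d. z \<in> bD \<Longrightarrow> 0 < d \<Longrightarrow> d \<le> r \<Longrightarrow> p (cap z d) \<le> C * d ^ CARD('d)"
  shows "\<exists>c>0. \<forall>g. positive_continuous_on (bD) g \<longrightarrow> (INF z\<in>bD. g z) < c \<longrightarrow>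
        (\<lambda>n. prob_inside M D \<rho> g n (\<Phi> n)) \<longlonglongrightarrow> 0"
proof -
  let ?d = "real CARD('d)"
  have d0: "CARD('d) > 0" by simp
  \<comment> \<open>Each cap is then missed with probability at least n powr (- 1 / (8 * d)), and there are about
    n powr (1 / (4 * d)) caps.\<close>
  define c0 where "c0 = min 1 (1 / (16 * ?d * C))"
  have c0: "c0 > 0" "c0 \<le> 1" using C by (auto simp: c0_def)
  have "c0 ^ CARD('d) \<le> c0 ^ 1" using c0 d0 by (intro power_decreasing) auto
  then have "C * c0 ^ CARD('d) \<le> C * (1 / (16 * ?d * C))" using C by (intro mult_left_mono) (auto simp: c0_def)
  then have K: "C * c0 ^ CARD('d) \<le> 1 / (16 * ?d)" using C by simp
  define K where "K = C * c0 ^ CARD('d)"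
  show ?thesis
  proof (intro exI[of _ c0] conjI c0 allI impI)
    fix g assume g: "positive_continuous_on (bD) g" and inf: "(INF z\<in>bD. g z) < c0"
    have gc: "continuous_on (bD) g" and gp: "\<And>z. z \<in> bD \<Longrightarrow> g z > 0"
      using g by (auto simp: positive_continuous_on_def)
    have bb: "bdd_below (g ` bD)" using gp by (intro bdd_belowI[of _ 0]) (auto intro: less_imp_le)
    obtain q where q: "q \<in> bD" "g q < c0"
      using inf cINF_less_iff[OF frontier_ne bb] by blast
    obtain r1 where r1: "r1 > 0" "\<And>w. w \<in> bD \<Longrightarrow> dist w q < r1 \<Longrightarrow> dist (g w) (g q) < c0 - g q"
      using gc q unfolding continuous_on_iff by (metis diff_gt_0_iff_gt)
    have near: "g w \<le> c0" if "w \<in> bD" "norm (w - q) < r1" for w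
      using r1(2)[OF that(1)] that(2) by (simp add: dist_norm)
    obtain y where y: "y \<in> bD" "\<And>w. w \<in> bD \<Longrightarrow> g w \<le> g y"
      using continuous_attains_sup[OF compact_frontier frontier_ne gc] by blast
    define Gm where "Gm = g y"
    have Gm: "Gm > 0" "\<And>w. w \<in> bD \<Longrightarrow> g w \<le> Gm" using y gp by (auto simp: Gm_def)
    define k where "k n = nat \<lfloor>real n powr (1 / (4 * ?d))\<rfloor>" for n :: nat
    let ?s = "\<lambda>n. sqrt (delta_seq CARD('d) n)"
    have sq: "3 * sqrt (delta_seq CARD('d) n / \<kappa>) = (3 / sqrt \<kappa>) * ?s n" for n
      by (simp add: real_sqrt_divide)
    have sq2: "sqrt (Gm * delta_seq CARD('d) n / \<kappa>) = (sqrt Gm / sqrt \<kappa>) * ?s n" for n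
      by (simp add: real_sqrt_divide real_sqrt_mult)
    have dlim: "delta_seq CARD('d) \<longlonglongrightarrow> 0" by (rule delta_seq_tendsto_0[OF d0])
    have slim: "?s \<longlonglongrightarrow> 0" using tendsto_real_sqrt[OF dlim] by simp
    have mlim: "(\<lambda>n. real n powr (1 / (4 * ?d)) * ?s n) \<longlonglongrightarrow> 0" by (rule many_small_steps_tendsto_0[OF d0])
    have l1: "(\<lambda>n. (3 / sqrt \<kappa>) * (real n powr (1 / (4 * ?d)) * ?s n)) \<longlonglongrightarrow> 0"
      by (rule tendsto_mult_right_zero[OF mlim])
    have l2: "(\<lambda>n. 2 * ((3 / sqrt \<kappa>) * (real n powr (1 / (4 * ?d)) * ?s n)) + (sqrt Gm / sqrt \<kappa>) * ?s n) \<longlonglongrightarrow> 0"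
      by (intro tendsto_add_zero tendsto_mult_right_zero mlim slim)
    have l3: "(\<lambda>n. K * (ln (real n) / real n)) \<longlonglongrightarrow> 0"
      by (rule tendsto_mult_right_zero[OF lim_ln_over_n])
    have "\<forall>\<^sub>F n in sequentially. delta_seq CARD('d) n < r" using order_tendstoD(2)[OF dlim C(2)] .
    moreover have "\<forall>\<^sub>F n in sequentially. (3 / sqrt \<kappa>) * (real n powr (1 / (4 * ?d)) * ?s n) < \<tau>\<^sup>2"
      using tau by (intro order_tendstoD(2)[OF l1]) auto
    moreover have "\<forall>\<^sub>F n in sequentially. 2 * ((3 / sqrt \<kappa>) * (real n powr (1 / (4 * ?d)) * ?s n)) + (sqrt Gm / sqrt \<kappa>) * ?s n < r1"
      by (rule order_tendstoD(2)[OF l2 r1(1)])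
    moreover have "\<forall>\<^sub>F n in sequentially. K * (ln (real n) / real n) < 1/2"
      by (rule order_tendstoD(2)[OF l3]) simp
    moreover have "\<forall>\<^sub>F n in sequentially. n \<ge> (2::nat)" by (rule eventually_ge_at_top)
    ultimately have bound: "\<forall>\<^sub>F n in sequentially. prob_inside M D \<rho> g n (\<Phi> n) \<le> 2 * real n powr (- (1 / (8 * ?d)))"
    proof eventually_elim
      case (elim n)
      let ?x = "real n powr (1 / (4 * ?d))"
      have n1: "n \<ge> 1" using elim by simp
      have x1: "?x \<ge> 1" using n1 d0 by (intro ge_one_powr_ge_zero) auto
      have kx: "real (k n) \<le> ?x" "?x / 2 \<le> real (k n)" "k n > 0"
      proof -
        have f: "\<lfloor>?x\<rfloor> \<ge> 1" using x1 by linarith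
        then have "real (k n) = of_int \<lfloor>?x\<rfloor>" by (simp add: k_def)
        moreover have "real_of_int \<lfloor>?x\<rfloor> \<ge> 1" using f by simp
        ultimately show "real (k n) \<le> ?x" "?x / 2 \<le> real (k n)" "k n > 0" by linarith+
      qed
      have s0: "?s n \<ge> 0" "3 / sqrt \<kappa> \<ge> 0"
        using pos delta_seq_power(1)[of n "CARD('d)"] elim d0 by (auto simp: less_imp_le)
      have ks: "real (k n) * (3 * sqrt (delta_seq CARD('d) n / \<kappa>)) \<le> (3 / sqrt \<kappa>) * (?x * ?s n)"
      proof -
        have "real (k n) * ((3 / sqrt \<kappa>) * ?s n) \<le> ?x * ((3 / sqrt \<kappa>) * ?s n)"
          using kx s0 by (intro mult_right_mono) auto
        then show ?thesis unfolding sq by (simp only: mult_ac)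
      qed
      have "prob_inside M D \<rho> g n (\<Phi> n) \<le> 1 / (real (k n) * real n powr (- 2 * (C * c0 ^ CARD('d))))"
      proof (rule small_cap_missed[OF M V[OF n1] _ C(1) c0 _ cp p0 _ q(1) near Gm kx(3)])
        show "real (k n) * (3 * sqrt (delta_seq CARD('d) n / \<kappa>)) \<le> \<tau>\<^sup>2" using ks elim by linarith
        show "2 * real (k n) * (3 * sqrt (delta_seq CARD('d) n / \<kappa>)) + sqrt (Gm * delta_seq CARD('d) n / \<kappa>) < r1"
          using ks elim unfolding sq2 by linarith
        show "C * c0 ^ CARD('d) * (ln (real n) / real n) \<le> 1 / 2" using elim by (simp add: K_def)
      qed (use elim in auto)
      also have "\<dots> \<le> 1 / (?x / 2 * real n powr (- (1 / (8 * ?d))))"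
      proof (intro divide_left_mono mult_mono kx)
        show "real n powr (- (1 / (8 * ?d))) \<le> real n powr (- 2 * (C * c0 ^ CARD('d)))"
          using K n1 by (intro powr_mono) auto
        show "0 < real (k n) * real n powr (- 2 * (C * c0 ^ CARD('d))) * (?x / 2 * real n powr (- (1 / (8 * ?d))))"
          using kx x1 n1 by (intro mult_pos_pos) auto
      qed auto
      also have "?x / 2 * real n powr (- (1 / (8 * ?d))) = real n powr (1 / (8 * ?d)) / 2"
      proof -
        have "1 / (4 * ?d) + - (1 / (8 * ?d)) = 1 / (8 * ?d)" using d0 by (simp add: field_simps)
        then show ?thesis by (simp add: powr_add[symmetric])
      qed
      also have "1 / (real n powr (1 / (8 * ?d)) / 2) = 2 * real n powr (- (1 / (8 * ?d)))"
        by (simp add: powr_minus field_simps)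
      finally show ?case .
    qed
    have "(\<lambda>n. real n powr (- (1 / (8 * ?d)))) \<longlonglongrightarrow> 0"
      using d0 by (intro tendsto_neg_powr filterlim_real_sequentially) auto
    then have lim: "(\<lambda>n. 2 * real n powr (- (1 / (8 * ?d)))) \<longlonglongrightarrow> 0" by (rule tendsto_mult_right_zero)
    show "(\<lambda>n. prob_inside M D \<rho> g n (\<Phi> n)) \<longlonglongrightarrow> 0"
      by (rule tendsto_sandwich[OF _ bound tendsto_const lim]) (auto simp: prob_inside_def)
  qed
qed

end

theorem proposition2p6:
  fixes D :: "(complex ^ 'd) set" and \<rho> :: "complex ^ 'd \<Rightarrow> real"
    and f :: "complex ^ 'd \<Rightarrow> real"
    and M :: "'s measure" and W :: "nat \<Rightarrow> 's \<Rightarrow> complex ^ 'd" and N :: "nat \<Rightarrow> 's \<Rightarrow> nat"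
  assumes dim: "CARD('d) \<ge> 2"
    and domain: "strongly_C_convex_domain D \<rho>" and bdd: "bounded D"
    and f_measurable: "f \<in> borel_measurable (surface_measure (frontier D))"
    and f_density: "(\<integral>\<^sup>+ z. ennreal (f z) \<partial>surface_measure (frontier D)) = 1"
    and f_bounds: "\<exists>a>0. \<exists>b. \<forall>z\<in>frontier D. a \<le> f z \<and> f z \<le> b"
    and M: "prob_space M"
    and W: "iid_points M (surface_measure (frontier D)) f W"
    and N: "\<And>n. n \<ge> 1 \<Longrightarrow> poisson_count_indep M (surface_measure (frontier D)) W (real n) (N n)"
  shows "(\<exists>c>0::real. \<forall>g. positive_continuous_on (frontier D) g \<longrightarrow> (INF z\<in>frontier D. g z) < c \<longrightarrow>
        (\<lambda>n. prob_inside M D \<rho> g n (poisson_process W N n)) \<longlonglongrightarrow> 0) \<and>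
    (\<forall>\<alpha>>0::real. \<exists>C>0::real. \<forall>g. positive_continuous_on (frontier D) g \<longrightarrow> (INF z\<in>frontier D. g z) > C \<longrightarrow>
        (\<lambda>n. 1 - prob_inside M D \<rho> g n (poisson_process W N n)) \<in> O(\<lambda>n. real n powr (- \<alpha>))) \<and>
    (\<exists>c>0::real. \<forall>g. positive_continuous_on (frontier D) g \<longrightarrow> (INF z\<in>frontier D. g z) < c \<longrightarrow>
        (\<lambda>n. prob_inside M D \<rho> g n (binomial_process W n)) \<longlonglongrightarrow> 0) \<and>
    (\<forall>\<alpha>>0::real. \<exists>C>0::real. \<forall>g. positive_continuous_on (frontier D) g \<longrightarrow> (INF z\<in>frontier D. g z) > C \<longrightarrow>
        (\<lambda>n. 1 - prob_inside M D \<rho> g n (binomial_process W n)) \<in> O(\<lambda>n. real n powr (- \<alpha>)))"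
proof -
  obtain L K m \<kappa> where "separated_hypersurface D \<rho> L K m \<kappa>"
    using bounded_C_convex_domain.boundary_separated_hypersurface domain bdd
    unfolding bounded_C_convex_domain_def by blast
  then interpret separated_hypersurface D \<rho> L K m \<kappa> .
  have Sb: "frontier D \<in> sets borel" using compact_frontier by (rule borel_compact)
  interpret prob_space M by (rule M)
  interpret iid_process M "frontier D" "surface_measure (frontier D)" f W
  proof
    show "space (surface_measure (frontier D)) = frontier D" by (rule space_surface_measure)
    show "A \<inter> frontier D \<in> sets (surface_measure (frontier D))" if "A \<in> sets borel" for A
      using that Sb by (intro sets_surface_measure_iff) auto
  qed (use Sb W in auto)
  obtain a b where a: "a > 0" and ab: "\<And>z. z \<in> frontier D \<Longrightarrow> a \<le> f z \<and> f z \<le> b"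
    using f_bounds by blast
  have b: "b > 0" using frontier_ne ab a by force
  have X: "distributed M (surface_measure (frontier D)) (W 0) (\<lambda>z. ennreal (f z))"
    using W by (simp add: iid_points_def)
  have dim_eq: "DIM(complex ^ 'd) - 1 = 2 * CARD('d) - 1" by simp
  note pb = distributed_prob_bounds[OF M X f_density Sb _ _ ab a, unfolded dim_eq, folded hit_def]
  obtain c C r where c: "c > 0" "C > 0" "r > 0"
    and lo: "\<And>z \<delta>. z \<in> frontier D \<Longrightarrow> 0 < \<delta> \<Longrightarrow> \<delta> \<le> r \<Longrightarrow> c * \<delta> ^ CARD('d) \<le> hit (cap z \<delta>)"
    and up: "\<And>z \<delta>. z \<in> frontier D \<Longrightarrow> 0 < \<delta> \<Longrightarrow> \<delta> \<le> r \<Longrightarrow> hit (cap z \<delta>) \<le> C * \<delta> ^ CARD('d)"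
    using cap_probability_bounds[OF a b pb hit_bounds(1)] by blast
  have VP: "\<And>n. n \<ge> 1 \<Longrightarrow> void_bounds M (frontier D) hit n (poisson_process W N n)"
    by (rule poisson_void_bounds[OF N]) auto
  have VB: "\<And>n. n \<ge> 1 \<Longrightarrow> void_bounds M (frontier D) hit n (binomial_process W n)"
    by (rule binomial_void_bounds)
  note small = small_constants_not_inside[OF M _ c(2,3) hit_bounds(1) up]
  note large = large_constants_inside[OF M _ c(1,3) lo]
  show ?thesis
    using small[of "poisson_process W N"] small[of "binomial_process W"]
      large[of "poisson_process W N"] large[of "binomial_process W"] VP VB by blast
qed


end
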